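(* Let $n\ge2$, $p>n$ and $s_0\in(\frac np,1)$. (a) There exists a constant $C$, independent of $s$ and $f$, such that for every $s\in(s_0,1)$ and every $f\in W^{s,p}$ with $|\operatorname{supp} f|<\infty$, $$\|f\|_{L^\infty}\le C\,|\operatorname{supp}f|^{\frac sn-\frac1p}(1-s)^{\frac1p}\,|\Pi^{*,s}_pf|^{-\frac sn}.$$ (b) There is a constant $c$ depending only on $n$ and $p$ such that for every nonzero $f\in W^1_p$ with $|\operatorname{supp}f|<\infty$ and every $s\in(0,1)$, $$(s(1-s))^{\frac1p}|\operatorname{supp}f|^{\frac sn}|\Pi^{*,s}_pf|^{-\frac sn}\le c\,|\operatorname{supp}f|^{\frac1n}|\Pi^*_pf|^{-\frac1n}.$$ (c) For every such $f$, $$\lim_{s\to1-}(1-s)^{\frac1p}|\operatorname{supp}f|^{\frac sn-\frac1p}|\Pi^{*,s}_pf|^{-\frac sn}=p^{-\frac1p}|\operatorname{supp}f|^{\frac1n-\frac1p}|\Pi^*_pf|^{-\frac1n}.$$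
   Context: $\Delta_hf(x)=f(x+h)-f(x)$. $W^{s,p}$ ($s\in(0,1)$) is the space of $f\in L^p$ with finite Gagliardo seminorm $\|f\|_{W^{s,p}}=(\int\int\frac{|f(x)-f(y)|^p}{|x-y|^{sp+n}}dxdy)^{1/p}$. The fractional polar projection body $\Pi^{*,s}_pf$ is the star-shaped set with gauge $\|\xi\|^{sp}_{\Pi^{*,s}_pf}=\int_0^\infty t^{-sp}\int_{\mathbb{R}^n}|f(x+t\xi)-f(x)|^pdx\frac{dt}{t}$. $\Pi^*_pf$ is the star body with gauge $\|\xi\|^p_{\Pi^*_pf}=\int|\nabla f(x)\cdot\xi|^pdx$. Volume of a star-shaped set $K$: $|K|=\frac1n\int_{\mathbb{S}^{n-1}}\|\xi\|_K^{-n}d\sigma(\xi)$. *)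

theory Defs
  imports "HOL-Analysis.Analysis" "HOL-Probability.Essential_Supremum"
begin

definition Lp_fun :: "real \<Rightarrow> ('a::euclidean_space \<Rightarrow> real) \<Rightarrow> bool" where
  "Lp_fun p f \<longleftrightarrow> f \<in> borel_measurable lebesgue \<and> integrable lebesgue (\<lambda>x. \<bar>f x\<bar> powr p)"

text \<open>Support set of f; its volume is the Lebesgue measure (a.e.-invariant).\<close>
definition supp_set :: "('a::euclidean_space \<Rightarrow> real) \<Rightarrow> 'a set" where
  "supp_set f = {x. f x \<noteq> 0}"

definition Linf_norm :: "('a::euclidean_space \<Rightarrow> real) \<Rightarrow> ereal" where
  "Linf_norm f = esssup lebesgue (\<lambda>x. ereal \<bar>f x\<bar>)"

definition gagliardo :: "real \<Rightarrow> real \<Rightarrow> ('a::euclidean_space \<Rightarrow> real) \<Rightarrow> ennreal" where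
  "gagliardo s p f = (\<integral>\<^sup>+ x. \<integral>\<^sup>+ y. ennreal (\<bar>f x - f y\<bar> powr p / norm (x - y) powr (s * p + real DIM('a))) \<partial>lebesgue \<partial>lebesgue)"

definition W_frac :: "real \<Rightarrow> real \<Rightarrow> ('a::euclidean_space \<Rightarrow> real) \<Rightarrow> bool" where
  "W_frac s p f \<longleftrightarrow> Lp_fun p f \<and> gagliardo s p f < \<infinity>"

text \<open>The sp-th power of the gauge of the fractional polar projection body.\<close>
definition frac_gauge_pow :: "real \<Rightarrow> real \<Rightarrow> ('a::euclidean_space \<Rightarrow> real) \<Rightarrow> 'a \<Rightarrow> ennreal" where
  "frac_gauge_pow s p f \<xi> = (\<integral>\<^sup>+ t. indicator {0<..} t * ennreal (t powr (- s * p) / t) *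
       (\<integral>\<^sup>+ x. ennreal (\<bar>f (x + t *\<^sub>R \<xi>) - f x\<bar> powr p) \<partial>lebesgue) \<partial>lebesgue)"

text \<open>The star-shaped set with that gauge: {xi. gauge(xi) <= 1}, equivalently gauge^{sp} <= 1.\<close>
definition frac_polar_proj_body :: "real \<Rightarrow> real \<Rightarrow> ('a::euclidean_space \<Rightarrow> real) \<Rightarrow> 'a set" where
  "frac_polar_proj_body s p f = {\<xi>. frac_gauge_pow s p f \<xi> \<le> 1}"

definition vol :: "'a::euclidean_space set \<Rightarrow> real" where
  "vol K = measure lebesgue K"

coinductive smooth_fun :: "('a::euclidean_space \<Rightarrow> real) \<Rightarrow> bool" where
  "(\<forall>x. f differentiable (at x)) \<Longrightarrow>
   (\<forall>i\<in>Basis. smooth_fun (\<lambda>x. frechet_derivative f (at x) i)) \<Longrightarrow> smooth_fun f"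

definition test_fun :: "('a::euclidean_space \<Rightarrow> real) \<Rightarrow> bool" where
  "test_fun \<phi> \<longleftrightarrow> smooth_fun \<phi> \<and> bounded {x. \<phi> x \<noteq> 0}"

definition weak_gradient :: "('a::euclidean_space \<Rightarrow> real) \<Rightarrow> ('a \<Rightarrow> 'a) \<Rightarrow> bool" where
  "weak_gradient f g \<longleftrightarrow> (\<forall>\<phi>. test_fun \<phi> \<longrightarrow> (\<forall>i\<in>Basis.
      (\<integral>x. f x * frechet_derivative \<phi> (at x) i \<partial>lebesgue) = - (\<integral>x. (g x \<bullet> i) * \<phi> x \<partial>lebesgue)))"

definition W1p_grad :: "real \<Rightarrow> ('a::euclidean_space \<Rightarrow> real) \<Rightarrow> ('a \<Rightarrow> 'a) \<Rightarrow> bool" where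
  "W1p_grad p f g \<longleftrightarrow> Lp_fun p f \<and> g \<in> borel_measurable lebesgue \<and>
      integrable lebesgue (\<lambda>x. norm (g x) powr p) \<and> weak_gradient f g"

definition polar_proj_body :: "real \<Rightarrow> ('a::euclidean_space \<Rightarrow> 'a) \<Rightarrow> 'a set" where
  "polar_proj_body p g = {\<xi>. (\<integral>\<^sup>+ x. ennreal (\<bar>g x \<bullet> \<xi>\<bar> powr p) \<partial>lebesgue) \<le> 1}"

end

theory Submission
  imports Defs "HOL-Probability.Probability_Measure"
begin

text \<open>
  Let \<open>\<phi>(z)\<close> be the \<open>p\<close>-th power of the \<open>L\<^sup>p\<close> norm of \<open>f(\<cdot> + z) - f\<close>, so that the fractional gauge satisfies
  \<open>H(\<xi>) = \<integral>\<^sub>0\<^sup>\<infinity> t powr (- s p - 1) \<phi>(t \<xi>) dt\<close>. Since \<open>\<phi>(z + w) \<le> 2 powr (p - 1) (\<phi>(z) + \<phi>(w))\<close>, the sets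
  \<open>{H \<le> r powr (s p)}\<close> behave like balls of a quasi-norm with volume \<open>r\<^sup>n |K|\<close>, and
  summing over dyadic scales gives \<open>\<phi>(\<xi>) \<le> C (1 - s) H(\<xi>)\<close>. Part (a) then is Campanato's proof of
  Morrey's inequality with these balls in place of Euclidean ones: neither rearrangement
  nor convexity of the body is needed.

  For the other parts, \<open>f(x + z) - f(x) = \<integral>\<^sub>0\<^sup>1 \<nabla>f(x + t z) \<bullet> z dt\<close> almost everywhere, so
  \<open>\<phi>(z) \<le> \<integral> |\<nabla>f \<bullet> z| powr p\<close>, and \<open>\<phi>(t \<xi>) / t powr p\<close> has lower limit at least \<open>\<integral> |\<nabla>f \<bullet> \<xi>| powr p\<close> as \<open>t \<rightarrow> 0\<close>.
  Splitting the integral in \<open>H\<close> at the optimal \<open>t\<close> bounds \<open>H\<close> by the gradient gauge and the norm of \<open>f\<close>;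
  the latter is absorbed by a Poincare inequality, which holds because \<open>f\<close> vanishes on at least half of
  any set of measure twice that of its support. For (c), the sets \<open>{p (1 - s) H \<le> 1}\<close> contain dilates of
  the polar projection body with factor tending to 1, their indicators converge to zero outside of it, and
  they lie in a common set of finite measure.
\<close>

section \<open>Shift energies\<close>

text \<open>Uniformity in s of (a) has two sources. The factor 1 - s in the pointwise bound of the
  shift energy by the gauge is kept through all later estimates. Oscillations between consecutive
  dyadic balls shrink by the ratio 2 powr (- (s - n/p)), which is at most 2 powr (- (s0 - n/p)) < 1,
  so the telescoping sum is bounded by a number that depends on s0 but not on s. Campanato's
  argument bounds differences of averages; an absolute bound needs a scale at which the average
  itself is small. This is the radius R with R^n |K| = 2 |supp f|: f vanishes on at least half of
  every translate of that ball. \<open>vol\<close> is a real number, so an infinite measure reads as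
  0, and 0 \<open>powr\<close> a is 0. An upper bound by a negative power of |K| would then claim
  too much, so (a) requires a proof of 0 < |K| < infinity: finiteness comes from the finite support,
  positivity from the finite Gagliardo seminorm.\<close>

lemma abs_powr_convex:
  fixes p :: real
  assumes "p \<ge> 1"
  shows "convex_on UNIV (\<lambda>x::real. \<bar>x\<bar> powr p)"
proof (rule convex_onI)
  fix t x y :: real
  assume t: "0 < t" "t < 1"
  have small: "u powr p \<le> u" if "0 < u" "u < 1" for u :: real
    using powr_mono'[of 1 p u] that assms by simp
  have ineq: "((1 - t) * a + t * b) powr p \<le> (1 - t) * a powr p + t * b powr p"
    if "a \<ge> 0" "b \<ge> 0" for a b :: real
  \<comment> \<open>\<open>powr_convex\<close> is applied to positive a and b; if one of them is 0,
    the claim reduces to u powr p <= u for u in (0,1).\<close>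
  proof (cases "a = 0 \<or> b = 0")
    case True
    then show ?thesis
      using that t small[of t] small[of "1 - t"] by (auto simp: powr_mult mult_right_mono)
  next
    case False
    then show ?thesis
      using that t convex_onD[OF powr_convex[OF assms], of t a b] by simp
  qed
  have "\<bar>(1 - t) *\<^sub>R x + t *\<^sub>R y\<bar> powr p \<le> ((1 - t) * \<bar>x\<bar> + t * \<bar>y\<bar>) powr p"
    using t assms abs_triangle_ineq[of "(1 - t) * x" "t * y"]
    by (intro powr_mono2) (auto simp: abs_mult)
  also have "\<dots> \<le> (1 - t) * \<bar>x\<bar> powr p + t * \<bar>y\<bar> powr p"
    by (rule ineq) auto
  finally show "\<bar>(1 - t) *\<^sub>R x + t *\<^sub>R y\<bar> powr p \<le> (1 - t) * \<bar>x\<bar> powr p + t * \<bar>y\<bar> powr p" .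
qed simp

lemma abs_add_powr_le:
  fixes a b p :: real
  assumes "p \<ge> 1"
  shows "\<bar>a + b\<bar> powr p \<le> 2 powr (p - 1) * (\<bar>a\<bar> powr p + \<bar>b\<bar> powr p)"
  using convex_onD[OF abs_powr_convex[OF assms], of "1/2" "2 * a" "2 * b"]
  by (simp add: abs_mult powr_mult powr_diff field_simps)

text \<open>Jensen's inequality for \<open>M\<close> normalised to a probability measure
  \<open>N\<close>; undoing the normalisation produces the power p - 1 of the total mass. Null mass,
  where nothing can be normalised, and an infinite right side, where Jensen over the reals does not
  apply, are split off first.\<close>

lemma (in finite_measure) abs_integral_powr_le:
  fixes u :: "'a \<Rightarrow> real"
  assumes p: "p \<ge> 1" and u: "integrable M u"
  shows "ennreal (\<bar>\<integral>x. u x \<partial>M\<bar> powr p) \<le>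
    ennreal (measure M (space M) powr (p - 1)) * (\<integral>\<^sup>+x. ennreal (\<bar>u x\<bar> powr p) \<partial>M)"
proof (cases "measure M (space M) = 0 \<or> (\<integral>\<^sup>+x. ennreal (\<bar>u x\<bar> powr p) \<partial>M) = \<infinity>")
  case True
  show ?thesis
  proof (cases "measure M (space M) = 0")
    case True
    then have "emeasure M (space M) = 0" by (simp add: emeasure_eq_measure)
    then have "(\<integral>x. u x \<partial>M) = 0"
      by (intro integral_eq_zero_AE AE_I[of _ _ "space M"]) auto
    then show ?thesis by simp
  next
    case False
    with True show ?thesis by (simp add: ennreal_mult_top)
  qed
next
  case False
  define m where "m = measure M (space M)"
  have m: "m > 0" using False by (simp add: m_def zero_less_measure_iff)
  have um [measurable]: "u \<in> borel_measurable M" using u by auto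
  have int: "integrable M (\<lambda>x. \<bar>u x\<bar> powr p)"
    using False by (intro integrableI_nonneg) (auto simp: less_top)
  define N where "N = density M (\<lambda>_. ennreal (1 / m))"
  have "emeasure N (space N) = ennreal (1 / m) * ennreal m"
    by (simp add: N_def emeasure_density m_def emeasure_eq_measure)
  also have "\<dots> = 1" using m by (simp add: ennreal_mult[symmetric])
  finally interpret N: prob_space N by (intro prob_spaceI) simp
  have eN: "(\<integral>x. v x \<partial>N) = (\<integral>x. v x \<partial>M) / m" if [measurable]: "v \<in> borel_measurable M" for v :: "'a \<Rightarrow> real"
    using m unfolding N_def by (subst integral_density) auto
  have iN: "integrable N v" if "integrable M v" for v :: "'a \<Rightarrow> real"
    using m that unfolding N_def by (subst integrable_density) (auto dest: borel_measurable_integrable)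
  have "\<bar>\<integral>x. u x \<partial>N\<bar> powr p \<le> (\<integral>x. \<bar>u x\<bar> powr p \<partial>N)"
    by (rule N.jensens_inequality[where I = UNIV]) (auto intro: iN u int abs_powr_convex[OF p])
  then have "\<bar>\<integral>x. u x \<partial>M\<bar> powr p / m powr p \<le> (\<integral>x. \<bar>u x\<bar> powr p \<partial>M) / m"
    using m by (simp add: eN powr_divide)
  then have "\<bar>\<integral>x. u x \<partial>M\<bar> powr p \<le> m powr (p - 1) * (\<integral>x. \<bar>u x\<bar> powr p \<partial>M)"
    using m by (simp add: powr_diff field_simps)
  moreover have "(\<integral>\<^sup>+x. ennreal (\<bar>u x\<bar> powr p) \<partial>M) = ennreal (\<integral>x. \<bar>u x\<bar> powr p \<partial>M)"
    by (rule nn_integral_eq_integral[OF int]) auto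
  ultimately show ?thesis
    by (simp add: m_def ennreal_mult[symmetric] integral_nonneg_AE del: ennreal_le_iff) (auto intro: ennreal_leI)
qed

section \<open>Dilations and translations of Lebesgue measure\<close>

lemma nn_integral_lborel_scaleR:
  fixes f :: "'a::euclidean_space \<Rightarrow> ennreal"
  assumes [measurable]: "f \<in> borel_measurable borel" and "r \<noteq> 0"
  shows "(\<integral>\<^sup>+x. f x \<partial>lborel) = ennreal (\<bar>r\<bar> ^ DIM('a)) * (\<integral>\<^sup>+x. f (r *\<^sub>R x) \<partial>lborel)"
  by (subst lborel_affine[OF assms(2), of 0])
     (simp add: nn_integral_density nn_integral_distr nn_integral_cmult)

lemma nn_integral_lborel_translate:
  fixes f :: "'a::euclidean_space \<Rightarrow> ennreal"
  assumes [measurable]: "f \<in> borel_measurable borel"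
  shows "(\<integral>\<^sup>+x. f (x + a) \<partial>lborel) = (\<integral>\<^sup>+x. f x \<partial>lborel)"
  by (subst (2) lborel_affine[of 1 a])
     (simp_all add: nn_integral_density nn_integral_distr add.commute)

lemma AE_lborel_translate:
  fixes P :: "'a::euclidean_space \<Rightarrow> bool"
  assumes "AE x in lborel. P x"
  shows "AE x in lborel. P (x + a)"
proof -
  obtain N where N: "N \<in> null_sets lborel" "{x. \<not> P x} \<subseteq> N"
    using assms unfolding eventually_ae_filter by auto
  show ?thesis
    using null_sets_translation[OF N(1), of "-a"] N(2)
    by (intro AE_I'[of "{x. x - (-a) \<in> N}"]) auto
qed

lemma emeasure_lborel_scaleR:
  fixes S :: "'a::euclidean_space set"
  assumes [measurable]: "S \<in> sets borel" and "r > 0"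
  shows "emeasure lborel {x. x /\<^sub>R r \<in> S} = ennreal (r ^ DIM('a)) * emeasure lborel S"
proof -
  have "emeasure lborel {x. x /\<^sub>R r \<in> S} = (\<integral>\<^sup>+x. indicator {x. x /\<^sub>R r \<in> S} x \<partial>lborel)"
    by (rule nn_integral_indicator[symmetric]) measurable
  also have "\<dots> = (\<integral>\<^sup>+x. indicator S (x /\<^sub>R r) \<partial>lborel)"
    by (intro nn_integral_cong) (auto split: split_indicator)
  also have "\<dots> = ennreal (r ^ DIM('a)) * (\<integral>\<^sup>+x. indicator S x \<partial>lborel)"
    using assms(2) by (subst nn_integral_lborel_scaleR[of _ r]) auto
  finally show ?thesis by simp
qed

abbreviation Lp_pow :: "real \<Rightarrow> ('a::euclidean_space \<Rightarrow> real) \<Rightarrow> ennreal" where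
  "Lp_pow p f \<equiv> \<integral>\<^sup>+x. ennreal (\<bar>f x\<bar> powr p) \<partial>lborel"

text \<open>For a weak gradient g this is the p-th power of the gauge of the polar projection body
  at \<open>\<xi>\<close>.\<close>

abbreviation grad_energy :: "real \<Rightarrow> ('a::euclidean_space \<Rightarrow> 'a) \<Rightarrow> 'a \<Rightarrow> ennreal" where
  "grad_energy p g \<xi> \<equiv> \<integral>\<^sup>+x. ennreal (\<bar>g x \<bullet> \<xi>\<bar> powr p) \<partial>lborel"

text \<open>The function phi of the overview, valued in \<open>ennreal\<close> so that no
  integrability hypothesis accompanies it.\<close>

definition shift_energy :: "real \<Rightarrow> ('a::euclidean_space \<Rightarrow> real) \<Rightarrow> 'a \<Rightarrow> ennreal" where
  "shift_energy p f z = (\<integral>\<^sup>+x. ennreal (\<bar>f (x + z) - f x\<bar> powr p) \<partial>lborel)"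

lemma frac_gauge_pow_eq_shift_energy:
  "frac_gauge_pow s p f \<xi> =
    (\<integral>\<^sup>+t. indicator {0<..} t * ennreal (t powr (- s * p) / t) * shift_energy p f (t *\<^sub>R \<xi>) \<partial>lborel)"
  by (simp add: frac_gauge_pow_def shift_energy_def nn_integral_completion)

lemma shift_energy_cong_AE:
  assumes "AE x in lborel. f x = g x"
  shows "shift_energy p f = shift_energy p g"
proof
  fix z
  show "shift_energy p f z = shift_energy p g z"
    unfolding shift_energy_def
    using assms AE_lborel_translate[OF assms, of z] by (intro nn_integral_cong_AE) auto
qed

lemma shift_energy_measurable [measurable]:
  assumes [measurable]: "f \<in> borel_measurable borel"
  shows "shift_energy p f \<in> borel_measurable borel"
proof -
  have "(\<lambda>z. \<integral>\<^sup>+x. ennreal (\<bar>f (x + z) - f x\<bar> powr p) \<partial>lborel) \<in> borel_measurable lborel"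
    by measurable
  then show ?thesis unfolding shift_energy_def[abs_def] by simp
qed

text \<open>Insert f(x + w) between the two values and split by \<open>abs_add_powr_le\<close>; the
  increment based at x + w is moved back to x by translation invariance. The constant is 2 powr (p -
  1) because p-th powers are split, not norms.\<close>

lemma shift_energy_add_le:
  assumes [measurable]: "f \<in> borel_measurable borel" and p: "p \<ge> 1"
  shows "shift_energy p f (z + w) \<le> ennreal (2 powr (p - 1)) * (shift_energy p f z + shift_energy p f w)"
proof -
  have "shift_energy p f (z + w) \<le>
    (\<integral>\<^sup>+x. ennreal (2 powr (p - 1)) * (ennreal (\<bar>f ((x + w) + z) - f (x + w)\<bar> powr p) + ennreal (\<bar>f (x + w) - f x\<bar> powr p)) \<partial>lborel)"
    unfolding shift_energy_def
  proof (rule nn_integral_mono)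
    fix x
    have "\<bar>f (x + (z + w)) - f x\<bar> powr p \<le>
        2 powr (p - 1) * (\<bar>f ((x + w) + z) - f (x + w)\<bar> powr p + \<bar>f (x + w) - f x\<bar> powr p)"
      using abs_add_powr_le[OF p, of "f ((x + w) + z) - f (x + w)" "f (x + w) - f x"]
      by (simp add: algebra_simps)
    then have "ennreal (\<bar>f (x + (z + w)) - f x\<bar> powr p) \<le>
        ennreal (2 powr (p - 1) * (\<bar>f ((x + w) + z) - f (x + w)\<bar> powr p + \<bar>f (x + w) - f x\<bar> powr p))"
      by (rule ennreal_leI)
    then show "ennreal (\<bar>f (x + (z + w)) - f x\<bar> powr p) \<le> ennreal (2 powr (p - 1)) *
       (ennreal (\<bar>f ((x + w) + z) - f (x + w)\<bar> powr p) + ennreal (\<bar>f (x + w) - f x\<bar> powr p))"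
      by (simp add: ennreal_mult)
  qed
  also have "\<dots> = ennreal (2 powr (p - 1)) * ((\<integral>\<^sup>+x. ennreal (\<bar>f ((x + w) + z) - f (x + w)\<bar> powr p) \<partial>lborel) + shift_energy p f w)"
    by (simp add: nn_integral_cmult nn_integral_add shift_energy_def)
  also have "(\<integral>\<^sup>+x. ennreal (\<bar>f ((x + w) + z) - f (x + w)\<bar> powr p) \<partial>lborel) = shift_energy p f z"
    unfolding shift_energy_def
    by (rule nn_integral_lborel_translate[of "\<lambda>x. ennreal (\<bar>f (x + z) - f x\<bar> powr p)"]) measurable
  finally show ?thesis .
qed

lemma shift_energy_minus:
  assumes [measurable]: "f \<in> borel_measurable borel"
  shows "shift_energy p f (- z) = shift_energy p f z"
proof -
  have "shift_energy p f (- z) = (\<integral>\<^sup>+x. ennreal (\<bar>f ((x + z) + - z) - f (x + z)\<bar> powr p) \<partial>lborel)"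
    unfolding shift_energy_def
    by (rule nn_integral_lborel_translate[symmetric, of "\<lambda>x. ennreal (\<bar>f (x + - z) - f x\<bar> powr p)"]) measurable
  also have "\<dots> = shift_energy p f z"
    by (simp add: shift_energy_def abs_minus_commute)
  finally show ?thesis .
qed

text \<open>The growth factor 2 powr p competes with the factor 2 powr (- s p) that the gauge weight
  gains under doubling; their product 2 powr (p (1 - s)) tends to 1 as s does.\<close>

lemma shift_energy_double_le:
  assumes f: "f \<in> borel_measurable borel" and p: "p \<ge> 1"
  shows "shift_energy p f (2 *\<^sub>R z) \<le> ennreal (2 powr p) * shift_energy p f z"
proof -
  have "shift_energy p f (z + z) \<le> ennreal (2 powr (p - 1)) * (shift_energy p f z + shift_energy p f z)"
    by (rule shift_energy_add_le[OF f p])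
  also have "\<dots> = ennreal (2 powr (p - 1)) * 2 * shift_energy p f z"
    by (simp add: mult_2 mult.assoc)
  also have "ennreal (2 powr (p - 1)) * 2 = ennreal (2 powr (p - 1) * 2)"
    by (simp add: ennreal_mult)
  also have "2 powr (p - 1) * 2 = (2::real) powr p"
    by (simp add: powr_diff)
  finally show ?thesis by (simp add: scaleR_2)
qed

text \<open>Controls long shifts in the gauge integral, where the gradient bound t powr p grows too
  fast to be integrated against the weight.\<close>

lemma shift_energy_le_norm:
  assumes [measurable]: "f \<in> borel_measurable borel" and p: "p \<ge> 1"
  shows "shift_energy p f z \<le> ennreal (2 powr p) * Lp_pow p f"
proof -
  let ?F = "Lp_pow p f"
  have "shift_energy p f z \<le>
    (\<integral>\<^sup>+x. ennreal (2 powr (p - 1)) * (ennreal (\<bar>f (x + z)\<bar> powr p) + ennreal (\<bar>f x\<bar> powr p)) \<partial>lborel)"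
    unfolding shift_energy_def
  proof (rule nn_integral_mono)
    fix x
    have "ennreal (\<bar>f (x + z) - f x\<bar> powr p) \<le> ennreal (2 powr (p - 1) * (\<bar>f (x + z)\<bar> powr p + \<bar>f x\<bar> powr p))"
      using abs_add_powr_le[OF p, of "f (x + z)" "- f x"] by (intro ennreal_leI) simp
    then show "ennreal (\<bar>f (x + z) - f x\<bar> powr p) \<le> ennreal (2 powr (p - 1)) *
       (ennreal (\<bar>f (x + z)\<bar> powr p) + ennreal (\<bar>f x\<bar> powr p))"
      by (simp add: ennreal_mult)
  qed
  also have "\<dots> = ennreal (2 powr (p - 1)) * ((\<integral>\<^sup>+x. ennreal (\<bar>f (x + z)\<bar> powr p) \<partial>lborel) + ?F)"
    by (simp add: nn_integral_cmult nn_integral_add)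
  also have "(\<integral>\<^sup>+x. ennreal (\<bar>f (x + z)\<bar> powr p) \<partial>lborel) = ?F"
    by (rule nn_integral_lborel_translate[of "\<lambda>x. ennreal (\<bar>f x\<bar> powr p)"]) measurable
  also have "ennreal (2 powr (p - 1)) * (?F + ?F) = ennreal (2 powr (p - 1)) * 2 * ?F"
    by (simp add: mult_2 mult.assoc)
  also have "ennreal (2 powr (p - 1)) * 2 = ennreal (2 powr (p - 1) * 2)"
    by (simp add: ennreal_mult)
  also have "2 powr (p - 1) * 2 = (2::real) powr p"
    by (simp add: powr_diff)
  finally show ?thesis .
qed

text \<open>For fixed \<open>x\<close>, the shifts \<open>z \<in> E\<close> that keep \<open>x + z\<close> inside the support of \<open>f\<close>
  have total measure at most that of the support; every other shift contributes at least \<open>\<bar>f x\<bar> powr p\<close>.\<close>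
lemma norm_le_shift_energy_integral:
  fixes f :: "'a::euclidean_space \<Rightarrow> real"
  assumes [measurable]: "f \<in> borel_measurable borel" "E \<in> sets borel"
  shows "Lp_pow p f * emeasure lborel E \<le>
    (\<integral>\<^sup>+z. indicator E z * shift_energy p f z \<partial>lborel) +
    Lp_pow p f * emeasure lborel (supp_set f)"
proof -
  let ?u = "\<lambda>x. ennreal (\<bar>f x\<bar> powr p)"
  have S [measurable]: "supp_set f \<in> sets borel"
    unfolding supp_set_def by measurable
  have "(\<integral>\<^sup>+x. ?u x \<partial>lborel) * emeasure lborel E = (\<integral>\<^sup>+x. (\<integral>\<^sup>+z. ?u x * indicator E z \<partial>lborel) \<partial>lborel)"
    by (simp add: nn_integral_cmult nn_integral_multc)
  also have "\<dots> \<le> (\<integral>\<^sup>+x. (\<integral>\<^sup>+z. indicator E z * ennreal (\<bar>f (x + z) - f x\<bar> powr p) + ?u x * indicator (supp_set f) (z + x) \<partial>lborel) \<partial>lborel)"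
    by (intro nn_integral_mono) (auto simp: supp_set_def add.commute split: split_indicator)
  also have "\<dots> = (\<integral>\<^sup>+x. (\<integral>\<^sup>+z. indicator E z * ennreal (\<bar>f (x + z) - f x\<bar> powr p) \<partial>lborel) \<partial>lborel) +
      (\<integral>\<^sup>+x. ?u x * (\<integral>\<^sup>+z. indicator (supp_set f) (z + x) \<partial>lborel) \<partial>lborel)"
    by (simp add: nn_integral_add nn_integral_cmult)
  also have "(\<integral>\<^sup>+x. ?u x * (\<integral>\<^sup>+z. indicator (supp_set f) (z + x) \<partial>lborel) \<partial>lborel) =
      (\<integral>\<^sup>+x. ?u x \<partial>lborel) * emeasure lborel (supp_set f)"
    by (subst nn_integral_lborel_translate) (simp_all add: nn_integral_multc)
  also have "(\<integral>\<^sup>+x. (\<integral>\<^sup>+z. indicator E z * ennreal (\<bar>f (x + z) - f x\<bar> powr p) \<partial>lborel) \<partial>lborel) =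
     (\<integral>\<^sup>+z. (\<integral>\<^sup>+x. indicator E z * ennreal (\<bar>f (x + z) - f x\<bar> powr p) \<partial>lborel) \<partial>lborel)"
    by (rule lborel_pair.Fubini') measurable
  also have "\<dots> = (\<integral>\<^sup>+z. indicator E z * shift_energy p f z \<partial>lborel)"
    by (simp add: nn_integral_cmult shift_energy_def)
  finally show ?thesis .
qed

text \<open>In \<open>norm_le_shift_energy_integral\<close> the energy term is at most half of the
  left side and can be absorbed. This one mechanism yields the finite volume of the fractional body,
  the Poincare inequality, and the common set of finite measure used for s -> 1.\<close>

lemma emeasure_small_shift_energy_le:
  fixes f :: "'a::euclidean_space \<Rightarrow> real"
  assumes [measurable]: "f \<in> borel_measurable borel" and E [measurable]: "E \<in> sets borel"
    and F: "Lp_pow p f = ennreal F" "F > 0"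
    and small: "\<And>z. z \<in> E \<Longrightarrow> shift_energy p f z \<le> ennreal (F / 2)"
  shows "emeasure lborel E \<le> 2 * emeasure lborel (supp_set f)"
proof -
  \<comment> \<open>Absorption subtracts a multiple of the measure of the set, which must be finite;
    hence bounded pieces first, then exhaustion of \<open>E\<close> by balls.\<close>
  have bounded_case: "emeasure lborel D \<le> 2 * emeasure lborel (supp_set f)"
    if "bounded D" "D \<subseteq> E" and D [measurable]: "D \<in> sets borel" for D
  proof -
    have "emeasure lborel D < \<infinity>" using \<open>bounded D\<close> by (rule emeasure_bounded_finite)
    then obtain d where d: "d \<ge> 0" "emeasure lborel D = ennreal d"
      by (cases "emeasure lborel D") auto
    have "ennreal F * emeasure lborel D \<le> (\<integral>\<^sup>+z. indicator D z * shift_energy p f z \<partial>lborel) + ennreal F * emeasure lborel (supp_set f)"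
      using norm_le_shift_energy_integral[of f D p] by (simp add: F)
    also have "(\<integral>\<^sup>+z. indicator D z * shift_energy p f z \<partial>lborel) \<le> (\<integral>\<^sup>+z. indicator D z * ennreal (F / 2) \<partial>lborel)"
      using small that by (intro nn_integral_mono) (auto split: split_indicator)
    also have "\<dots> = ennreal (F / 2) * emeasure lborel D"
      by (simp add: nn_integral_multc mult.commute)
    finally have *: "ennreal F * emeasure lborel D \<le> ennreal (F / 2) * emeasure lborel D + ennreal F * emeasure lborel (supp_set f)" 
      by (simp add: add_right_mono)
    show ?thesis
    proof (cases "emeasure lborel (supp_set f)")
      case (real m)
      have "ennreal (F * d) \<le> ennreal (F / 2 * d + F * m)"
        using * F(2) d real by (simp add: ennreal_mult'[symmetric] ennreal_plus[symmetric] del: ennreal_plus)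
      then have "F * d \<le> F / 2 * d + F * m"
        using F(2) d real by (subst (asm) ennreal_le_iff) auto
      then have "F * d \<le> F * (2 * m)" by simp
      then have "d \<le> 2 * m" using F(2) by (simp only: mult_le_cancel_left_pos)
      then have "ennreal d \<le> ennreal (2 * m)" by (rule ennreal_leI)
      then show ?thesis using d real by (simp add: ennreal_mult)
    next
      case top
      then show ?thesis by (simp add: ennreal_mult_top)
    qed
  qed
  have "emeasure lborel E = emeasure lborel (\<Union>n. E \<inter> ball 0 (real n))"
    by (rule arg_cong[where f = "emeasure lborel"]) (auto simp: reals_Archimedean2)
  also have "\<dots> = (SUP n. emeasure lborel (E \<inter> ball 0 (real n)))"
    by (rule SUP_emeasure_incseq[symmetric]) (auto simp: incseq_def)
  also have "\<dots> \<le> 2 * emeasure lborel (supp_set f)"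
    by (intro SUP_least bounded_case) auto
  finally show ?thesis .
qed

section \<open>Fractional gauges\<close>

lemma nn_integral_powr_tail:
  fixes a b :: real
  assumes "a > 0" "b > 0"
  shows "(\<integral>\<^sup>+t. indicator {a..} t * ennreal (t powr (- b) / t) \<partial>lborel) = ennreal (a powr (- b) / b)"
proof -
  have "(\<integral>\<^sup>+t. ennreal (t powr (- b) / t) * indicator {a..} t \<partial>lborel) = ennreal (0 - (- (a powr (- b) / b)))"
  proof (rule nn_integral_FTC_atLeast)
    fix x assume "a \<le> x"
    then have x: "x > 0" using assms by simp
    show "((\<lambda>t. - (t powr (- b) / b)) has_real_derivative x powr (- b) / x) (at x)"
      using x assms by (auto intro!: derivative_eq_intros simp: powr_diff field_simps)
    show "0 \<le> x powr (- b) / x" using x by simp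
  next
    have "((\<lambda>t. - (t powr (- b) / b)) \<longlongrightarrow> - (0 / b)) at_top"
      using assms by (intro tendsto_intros tendsto_neg_powr filterlim_ident) auto
    then show "((\<lambda>t. - (t powr (- b) / b)) \<longlongrightarrow> 0) at_top" by simp
  qed measurable
  then show ?thesis by (simp add: mult.commute)
qed

lemma nn_integral_powr_head:
  fixes T b :: real
  assumes "T > 0" "b > 0"
  shows "(\<integral>\<^sup>+t. indicator {0<..<T} t * ennreal (t powr b / t) \<partial>lborel) = ennreal (T powr b / b)"
proof -
  have "((\<lambda>t. t powr (b - 1)) has_integral (T powr b / b)) {0..T}"
    using has_integral_powr_from_0[of "b - 1" T] assms by simp
  then have "((\<lambda>t. indicator {0<..<T} t * (t powr b / t)) has_integral (T powr b / b)) {0..T}"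
    by (rule has_integral_spike[of "{0, T}", rotated 2]) (auto simp: powr_diff)
  then have "((\<lambda>t. if t \<in> {0..T} then indicator {0<..<T} t * (t powr b / t) else 0) has_integral (T powr b / b)) UNIV"
    by (subst has_integral_restrict_UNIV)
  moreover have "(\<lambda>t. if t \<in> {0..T} then indicator {0<..<T} t * (t powr b / t) else 0) = (\<lambda>t. indicator {0<..<T} t * (t powr b / t))"
    by (auto split: split_indicator)
  ultimately have "((\<lambda>t. indicator {0<..<T} t * (t powr b / t)) has_integral (T powr b / b)) UNIV"
    by simp
  then have "(\<integral>\<^sup>+t. ennreal (indicator {0<..<T} t * (t powr b / t)) \<partial>lborel) = ennreal (T powr b / b)"
    by (intro nn_integral_has_integral_lborel) (auto split: split_indicator)
  moreover have "ennreal (indicator {0<..<T} t * (t powr b / t)) = indicator {0<..<T} t * ennreal (t powr b / t)" for t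
    by (auto split: split_indicator)
  ultimately show ?thesis by simp
qed

lemma frac_gauge_pow_cong_AE:
  assumes "AE x in lborel. f x = g x"
  shows "frac_gauge_pow s p f = frac_gauge_pow s p g"
  by (rule ext) (simp add: frac_gauge_pow_eq_shift_energy shift_energy_cong_AE[OF assms])

lemma frac_gauge_pow_measurable [measurable]:
  fixes f :: "'a::euclidean_space \<Rightarrow> real"
  assumes [measurable]: "f \<in> borel_measurable borel"
  shows "frac_gauge_pow s p f \<in> borel_measurable borel"
proof -
  have "(\<lambda>\<xi>. \<integral>\<^sup>+t. indicator {0<..} t * ennreal (t powr (- s * p) / t) * shift_energy p f (t *\<^sub>R \<xi>) \<partial>lborel) \<in> borel_measurable lborel"
    by measurable
  then show ?thesis by (simp add: frac_gauge_pow_eq_shift_energy[abs_def])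
qed

lemma frac_polar_proj_body_sets [measurable]:
  assumes [measurable]: "f \<in> borel_measurable borel"
  shows "frac_polar_proj_body s p f \<in> sets borel"
  unfolding frac_polar_proj_body_def by measurable

lemma frac_gauge_pow_scaleR:
  fixes f :: "'a::euclidean_space \<Rightarrow> real"
  assumes [measurable]: "f \<in> borel_measurable borel" and r: "r > 0"
  shows "frac_gauge_pow s p f (r *\<^sub>R \<xi>) = ennreal (r powr (s * p)) * frac_gauge_pow s p f \<xi>"
proof -
  have "frac_gauge_pow s p f \<xi> = ennreal \<bar>r\<bar> * (\<integral>\<^sup>+t. indicator {0<..} (0 + r * t) * ennreal ((0 + r * t) powr (- s * p) / (0 + r * t)) * shift_energy p f ((0 + r * t) *\<^sub>R \<xi>) \<partial>lborel)"
    unfolding frac_gauge_pow_eq_shift_energy using r by (intro nn_integral_real_affine) auto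
  also have "\<dots> = ennreal r * (\<integral>\<^sup>+t. ennreal (r powr (- s * p) / r) * (indicator {0<..} t * ennreal (t powr (- s * p) / t) * shift_energy p f (t *\<^sub>R (r *\<^sub>R \<xi>))) \<partial>lborel)"
  proof (rule arg_cong2[where f = "(*)"], goal_cases)
    case 2
    show ?case
    proof (rule nn_integral_cong)
      fix t :: real
      have "ennreal ((r * t) powr (- s * p) / (r * t)) = ennreal (r powr (- s * p) / r) * ennreal (t powr (- s * p) / t)" if "t > 0"
        using r that by (subst ennreal_mult'[symmetric]) (auto simp: powr_mult)
      then show "indicator {0<..} (0 + r * t) * ennreal ((0 + r * t) powr (- s * p) / (0 + r * t)) * shift_energy p f ((0 + r * t) *\<^sub>R \<xi>) =
        ennreal (r powr (- s * p) / r) * (indicator {0<..} t * ennreal (t powr (- s * p) / t) * shift_energy p f (t *\<^sub>R r *\<^sub>R \<xi>))"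
        using r by (cases "t > 0") (auto simp: zero_less_mult_iff mult_ac)
    qed
  qed (use r in auto)
  also have "\<dots> = ennreal r * ennreal (r powr (- s * p) / r) * frac_gauge_pow s p f (r *\<^sub>R \<xi>)"
    by (simp add: nn_integral_cmult frac_gauge_pow_eq_shift_energy mult.assoc)
  also have "ennreal r * ennreal (r powr (- s * p) / r) = ennreal (r powr (- s * p))"
    using r by (simp add: ennreal_mult'[symmetric])
  finally have "frac_gauge_pow s p f \<xi> = ennreal (r powr (- s * p)) * frac_gauge_pow s p f (r *\<^sub>R \<xi>)" .
  then have "ennreal (r powr (s * p)) * frac_gauge_pow s p f \<xi> =
     ennreal (r powr (s * p)) * ennreal (r powr (- s * p)) * frac_gauge_pow s p f (r *\<^sub>R \<xi>)"
    by (simp add: mult.assoc)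
  also have "ennreal (r powr (s * p)) * ennreal (r powr (- s * p)) = 1"
    using r by (simp add: ennreal_mult'[symmetric] powr_add[symmetric])
  finally show ?thesis by simp
qed

lemma frac_gauge_pow_minus:
  assumes "f \<in> borel_measurable borel"
  shows "frac_gauge_pow s p f (- \<xi>) = frac_gauge_pow s p f \<xi>"
  by (simp add: frac_gauge_pow_eq_shift_energy shift_energy_minus[OF assms])

lemma frac_gauge_pow_add_le:
  fixes f :: "'a::euclidean_space \<Rightarrow> real"
  assumes f [measurable]: "f \<in> borel_measurable borel" and p: "p \<ge> 1"
  shows "frac_gauge_pow s p f (\<xi> + \<eta>) \<le> ennreal (2 powr (p - 1)) * (frac_gauge_pow s p f \<xi> + frac_gauge_pow s p f \<eta>)"
proof -
  let ?w = "\<lambda>t::real. indicator {0<..} t * ennreal (t powr (- s * p) / t)"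
  have "frac_gauge_pow s p f (\<xi> + \<eta>) \<le> (\<integral>\<^sup>+t. ennreal (2 powr (p - 1)) * (?w t * shift_energy p f (t *\<^sub>R \<xi>) + ?w t * shift_energy p f (t *\<^sub>R \<eta>)) \<partial>lborel)"
    unfolding frac_gauge_pow_eq_shift_energy
  proof (rule nn_integral_mono)
    fix t :: real
    have "?w t * shift_energy p f (t *\<^sub>R (\<xi> + \<eta>)) \<le> ?w t * (ennreal (2 powr (p - 1)) * (shift_energy p f (t *\<^sub>R \<xi>) + shift_energy p f (t *\<^sub>R \<eta>)))"
      unfolding scaleR_add_right by (intro mult_left_mono shift_energy_add_le f p) auto
    then show "?w t * shift_energy p f (t *\<^sub>R (\<xi> + \<eta>)) \<le> ennreal (2 powr (p - 1)) * (?w t * shift_energy p f (t *\<^sub>R \<xi>) + ?w t * shift_energy p f (t *\<^sub>R \<eta>))"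
      by (simp add: algebra_simps)
  qed
  also have "\<dots> = ennreal (2 powr (p - 1)) * (frac_gauge_pow s p f \<xi> + frac_gauge_pow s p f \<eta>)"
    by (simp add: nn_integral_cmult nn_integral_add frac_gauge_pow_eq_shift_energy)
  finally show ?thesis .
qed

text \<open>Applied with x = p (1 - s), this turns the geometric growth factor minus 1 into a
  multiple of 1 - s. It is 1 - exp(- u) <= u for u = x ln 2, together with ln 2 <= 1.\<close>

lemma two_powr_minus_one_le:
  fixes p x :: real
  assumes "0 \<le> x" "x \<le> p"
  shows "2 powr x - 1 \<le> 2 powr p * x"
proof -
  have "1 - 2 powr (- x) \<le> x * ln 2"
    using exp_ge_add_one_self[of "- x * ln 2"] by (simp add: powr_def)
  also have "\<dots> \<le> x * 1"
    using assms ln_le_minus_one[of "2::real"] by (intro mult_left_mono) auto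
  finally have "2 powr x * (1 - 2 powr (- x)) \<le> 2 powr x * x"
    by (intro mult_left_mono) auto
  also have "\<dots> \<le> 2 powr p * x"
    using assms by (intro mult_right_mono) auto
  finally show ?thesis by (simp add: right_diff_distrib powr_add[symmetric])
qed

text \<open>This is where the factor \<open>1 - s\<close> comes from: \<open>shift_energy p f (2 z) \<le> 2\<^sup>p shift_energy p f z\<close>
  lets every dyadic scale below \<open>\<xi>\<close> contribute to the gauge, and these contributions add up to a
  geometric series of ratio \<open>2 powr (- p (1 - s))\<close>.\<close>
lemma shift_energy_le_frac_gauge_pow:
  fixes f :: "'a::euclidean_space \<Rightarrow> real"
  assumes f [measurable]: "f \<in> borel_measurable borel" and p: "p \<ge> 1" and s: "0 < s" "s < 1"
  shows "shift_energy p f \<xi> \<le> ennreal (3 * 4 powr p * p * (1 - s)) * frac_gauge_pow s p f \<xi>"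
proof -
  define \<Phi> where "\<Phi> t = shift_energy p f (t *\<^sub>R \<xi>)" for t
  have [measurable]: "\<Phi> \<in> borel_measurable borel" unfolding \<Phi>_def[abs_def] by measurable
  define w where "w t = ennreal (t powr (- s * p) / t)" for t :: real
  have [measurable]: "w \<in> borel_measurable borel" unfolding w_def[abs_def] by measurable
  \<comment> \<open>The window (1/3, 2/3) is one dyadic block, so that (0, 1/3) and the window
    together make up the dilate (0, 2/3) of (0, 1/3), up to a point; and it is symmetric about 1/2,
    so that t and 1 - t lie in it together.\<close>
  define J where "J = (\<integral>\<^sup>+t. indicator {0<..<1/3} t * w t * \<Phi> t \<partial>lborel)"
  define L where "L = (\<integral>\<^sup>+t. indicator {1/3<..<2/3} t * w t * \<Phi> t \<partial>lborel)"
  have J_le: "J \<le> frac_gauge_pow s p f \<xi>"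
    unfolding J_def frac_gauge_pow_eq_shift_energy w_def \<Phi>_def
    by (intro nn_integral_mono) (auto split: split_indicator)
  \<comment> \<open>Substituting 2 t for t gains 2 powr (- s p) from weight and measure and at most
    2 powr p from the energy. The resulting J + L <= 2 powr (p (1 - s)) J is the geometric series in
    closed form: L is at most (2 powr (p (1 - s)) - 1) J.\<close>
  have "J + L = (\<integral>\<^sup>+t. indicator {0<..<1/3} t * w t * \<Phi> t + indicator {1/3<..<2/3} t * w t * \<Phi> t \<partial>lborel)"
    unfolding J_def L_def by (rule nn_integral_add[symmetric]) auto
  also have "\<dots> \<le> (\<integral>\<^sup>+t. indicator {0<..<2/3} t * w t * \<Phi> t \<partial>lborel)"
    by (intro nn_integral_mono) (auto split: split_indicator)
  also have "\<dots> = ennreal \<bar>2\<bar> * (\<integral>\<^sup>+t. indicator {0<..<2/3} (0 + 2 * t) * w (0 + 2 * t) * \<Phi> (0 + 2 * t) \<partial>lborel)"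
    by (rule nn_integral_real_affine) auto
  also have "\<dots> \<le> ennreal \<bar>2\<bar> * (\<integral>\<^sup>+t. ennreal (2 powr (- s * p) / 2 * 2 powr p) * (indicator {0<..<1/3} t * w t * \<Phi> t) \<partial>lborel)"
  proof (intro mult_left_mono nn_integral_mono)
    fix t :: real
    show "indicator {0<..<2/3} (0 + 2 * t) * w (0 + 2 * t) * \<Phi> (0 + 2 * t) \<le>
       ennreal (2 powr (- s * p) / 2 * 2 powr p) * (indicator {0<..<1/3} t * w t * \<Phi> t)"
    proof (cases "t \<in> {0<..<1/3}")
      case True
      have "w (2 * t) = ennreal (2 powr (- s * p) / 2) * w t"
        using True by (simp add: w_def powr_mult ennreal_mult'[symmetric])
      moreover have "\<Phi> (2 * t) \<le> ennreal (2 powr p) * \<Phi> t"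
        using shift_energy_double_le[OF f p, of "t *\<^sub>R \<xi>"] by (simp add: \<Phi>_def)
      ultimately have "w (2 * t) * \<Phi> (2 * t) \<le> (ennreal (2 powr (- s * p) / 2) * w t) * (ennreal (2 powr p) * \<Phi> t)"
        by (simp add: mult_left_mono)
      also have "\<dots> = ennreal (2 powr (- s * p) / 2 * 2 powr p) * (w t * \<Phi> t)"
        by (subst ennreal_mult) (auto simp: mult_ac)
      finally show ?thesis using True by simp
    qed (auto split: split_indicator)
  qed simp
  also have "\<dots> = ennreal 2 * ennreal (2 powr (- s * p) / 2 * 2 powr p) * J"
    by (simp add: J_def nn_integral_cmult mult.assoc)
  also have "ennreal 2 * ennreal (2 powr (- s * p) / 2 * 2 powr p) = ennreal (2 * (2 powr (- s * p) / 2 * 2 powr p))"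
    by (rule ennreal_mult[symmetric]) auto
  also have "2 * (2 powr (- s * p) / 2 * 2 powr p) = 2 powr (p * (1 - s))"
    by (simp add: powr_add[symmetric] algebra_simps)
  finally have JL: "J + L \<le> ennreal (2 powr (p * (1 - s))) * J" .

  \<comment> \<open>Average over t in the window the splitting of \<open>\<xi>\<close> into t
    \<open>\<xi>\<close> and (1 - t) \<open>\<xi>\<close>. By symmetry of the window both parts have
    the same integral, and there the weight is at least 1.\<close>
  have "shift_energy p f \<xi> * ennreal (1/3) = (\<integral>\<^sup>+t. indicator {1/3<..<2/3::real} t * shift_energy p f \<xi> \<partial>lborel)"
    by (subst nn_integral_multc) (auto simp: mult.commute)
  also have "\<dots> \<le> (\<integral>\<^sup>+t. ennreal (2 powr (p - 1)) * (indicator {1/3<..<2/3} t * \<Phi> t + indicator {1/3<..<2/3} t * \<Phi> (1 - t)) \<partial>lborel)"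
  proof (rule nn_integral_mono)
    fix t :: real
    show "indicator {1/3<..<2/3} t * shift_energy p f \<xi> \<le> ennreal (2 powr (p - 1)) * (indicator {1/3<..<2/3} t * \<Phi> t + indicator {1/3<..<2/3} t * \<Phi> (1 - t))"
      using shift_energy_add_le[OF f p, of "t *\<^sub>R \<xi>" "(1 - t) *\<^sub>R \<xi>"]
      by (auto simp: \<Phi>_def scaleR_left.diff split: split_indicator)
  qed
  also have "\<dots> = ennreal (2 powr (p - 1)) * ((\<integral>\<^sup>+t. indicator {1/3<..<2/3} t * \<Phi> t \<partial>lborel) + (\<integral>\<^sup>+t. indicator {1/3<..<2/3} t * \<Phi> (1 - t) \<partial>lborel))"
    by (simp add: nn_integral_cmult nn_integral_add)
  also have "(\<integral>\<^sup>+t. indicator {1/3<..<2/3} t * \<Phi> (1 - t) \<partial>lborel) = (\<integral>\<^sup>+t. indicator {1/3<..<2/3} t * \<Phi> t \<partial>lborel)"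
    by (subst (2) nn_integral_real_affine[where c = "-1" and t = 1])
       (auto intro!: nn_integral_cong split: split_indicator)
  also have "(\<integral>\<^sup>+t. indicator {1/3<..<2/3} t * \<Phi> t \<partial>lborel) \<le> L"
    unfolding L_def
  proof (rule nn_integral_mono)
    fix t :: real
    have "1 \<le> t powr (- s * p) / t" if t: "1/3 < t" "t < 2/3"
    proof -
      have "1 \<le> t powr (- s * p)" using powr_mono'[of "- s * p" 0 t] t s p by (simp)
      then show ?thesis using t by (simp add: le_divide_eq)
    qed
    then have "t \<in> {1/3<..<2/3} \<Longrightarrow> 1 \<le> w t" by (simp add: w_def)
    then show "indicator {1/3<..<2/3} t * \<Phi> t \<le> indicator {1/3<..<2/3} t * w t * \<Phi> t"
      using mult_right_mono[of 1 "w t" "\<Phi> t"] by (auto split: split_indicator)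
  qed
  finally have "shift_energy p f \<xi> * ennreal (1/3) \<le> ennreal (2 powr (p - 1)) * (L + L)"
    by (simp add: add_mono mult_left_mono)
  then have "ennreal 3 * (shift_energy p f \<xi> * ennreal (1/3)) \<le> ennreal 3 * (ennreal (2 powr (p - 1)) * (L + L))"
    by (rule mult_left_mono) simp
  moreover have "ennreal 3 * (shift_energy p f \<xi> * ennreal (1/3)) = shift_energy p f \<xi>"
    by (simp add: ennreal_mult'[symmetric] mult.left_commute[of "ennreal 3"] del: ennreal_numeral)
  moreover have "ennreal 3 * (ennreal (2 powr (p - 1)) * (L + L)) = ennreal (3 * 2 powr p) * L"
  proof -
    have "ennreal 3 * (ennreal (2 powr (p - 1)) * (L + L)) = ennreal 3 * ennreal (2 powr (p - 1)) * ennreal 2 * L"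
      by (simp add: mult_2 mult.assoc)
    also have "ennreal 3 * ennreal (2 powr (p - 1)) * ennreal 2 = ennreal (3 * 2 powr p)"
      by (simp add: ennreal_mult'[symmetric] powr_diff del: ennreal_numeral)
    finally show ?thesis .
  qed
  ultimately have E_le: "shift_energy p f \<xi> \<le> ennreal (3 * 2 powr p) * L" by simp
  show ?thesis
  proof (cases "frac_gauge_pow s p f \<xi> = \<infinity>")
    case True
    then show ?thesis using p s by (simp add: ennreal_mult_top)
  next
    case False
    \<comment> \<open>Finiteness of \<open>J\<close> allows it to be subtracted from both sides of
      \<open>JL\<close>.\<close>
    then have "J < \<infinity>" using J_le by (auto simp: less_top top_unique)
    then obtain j where j: "j \<ge> 0" "J = ennreal j" by (cases J) auto
    have "L \<le> ennreal (2 powr (p * (1 - s))) * ennreal j" using JL by (auto simp: j intro: order_trans[rotated])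
    then have "L < \<infinity>" by (rule le_less_trans) (simp add: ennreal_mult_less_top)
    then obtain l where l: "l \<ge> 0" "L = ennreal l" by (cases L) auto
    have "j + l \<le> 2 powr (p * (1 - s)) * j"
      using JL j l by (simp add: ennreal_mult'[symmetric] ennreal_plus[symmetric] del: ennreal_plus)
    then have "l \<le> (2 powr (p * (1 - s)) - 1) * j" by (simp add: algebra_simps)
    also have "\<dots> \<le> (2 powr p * (p * (1 - s))) * j"
      using p s j by (intro mult_right_mono two_powr_minus_one_le) (auto simp: algebra_simps)
    finally have "L \<le> ennreal (2 powr p * (p * (1 - s))) * J"
      using p s j l by (simp add: ennreal_mult'[symmetric])
    also have "\<dots> \<le> ennreal (2 powr p * (p * (1 - s))) * frac_gauge_pow s p f \<xi>"
      by (intro mult_left_mono J_le) simp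
    finally have "shift_energy p f \<xi> \<le> ennreal (3 * 2 powr p) * (ennreal (2 powr p * (p * (1 - s))) * frac_gauge_pow s p f \<xi>)"
      using E_le by (meson mult_left_mono order_trans zero_le)
    also have "\<dots> = ennreal (3 * 2 powr p * (2 powr p * (p * (1 - s)))) * frac_gauge_pow s p f \<xi>"
      using p s by (simp add: ennreal_mult' mult.assoc)
    \<comment> \<open>The 3 is the inverse length of the window, one 2 powr p comes from splitting
      \<open>\<xi>\<close> into two parts with equal integrals, the other from
      \<open>two_powr_minus_one_le\<close>.\<close>
    also have "3 * 2 powr p * (2 powr p * (p * (1 - s))) = 3 * 4 powr p * p * (1 - s)"
      using powr_mult[of 2 2 p] by simp
    finally show ?thesis .
  qed
qed

lemma frac_gauge_pow_sublevel:
  fixes f :: "'a::euclidean_space \<Rightarrow> real"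
  assumes f: "f \<in> borel_measurable borel" and r: "r > 0"
  shows "{\<xi>. frac_gauge_pow s p f \<xi> \<le> ennreal (r powr (s * p))} = {\<xi>. \<xi> /\<^sub>R r \<in> frac_polar_proj_body s p f}"
proof -
  have "frac_gauge_pow s p f \<xi> \<le> ennreal (r powr (s * p)) \<longleftrightarrow> frac_gauge_pow s p f (\<xi> /\<^sub>R r) \<le> 1" for \<xi>
    using frac_gauge_pow_scaleR[OF f r, of s p "\<xi> /\<^sub>R r"] r
      ennreal_mult_le_mult_iff[of "ennreal (r powr (s * p))" "frac_gauge_pow s p f (\<xi> /\<^sub>R r)" 1]
    by simp
  then show ?thesis by (simp add: frac_polar_proj_body_def)
qed

lemma emeasure_frac_gauge_pow_sublevel:
  fixes f :: "'a::euclidean_space \<Rightarrow> real"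
  assumes f: "f \<in> borel_measurable borel" and r: "r > 0"
  shows "emeasure lborel {\<xi>. frac_gauge_pow s p f \<xi> \<le> ennreal (r powr (s * p))} =
    ennreal (r ^ DIM('a)) * emeasure lborel (frac_polar_proj_body s p f)"
  unfolding frac_gauge_pow_sublevel[OF f r]
  by (rule emeasure_lborel_scaleR[OF frac_polar_proj_body_sets[OF f] r])

text \<open>The radius r solves c r powr (s p) = F / 2, so every shift in the dilate of the body by
  r has energy at most F / 2 and the absorption lemma bounds the measure of that dilate by twice
  that of the support.\<close>

lemma emeasure_frac_polar_proj_body_finite:
  fixes f :: "'a::euclidean_space \<Rightarrow> real"
  assumes f [measurable]: "f \<in> borel_measurable borel" and p: "p \<ge> 1" and s: "0 < s" "s < 1"
    and F: "Lp_pow p f = ennreal F" "F > 0"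
    and supp: "emeasure lborel (supp_set f) < \<infinity>"
  shows "emeasure lborel (frac_polar_proj_body s p f) < \<infinity>"
proof -
  define c where "c = 3 * 4 powr p * p * (1 - s)"
  have c: "c > 0" using p s by (simp add: c_def)
  define r where "r = (F / (2 * c)) powr (1 / (s * p))"
  have r: "r > 0" using c F by (simp add: r_def)
  have r_eq: "c * r powr (s * p) = F / 2" using c F p s by (simp add: r_def powr_powr)
  have "emeasure lborel {\<xi>. frac_gauge_pow s p f \<xi> \<le> ennreal (r powr (s * p))} \<le> 2 * emeasure lborel (supp_set f)"
  proof (rule emeasure_small_shift_energy_le[OF f _ F])
    fix z assume z: "z \<in> {\<xi>. frac_gauge_pow s p f \<xi> \<le> ennreal (r powr (s * p))}"
    have "shift_energy p f z \<le> ennreal c * frac_gauge_pow s p f z"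
      unfolding c_def by (rule shift_energy_le_frac_gauge_pow[OF f p s])
    also have "\<dots> \<le> ennreal c * ennreal (r powr (s * p))"
      using z by (intro mult_left_mono) auto
    also have "\<dots> = ennreal (F / 2)" using c by (simp add: ennreal_mult'[symmetric] r_eq)
    finally show "shift_energy p f z \<le> ennreal (F / 2)" .
  qed measurable
  then have "ennreal (r ^ DIM('a)) * emeasure lborel (frac_polar_proj_body s p f) \<le> 2 * emeasure lborel (supp_set f)"
    by (simp add: emeasure_frac_gauge_pow_sublevel[OF f r])
  also have "\<dots> < \<infinity>" using supp by (simp add: ennreal_mult_less_top)
  finally show ?thesis using r by (auto simp: ennreal_mult_less_top)
qed

section \<open>The Gagliardo seminorm and positivity of the volume\<close>

lemma gagliardo_eq_shift_energy:
  fixes f :: "'a::euclidean_space \<Rightarrow> real"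
  assumes [measurable]: "f \<in> borel_measurable borel"
  shows "gagliardo s p f = (\<integral>\<^sup>+z. shift_energy p f z * ennreal (1 / norm z powr (s * p + real DIM('a))) \<partial>lborel)"
proof -
  let ?q = "s * p + real DIM('a)"
  have "gagliardo s p f = (\<integral>\<^sup>+x. \<integral>\<^sup>+y. ennreal (\<bar>f x - f y\<bar> powr p / norm (x - y) powr ?q) \<partial>lborel \<partial>lborel)"
    by (simp add: gagliardo_def nn_integral_completion)
  also have "\<dots> = (\<integral>\<^sup>+x. \<integral>\<^sup>+z. ennreal (\<bar>f x - f (z + x)\<bar> powr p / norm (x - (z + x)) powr ?q) \<partial>lborel \<partial>lborel)"
    by (intro nn_integral_cong nn_integral_lborel_translate[symmetric]) measurable
  also have "\<dots> = (\<integral>\<^sup>+x. \<integral>\<^sup>+z. ennreal (\<bar>f (x + z) - f x\<bar> powr p) * ennreal (1 / norm z powr ?q) \<partial>lborel \<partial>lborel)"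
    by (intro nn_integral_cong) (simp add: ennreal_mult'[symmetric] abs_minus_commute add.commute)
  also have "\<dots> = (\<integral>\<^sup>+z. \<integral>\<^sup>+x. ennreal (\<bar>f (x + z) - f x\<bar> powr p) * ennreal (1 / norm z powr ?q) \<partial>lborel \<partial>lborel)"
    by (rule lborel_pair.Fubini') measurable
  also have "\<dots> = (\<integral>\<^sup>+z. shift_energy p f z * ennreal (1 / norm z powr ?q) \<partial>lborel)"
    by (simp add: nn_integral_multc shift_energy_def)
  finally show ?thesis .
qed

text \<open>Polar coordinates are avoided by integrating the gauge over the unit ball and
  rescaling the ball for each fixed \<open>t\<close>.\<close>
lemma nn_integral_ball_frac_gauge_pow:
  fixes f :: "'a::euclidean_space \<Rightarrow> real"
  assumes f [measurable]: "f \<in> borel_measurable borel" and sp: "s * p > 0"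
  shows "(\<integral>\<^sup>+\<xi>. indicator (cball 0 1) \<xi> * frac_gauge_pow s p f \<xi> \<partial>lborel) =
    ennreal (1 / (s * p + real DIM('a))) * gagliardo s p f"
proof -
  have [measurable]: "cball (0::'a) t \<in> sets borel" for t by (rule borel_closed) simp
  have [measurable]: "shift_energy p f \<in> borel_measurable lborel" by simp
  let ?q = "s * p + real DIM('a)"
  let ?w = "\<lambda>t::real. indicator {0<..} t * ennreal (t powr (- s * p) / t)"
  have q: "?q > 0" using sp by (simp add: add_pos_nonneg)
  have "(\<integral>\<^sup>+\<xi>. indicator (cball 0 1) \<xi> * frac_gauge_pow s p f \<xi> \<partial>lborel) =
    (\<integral>\<^sup>+\<xi>. (\<integral>\<^sup>+t. ?w t * (indicator (cball 0 1) \<xi> * shift_energy p f (t *\<^sub>R \<xi>)) \<partial>lborel) \<partial>lborel)"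
    unfolding frac_gauge_pow_eq_shift_energy
    by (subst nn_integral_cmult[symmetric]) (auto simp: mult_ac)
  also have "\<dots> = (\<integral>\<^sup>+t. (\<integral>\<^sup>+\<xi>. ?w t * (indicator (cball 0 1) \<xi> * shift_energy p f (t *\<^sub>R \<xi>)) \<partial>lborel) \<partial>lborel)"
    by (rule lborel_pair.Fubini') measurable
  also have "\<dots> = (\<integral>\<^sup>+t. (\<integral>\<^sup>+z. indicator {0<..} t * ennreal (t powr (- ?q) / t) * (indicator (cball 0 t) z * shift_energy p f z) \<partial>lborel) \<partial>lborel)"
  proof (rule nn_integral_cong)
    fix t :: real
    show "(\<integral>\<^sup>+\<xi>. ?w t * (indicator (cball 0 1) \<xi> * shift_energy p f (t *\<^sub>R \<xi>)) \<partial>lborel) =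
       (\<integral>\<^sup>+z. indicator {0<..} t * ennreal (t powr (- ?q) / t) * (indicator (cball 0 t) z * shift_energy p f z) \<partial>lborel)"
    proof (cases "t > 0")
      case True
      have "(\<integral>\<^sup>+z. indicator (cball 0 t) z * shift_energy p f z \<partial>lborel) =
        ennreal (t ^ DIM('a)) * (\<integral>\<^sup>+\<xi>. indicator (cball 0 t) (t *\<^sub>R \<xi>) * shift_energy p f (t *\<^sub>R \<xi>) \<partial>lborel)"
        using True by (subst nn_integral_lborel_scaleR[of _ t]) auto
      also have "(\<integral>\<^sup>+\<xi>. indicator (cball 0 t) (t *\<^sub>R \<xi>) * shift_energy p f (t *\<^sub>R \<xi>) \<partial>lborel) =
         (\<integral>\<^sup>+\<xi>. indicator (cball 0 1) \<xi> * shift_energy p f (t *\<^sub>R \<xi>) \<partial>lborel)"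
        using True by (intro nn_integral_cong) (auto split: split_indicator)
      finally have eq: "(\<integral>\<^sup>+z. indicator (cball 0 t) z * shift_energy p f z \<partial>lborel) =
         ennreal (t ^ DIM('a)) * (\<integral>\<^sup>+\<xi>. indicator (cball 0 1) \<xi> * shift_energy p f (t *\<^sub>R \<xi>) \<partial>lborel)" .
      \<comment> \<open>The Jacobian t^n of the rescaled ball accounts for the dimension in the
        exponent of the Gagliardo kernel.\<close>
      have "t powr (- ?q) / t * t ^ DIM('a) = t powr (- s * p) / t"
        using True by (simp add: powr_diff powr_realpow)
      then have "ennreal (t powr (- ?q) / t) * ennreal (t ^ DIM('a)) = ennreal (t powr (- s * p) / t)"
        using True by (metis ennreal_mult'' less_imp_le zero_le_power)
      then show ?thesis using True
        by (subst (1 2) nn_integral_cmult) (auto simp: eq mult.assoc[symmetric])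
    qed simp
  qed
  also have "\<dots> = (\<integral>\<^sup>+z. (\<integral>\<^sup>+t. indicator {0<..} t * ennreal (t powr (- ?q) / t) * (indicator (cball 0 t) z * shift_energy p f z) \<partial>lborel) \<partial>lborel)"
  proof (rule lborel_pair.Fubini')
    \<comment> \<open>The indicator of a ball of varying radius t is rewritten as that of the closed
      cone norm z <= t in the product space, which makes it jointly measurable.\<close>
    have "(\<lambda>x::'a \<times> real. indicator {0<..} (snd x) * ennreal (snd x powr (- ?q) / snd x) * (indicator {y. norm (fst y) \<le> snd y} x * shift_energy p f (fst x)))
       \<in> borel_measurable (lborel \<Otimes>\<^sub>M lborel)"
      by measurable
    then show "(\<lambda>(z, t). indicator {0<..} t * ennreal (t powr (- ?q) / t) * (indicator (cball 0 t) z * shift_energy p f z)) \<in> borel_measurable (lborel \<Otimes>\<^sub>M lborel)"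
      by (rule measurable_cong[THEN iffD1, rotated]) (auto split: split_indicator)
  qed
  also have "\<dots> = (\<integral>\<^sup>+z. ennreal (1 / ?q) * (shift_energy p f z * ennreal (1 / norm z powr ?q)) \<partial>lborel)"
  proof (rule nn_integral_cong_AE)
    have "AE z in lborel. z \<noteq> (0::'a)" by (rule AE_lborel_singleton)
    then show "AE z in lborel. (\<integral>\<^sup>+t. indicator {0<..} t * ennreal (t powr (- ?q) / t) * (indicator (cball 0 t) z * shift_energy p f z) \<partial>lborel) =
        ennreal (1 / ?q) * (shift_energy p f z * ennreal (1 / norm z powr ?q))"
    proof eventually_elim
      case (elim z)
      have "(\<integral>\<^sup>+t. indicator {0<..} t * ennreal (t powr (- ?q) / t) * (indicator (cball 0 t) z * shift_energy p f z) \<partial>lborel)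
        = (\<integral>\<^sup>+t. (indicator {norm z..} t * ennreal (t powr (- ?q) / t)) * shift_energy p f z \<partial>lborel)"
        using elim order_less_le_trans[of 0 "norm z"] by (intro nn_integral_cong) (fastforce split: split_indicator)
      also have "\<dots> = (\<integral>\<^sup>+t. (indicator {norm z..} t * ennreal (t powr (- ?q) / t)) \<partial>lborel) * shift_energy p f z"
        by (rule nn_integral_multc) measurable
      also have "(\<integral>\<^sup>+t. (indicator {norm z..} t * ennreal (t powr (- ?q) / t)) \<partial>lborel) = ennreal (norm z powr (- ?q) / ?q)"
        using elim q by (intro nn_integral_powr_tail) auto
      also have "\<dots> = ennreal (1 / ?q) * ennreal (1 / norm z powr ?q)"
        using q by (simp add: ennreal_mult'[symmetric] powr_minus_divide del: minus_add_distrib)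
      finally show ?case by (simp add: mult_ac)
    qed
  qed
  also have "\<dots> = ennreal (1 / ?q) * gagliardo s p f"
    by (simp add: nn_integral_cmult gagliardo_eq_shift_energy)
  finally show ?thesis .
qed

text \<open>All sublevel sets of the gauge are dilates of the body. If the body were null, countably
  many of them would show that the gauge is infinite almost everywhere, against the finite integral
  over the unit ball.\<close>

lemma emeasure_frac_polar_proj_body_pos:
  fixes f :: "'a::euclidean_space \<Rightarrow> real"
  assumes f [measurable]: "f \<in> borel_measurable borel" and sp: "s * p > 0"
    and fin: "gagliardo s p f < \<infinity>"
  shows "emeasure lborel (frac_polar_proj_body s p f) > 0"
proof (rule ccontr)
  assume "\<not> emeasure lborel (frac_polar_proj_body s p f) > 0"
  then have zero: "emeasure lborel (frac_polar_proj_body s p f) = 0" by simp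
  have "AE \<xi> in lborel. \<not> frac_gauge_pow s p f \<xi> \<le> ennreal (real (Suc n))" for n
  proof (rule AE_I[of _ _ "{\<xi>. frac_gauge_pow s p f \<xi> \<le> ennreal (real (Suc n))}"])
    have "real (Suc n) = (real (Suc n) powr (1 / (s * p))) powr (s * p)"
      using sp by (auto simp: powr_powr)
    then show "emeasure lborel {\<xi>. frac_gauge_pow s p f \<xi> \<le> ennreal (real (Suc n))} = 0"
      using emeasure_frac_gauge_pow_sublevel[OF f, of "real (Suc n) powr (1 / (s * p))" s p] zero by simp
  qed auto
  then have "AE \<xi> in lborel. \<forall>n. \<not> frac_gauge_pow s p f \<xi> \<le> ennreal (real (Suc n))"
    by (simp add: AE_all_countable)
  then have "AE \<xi> in lborel. frac_gauge_pow s p f \<xi> = \<infinity>"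
  proof eventually_elim
    case (elim \<xi>)
    show ?case
    proof (rule ccontr)
      assume "frac_gauge_pow s p f \<xi> \<noteq> \<infinity>"
      then obtain c where "c \<ge> 0" "frac_gauge_pow s p f \<xi> = ennreal c"
        by (cases "frac_gauge_pow s p f \<xi>") auto
      moreover obtain n where "c \<le> real n" using real_arch_simple by blast
      ultimately show False using elim[rule_format, of n] by (auto simp del: of_nat_Suc intro!: ennreal_leI)
    qed
  qed
  then have "(\<integral>\<^sup>+\<xi>. indicator (cball 0 1) \<xi> * frac_gauge_pow s p f \<xi> \<partial>lborel) = (\<integral>\<^sup>+\<xi>. indicator (cball 0 1 :: 'a set) \<xi> * \<infinity> \<partial>lborel)"
    by (intro nn_integral_cong_AE) auto
  also have "\<dots> = emeasure lborel (cball 0 1 :: 'a set) * \<infinity>"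
    by (subst nn_integral_multc) (auto intro!: borel_measurable_indicator borel_closed)
  also have "\<dots> = \<infinity>"
  proof -
    have "emeasure lborel (cball 0 1 :: 'a set) \<noteq> 0"
      using emeasure_cball[of 1 "0::'a"] by (simp add: unit_ball_vol_pos less_imp_neq[symmetric])
    then show ?thesis by (simp add: ennreal_mult_top)
  qed
  finally show False
    using nn_integral_ball_frac_gauge_pow[OF f sp] fin by (auto simp: ennreal_mult_eq_top_iff)
qed

section \<open>A fractional Morrey inequality\<close>

definition mean_on :: "'a::euclidean_space set \<Rightarrow> ('a \<Rightarrow> real) \<Rightarrow> real" where
  "mean_on A g = (\<integral>z. indicator A z * g z \<partial>lborel) / measure lborel A"

text \<open>\<open>abs_integral_powr_le\<close> for Lebesgue measure restricted to \<open>A\<close>: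
  a powr (- p) from the normalisation of the mean and a powr (p - 1) from Jensen combine to 1 /
  a.\<close>

lemma mean_on_powr_le:
  fixes g :: "'a::euclidean_space \<Rightarrow> real"
  assumes p: "p \<ge> 1" and A [measurable]: "A \<in> sets borel"
    and a: "emeasure lborel A = ennreal a" "a > 0"
    and g: "integrable lborel (\<lambda>z. indicator A z * g z)" and gm [measurable]: "g \<in> borel_measurable borel"
  shows "ennreal (\<bar>mean_on A g - c\<bar> powr p) \<le> ennreal (1 / a) * (\<integral>\<^sup>+z. indicator A z * ennreal (\<bar>g z - c\<bar> powr p) \<partial>lborel)"
proof -
  define M where "M = density lborel (indicator A)"
  have ma: "measure lborel A = a" using a by (simp add: measure_def)
  have iA: "integrable lborel (indicator A :: 'a \<Rightarrow> real)"
    using a by (intro integrable_real_indicator) auto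
  have "emeasure M (space M) = ennreal a" by (simp add: M_def emeasure_density a)
  then interpret M: finite_measure M by (intro finite_measureI) auto
  have mM: "measure M (space M) = a" using \<open>emeasure M (space M) = ennreal a\<close> a by (simp add: measure_def)
  have M_eq: "M = density lborel (\<lambda>z. ennreal (indicator A z))"
    by (simp add: M_def ennreal_indicator)
  have eM: "(\<integral>z. v z \<partial>M) = (\<integral>z. indicator A z * v z \<partial>lborel)" if [measurable]: "v \<in> borel_measurable borel" for v :: "'a \<Rightarrow> real"
    unfolding M_eq by (subst integral_density) auto
  have u: "integrable M (\<lambda>z. g z - c)"
  proof -
    have "integrable lborel (\<lambda>z. indicator A z * g z - c * indicator A z)"
      using g iA by (intro Bochner_Integration.integrable_diff) auto
    then have "integrable lborel (\<lambda>z. indicator A z * (g z - c))"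
      by (simp add: algebra_simps)
    then show ?thesis unfolding M_eq by (subst integrable_density) auto
  qed
  have "(\<integral>z. g z - c \<partial>M) = (\<integral>z. indicator A z * g z - c * indicator A z \<partial>lborel)"
    by (subst eM) (auto simp: algebra_simps)
  also have "\<dots> = (\<integral>z. indicator A z * g z \<partial>lborel) - c * a"
    using g iA ma by (subst Bochner_Integration.integral_diff) auto
  also have "\<dots> = a * (mean_on A g - c)"
    using a by (simp add: mean_on_def ma algebra_simps)
  finally have eq: "(\<integral>z. g z - c \<partial>M) = a * (mean_on A g - c)" .
  have "ennreal (\<bar>a * (mean_on A g - c)\<bar> powr p) \<le> ennreal (a powr (p - 1)) * (\<integral>\<^sup>+z. ennreal (\<bar>g z - c\<bar> powr p) \<partial>M)"
    using M.abs_integral_powr_le[OF p u] by (simp add: eq mM)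
  also have "(\<integral>\<^sup>+z. ennreal (\<bar>g z - c\<bar> powr p) \<partial>M) = (\<integral>\<^sup>+z. indicator A z * ennreal (\<bar>g z - c\<bar> powr p) \<partial>lborel)" (is "_ = ?I")
    unfolding M_def by (subst nn_integral_density) auto
  finally have *: "ennreal (\<bar>a * (mean_on A g - c)\<bar> powr p) \<le> ennreal (a powr (p - 1)) * ?I" .
  have "ennreal (\<bar>mean_on A g - c\<bar> powr p) = ennreal (a powr (- p)) * ennreal (\<bar>a * (mean_on A g - c)\<bar> powr p)"
    using a(2) by (simp add: ennreal_mult'[symmetric] abs_mult powr_mult mult.assoc[symmetric] powr_add[symmetric])
  also have "\<dots> \<le> ennreal (a powr (- p)) * (ennreal (a powr (p - 1)) * ?I)"
    by (intro mult_left_mono *) auto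
  also have "\<dots> = ennreal (a powr (- p) * a powr (p - 1)) * ?I"
    by (simp add: ennreal_mult mult.assoc)
  also have "a powr (- p) * a powr (p - 1) = 1 / a"
    using a(2) by (simp add: powr_diff powr_minus_divide)
  finally show ?thesis .
qed

text \<open>Domination by 1 + |f| powr p on \<open>A\<close>. Integrability has to be secured
  wherever means are taken, since a Bochner integral of a non-integrable function is 0 by
  convention.\<close>

lemma integrable_Lp_on_finite_measure:
  fixes f :: "'a::euclidean_space \<Rightarrow> real"
  assumes [measurable]: "f \<in> borel_measurable borel" "A \<in> sets borel" and p: "p \<ge> 1"
    and F: "Lp_pow p f < \<infinity>" and A: "emeasure lborel A < \<infinity>"
  shows "integrable lborel (\<lambda>z. indicator A z * f (x + z))"
proof (rule Bochner_Integration.integrable_bound)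
  have le: "t \<le> 1 + t powr p" if "t \<ge> 0" for t :: real
  proof (cases "t \<le> 1")
    case False
    then have "t powr 1 \<le> t powr p" using p by (intro powr_mono) auto
    then show ?thesis using False by simp
  qed (simp add: add_increasing2)
  have "(\<integral>\<^sup>+z. ennreal (\<bar>f (z + x)\<bar> powr p) \<partial>lborel) < \<infinity>"
    using F nn_integral_lborel_translate[of "\<lambda>z. ennreal (\<bar>f z\<bar> powr p)" x] by simp
  then have "integrable lborel (\<lambda>z. \<bar>f (z + x)\<bar> powr p)"
    by (intro integrableI_nonneg) auto
  then show "integrable lborel (\<lambda>z. indicator A z + \<bar>f (z + x)\<bar> powr p)"
    using A by (intro Bochner_Integration.integrable_add integrable_real_indicator) auto
  show "AE z in lborel. norm (indicator A z * f (x + z)) \<le> norm (indicator A z + \<bar>f (z + x)\<bar> powr p)"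
    using le by (intro always_eventually) (auto simp: add.commute split: split_indicator)
qed measurable

text \<open>For \<open>z\<close>, \<open>w\<close> in the ball of radius \<open>r\<close> of the quasi-norm given by the gauge, \<open>z - w\<close>
  stays in a ball of comparable radius, where the shift energy is controlled.\<close>
lemma mean_on_diff_powr_le:
  fixes f :: "'a::euclidean_space \<Rightarrow> real"
  assumes f [measurable]: "f \<in> borel_measurable borel" and p: "p \<ge> 1" and s: "0 < s" "s < 1"
    and F: "Lp_pow p f < \<infinity>"
    and k: "emeasure lborel (frac_polar_proj_body s p f) = ennreal k" "k > 0"
    and r: "r > 0"
    and A [measurable]: "A \<in> sets borel" and a: "emeasure lborel A = ennreal a" "a > 0"
    and D [measurable]: "D \<in> sets borel" and d: "emeasure lborel D = ennreal d" "d > 0"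
    and AD: "A \<union> D \<subseteq> {\<xi>. frac_gauge_pow s p f \<xi> \<le> ennreal (r powr (s * p))}"
  shows "\<bar>mean_on A (\<lambda>z. f (x + z)) - mean_on D (\<lambda>z. f (x + z))\<bar> powr p \<le>
    1 / (a * d) * (3 * 4 powr p * p * (1 - s) * (2 powr p * r powr (s * p)) * ((2 powr (1 / s) * r) ^ DIM('a) * k))"
proof -
  \<comment> \<open>On differences z - w the quasi-triangle inequality bounds the gauge power by 2
    powr (p - 1) times 2 r powr (s p); the factor 2 powr (1 / s) on the radius is what reproduces
    this value.\<close>
  define B where "B = {\<xi>. frac_gauge_pow s p f \<xi> \<le> ennreal ((2 powr (1 / s) * r) powr (s * p))}"
  have [measurable]: "B \<in> sets borel" unfolding B_def by measurable
  have rad: "(2 powr (1 / s) * r) powr (s * p) = 2 powr p * r powr (s * p)"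
    using r s by (simp add: powr_mult powr_powr)
  have B_meas: "emeasure lborel B = ennreal ((2 powr (1 / s) * r) ^ DIM('a) * k)"
    unfolding B_def using r k by (subst emeasure_frac_gauge_pow_sublevel[OF f]) (auto simp: ennreal_mult')
  have diff_in_B: "z - w \<in> B" if "z \<in> A" "w \<in> D" for z w
  proof -
    have "frac_gauge_pow s p f (z + - w) \<le> ennreal (2 powr (p - 1)) * (frac_gauge_pow s p f z + frac_gauge_pow s p f (- w))"
      by (rule frac_gauge_pow_add_le[OF f p])
    also have "\<dots> \<le> ennreal (2 powr (p - 1)) * (ennreal (r powr (s * p)) + ennreal (r powr (s * p)))"
      using that AD by (intro mult_left_mono add_mono) (auto simp: frac_gauge_pow_minus[OF f])
    also have "\<dots> = ennreal (2 powr (p - 1) * (r powr (s * p) + r powr (s * p)))"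
      by (subst ennreal_plus[symmetric]) (auto simp: ennreal_mult')
    also have "2 powr (p - 1) * (r powr (s * p) + r powr (s * p)) = (2 powr (1 / s) * r) powr (s * p)"
      by (simp add: rad powr_diff)
    finally show ?thesis by (simp add: B_def)
  qed
  have int: "integrable lborel (\<lambda>z. indicator A z * f (x + z))" "integrable lborel (\<lambda>z. indicator D z * f (x + z))"
    using a d by (intro integrable_Lp_on_finite_measure[OF f _ p F]; simp)+
  let ?u = "\<lambda>z w. ennreal (\<bar>f (x + z) - f (x + w)\<bar> powr p)"
  \<comment> \<open>Jensen over \<open>D\<close> here and over \<open>A\<close> next: the difference
    of the means is bounded by the average of |f(x + z) - f(x + w)| powr p over the product of
    \<open>A\<close> and \<open>D\<close>.\<close>
  have inner: "ennreal (\<bar>f (x + z) - mean_on D (\<lambda>w. f (x + w))\<bar> powr p) \<le> ennreal (1 / d) * (\<integral>\<^sup>+w. indicator D w * ?u z w \<partial>lborel)" for z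
    using mean_on_powr_le[OF p D d int(2), of "f (x + z)"] by (simp add: abs_minus_commute)
  have "ennreal (\<bar>mean_on A (\<lambda>z. f (x + z)) - mean_on D (\<lambda>z. f (x + z))\<bar> powr p) \<le>
    ennreal (1 / a) * (\<integral>\<^sup>+z. indicator A z * ennreal (\<bar>f (x + z) - mean_on D (\<lambda>z. f (x + z))\<bar> powr p) \<partial>lborel)"
    by (rule mean_on_powr_le[OF p A a int(1)]) measurable
  also have "\<dots> \<le> ennreal (1 / a) * (\<integral>\<^sup>+z. indicator A z * (ennreal (1 / d) * (\<integral>\<^sup>+w. indicator D w * ?u z w \<partial>lborel)) \<partial>lborel)"
    by (intro mult_left_mono nn_integral_mono inner) auto
  also have "\<dots> = ennreal (1 / a) * ennreal (1 / d) * (\<integral>\<^sup>+z. \<integral>\<^sup>+w. indicator A z * (indicator D w * ?u z w) \<partial>lborel \<partial>lborel)"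
    by (simp add: nn_integral_cmult[symmetric] mult_ac)
  \<comment> \<open>Only z - w matters from here on: relaxing the product of \<open>A\<close> and
    \<open>D\<close> to the strip z - w in \<open>B\<close> makes the domain invariant under common
    translation, and integrating along it leaves the shift energy integrated over
    \<open>B\<close>.\<close>
  also have "(\<integral>\<^sup>+z. \<integral>\<^sup>+w. indicator A z * (indicator D w * ?u z w) \<partial>lborel \<partial>lborel) \<le>
     (\<integral>\<^sup>+z. \<integral>\<^sup>+w. indicator B (z - w) * ?u z w \<partial>lborel \<partial>lborel)"
    using diff_in_B by (intro nn_integral_mono) (auto split: split_indicator)
  also have "\<dots> = (\<integral>\<^sup>+w. \<integral>\<^sup>+z. indicator B (z - w) * ?u z w \<partial>lborel \<partial>lborel)"
    by (rule lborel_pair.Fubini') measurable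
  also have "\<dots> = (\<integral>\<^sup>+w. \<integral>\<^sup>+z. indicator B ((z + w) - w) * ?u (z + w) w \<partial>lborel \<partial>lborel)"
    by (intro nn_integral_cong nn_integral_lborel_translate[symmetric]) measurable
  also have "\<dots> = (\<integral>\<^sup>+w. \<integral>\<^sup>+z. indicator B z * ennreal (\<bar>f (w + x + z) - f (w + x)\<bar> powr p) \<partial>lborel \<partial>lborel)"
    by (simp add: add_ac)
  also have "\<dots> = (\<integral>\<^sup>+z. \<integral>\<^sup>+w. indicator B z * ennreal (\<bar>f (w + x + z) - f (w + x)\<bar> powr p) \<partial>lborel \<partial>lborel)"
    by (rule lborel_pair.Fubini') measurable
  also have "\<dots> = (\<integral>\<^sup>+z. indicator B z * shift_energy p f z \<partial>lborel)"
    by (simp add: nn_integral_cmult shift_energy_def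
        nn_integral_lborel_translate[where f = "\<lambda>w. ennreal (\<bar>f (w + z) - f w\<bar> powr p)" for z])
  also have "\<dots> \<le> (\<integral>\<^sup>+z. indicator B z * ennreal (3 * 4 powr p * p * (1 - s) * (2 powr p * r powr (s * p))) \<partial>lborel)"
  proof (intro nn_integral_mono)
    fix z :: 'a
    have "shift_energy p f z \<le> ennreal (3 * 4 powr p * p * (1 - s) * (2 powr p * r powr (s * p)))" if "z \<in> B"
    proof -
      have "shift_energy p f z \<le> ennreal (3 * 4 powr p * p * (1 - s)) * frac_gauge_pow s p f z"
        by (rule shift_energy_le_frac_gauge_pow[OF f p s])
      also have "\<dots> \<le> ennreal (3 * 4 powr p * p * (1 - s)) * ennreal (2 powr p * r powr (s * p))"
        using that by (intro mult_left_mono) (auto simp: B_def rad)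
      finally show ?thesis using p s by (simp add: ennreal_mult'[symmetric])
    qed
    then show "indicator B z * shift_energy p f z \<le> indicator B z * ennreal (3 * 4 powr p * p * (1 - s) * (2 powr p * r powr (s * p)))"
      by (auto split: split_indicator)
  qed
  also have "\<dots> = emeasure lborel B * ennreal (3 * 4 powr p * p * (1 - s) * (2 powr p * r powr (s * p)))"
    by (subst nn_integral_multc) auto
  also have "\<dots> = ennreal (3 * 4 powr p * p * (1 - s) * (2 powr p * r powr (s * p)) * ((2 powr (1 / s) * r) ^ DIM('a) * k))"
    using p s r k by (simp add: B_meas ennreal_mult'[symmetric] mult_ac)
  finally have "ennreal (\<bar>mean_on A (\<lambda>z. f (x + z)) - mean_on D (\<lambda>z. f (x + z))\<bar> powr p) \<le> ennreal (1 / a) * ennreal (1 / d) * \<dots>"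
    by (simp add: mult_left_mono)
  also have "\<dots> = ennreal (1 / (a * d) * (3 * 4 powr p * p * (1 - s) * (2 powr p * r powr (s * p)) * ((2 powr (1 / s) * r) ^ DIM('a) * k)))"
    using a d by (simp add: ennreal_mult'[symmetric])
  finally show ?thesis
    using p s a d k r by (subst (asm) ennreal_le_iff) auto
qed

lemma sum_geometric_le:
  fixes q :: real
  assumes "0 \<le> q" "q < 1"
  shows "(\<Sum>i<m. q ^ i) \<le> 1 / (1 - q)"
  using assms by (simp add: sum_gp_strict field_simps mult_left_le_one_le)

text \<open>The average over the largest ball is controlled through the zeros of f, successive
  averages through \<open>mean_on_diff_powr_le\<close>, and f is recovered from its averages in
  measure, so no differentiation theorem for the balls of the gauge is involved.\<close>

lemma fractional_morrey:
  fixes f :: "'a::euclidean_space \<Rightarrow> real" and p s0 s :: real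
  defines "n \<equiv> real DIM('a)"
  assumes f [measurable]: "f \<in> borel_measurable borel" and pn: "n < p"
    and s0: "n / p < s0" and s: "s0 < s" "s < 1"
    and F: "Lp_pow p f < \<infinity>"
    and \<sigma>: "emeasure lborel (supp_set f) = ennreal \<sigma>" "\<sigma> > 0"
    and k: "emeasure lborel (frac_polar_proj_body s p f) = ennreal k" "k > 0"
  shows "AE x in lborel. \<bar>f x\<bar> \<le>
    2 * (2 powr n * 2 powr p * 2 powr p * (3 * 4 powr p * p)) powr (1 / p) * (1 + 1 / (1 - 2 powr (- (s0 - n / p))))
     * \<sigma> powr (s / n - 1 / p) * (1 - s) powr (1 / p) * k powr (- s / n)"
proof -
  have n: "n \<ge> 1" by (simp add: n_def DIM_positive Suc_leI)
  then have p: "p > 1" using pn by simp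
  have s_pos: "0 < s" using s0 s n p by (smt (verit) divide_pos_pos)
  have sn: "n / p < s" using s0 s by simp
  \<comment> \<open>Makes the measure of the ball of radius \<open>R\<close> equal to 2
    \<open>\<sigma>\<close>, twice that of the support.\<close>
  define R where "R = (2 * \<sigma> / k) powr (1 / n)"
  have R: "R > 0" using \<sigma> k by (simp add: R_def)
  have Rn: "R ^ DIM('a) * k = 2 * \<sigma>"
  proof -
    have "R ^ DIM('a) = R powr n" using R by (simp add: n_def powr_realpow)
    also have "\<dots> = 2 * \<sigma> / k" using n \<sigma> k by (simp add: R_def powr_powr)
    finally show ?thesis using k by simp
  qed
  define B where "B r = {\<xi>. frac_gauge_pow s p f \<xi> \<le> ennreal (r powr (s * p))}" for r
  have Bs [measurable]: "B r \<in> sets borel" for r unfolding B_def by measurable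
  have B_meas: "emeasure lborel (B r) = ennreal (r ^ DIM('a) * k)" if "r > 0" for r
    unfolding B_def using that k by (subst emeasure_frac_gauge_pow_sublevel[OF f]) (auto simp: ennreal_mult')
  have B_mono: "B r \<subseteq> B r'" if "0 < r" "r \<le> r'" for r r'
  proof -
    have "r powr (s * p) \<le> r' powr (s * p)" using that s_pos p by (intro powr_mono2) auto
    then show ?thesis unfolding B_def by (auto intro: order_trans ennreal_leI)
  qed
  \<comment> \<open>2 powr n: \<open>D\<close> has at least the fraction 2^-n of the ball. One 2
    powr p: volume of the enlarged ball, as 2 powr (n / s) <= 2 powr p. The other 2 powr p: its
    gauge level. The rest: the constant of \<open>shift_energy_le_frac_gauge_pow\<close>.\<close>
  define M where "M = 2 powr n * 2 powr p * 2 powr p * (3 * 4 powr p * p)"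
  have M: "M > 0" using p by (simp add: M_def)
  define L where "L r = M powr (1 / p) * ((1 - s) / k) powr (1 / p) * r powr (s - n / p)" for r
  \<comment> \<open>\<open>D\<close> may be any part of the ball with at least 2^-n of its measure.
    This covers the concentric ball of half the radius and also the zeros of f in the ball of radius
    \<open>R\<close>.\<close>
  have step: "\<bar>mean_on A (\<lambda>z. f (x + z)) - mean_on D (\<lambda>z. f (x + z))\<bar> \<le> L r"
    if r: "r > 0" and A [measurable]: "A \<in> sets borel" and a: "emeasure lborel A = ennreal a"
      and D [measurable]: "D \<in> sets borel" and d: "emeasure lborel D = ennreal d"
      and AD: "A \<subseteq> B r" "D \<subseteq> B r" and a_ge: "a = r ^ DIM('a) * k" and d_ge: "d \<ge> r ^ DIM('a) * k / 2 ^ DIM('a)"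
    for r A D a d x
  proof -
    define v where "v = r ^ DIM('a) * k"
    have v: "v > 0" using r k by (simp add: v_def)
    have d': "d \<ge> v / 2 powr n" using d_ge by (simp add: v_def n_def powr_realpow)
    then have d0: "d > 0" using v by (smt (verit) divide_pos_pos powr_gt_zero)
    have rn: "r ^ DIM('a) = r powr n" using r by (simp add: n_def powr_realpow)
    let ?E = "3 * 4 powr p * p * (1 - s) * (2 powr p * r powr (s * p)) * ((2 powr (1 / s) * r) ^ DIM('a) * k)"
    have "\<bar>mean_on A (\<lambda>z. f (x + z)) - mean_on D (\<lambda>z. f (x + z))\<bar> powr p \<le> 1 / (a * d) * ?E"
      using AD p s s_pos v d0 a_ge
      by (intro mean_on_diff_powr_le[OF f _ _ _ F k r A a _ D d]) (auto simp: B_def v_def)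
    also have "\<dots> \<le> 1 / (v * (v / 2 powr n)) * (3 * 4 powr p * p * (1 - s) * (2 powr p * r powr (s * p)) * (2 powr p * v))"
    proof (rule mult_mono)
      show "1 / (a * d) \<le> 1 / (v * (v / 2 powr n))"
        using v d' d0 by (intro divide_left_mono mult_mono) (auto simp: a_ge v_def[symmetric])
      \<comment> \<open>Since n / p < s, the exponent n / s is at most p, so the enlargement of the
        ball costs a factor independent of s.\<close>
      have "(2 powr (1 / s)) ^ DIM('a) = 2 powr (n / s)"
        by (simp add: n_def powr_powr powr_realpow[symmetric])
      also have "\<dots> \<le> 2 powr p"
        using sn s_pos p by (intro powr_mono) (auto simp: field_simps)
      finally have "(2 powr (1 / s) * r) ^ DIM('a) * k \<le> 2 powr p * v"
        using r k by (simp add: power_mult_distrib v_def mult_right_mono)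
      then show "?E \<le> 3 * 4 powr p * p * (1 - s) * (2 powr p * r powr (s * p)) * (2 powr p * v)"
        using p s by (intro mult_left_mono) auto
      show "0 \<le> 1 / (v * (v / 2 powr n))" using v by simp
      show "0 \<le> ?E" using p s k r by auto
    qed
    also have "\<dots> = M * (1 - s) * r powr (s * p) / v"
      using v by (simp add: M_def field_simps)
    also have "\<dots> = M * ((1 - s) / k) * r powr (s * p - n)"
      using r k by (simp add: v_def rn powr_diff)
    also have "\<dots> = L r powr p"
    proof -
      have "L r powr p = M * ((1 - s) / k) * r powr ((s - n / p) * p)"
        using M s k r p by (simp add: L_def powr_mult powr_powr)
      also have "(s - n / p) * p = s * p - n" using p by (simp add: field_simps)
      finally show ?thesis by simp
    qed
    finally have "\<bar>mean_on A (\<lambda>z. f (x + z)) - mean_on D (\<lambda>z. f (x + z))\<bar> powr p \<le> L r powr p" .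
    moreover have "L r \<ge> 0" by (simp add: L_def)
    ultimately show ?thesis using p by (smt (verit) powr_less_mono2)
  qed
  define rr where "rr j = R / 2 ^ j" for j :: nat
  have rr: "rr j > 0" for j using R by (simp add: rr_def)
  define q where "q = 2 powr (- (s - n / p))"
  \<comment> \<open>The ratio \<open>q\<close> of the geometric series depends on s;
    \<open>q0\<close> bounds it uniformly for s > s0.\<close>
  define q0 where "q0 = 2 powr (- (s0 - n / p))"
  have q: "0 \<le> q" "q \<le> q0" "q0 < 1"
  proof -
    show "0 \<le> q" by (simp add: q_def)
    show "q \<le> q0" using s by (simp add: q_def q0_def)
    show "q0 < 1" using powr_less_mono[of "- (s0 - n / p)" 0 2] s0 by (simp add: q0_def)
  qed
  have L_rr: "L (rr j) = L R * q ^ j" for j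
  proof -
    have "(R / 2 ^ j) powr (s - n / p) = R powr (s - n / p) * (2 ^ j) powr (- (s - n / p))"
      using R by (simp add: powr_divide powr_minus_divide del: minus_diff_eq)
    also have "(2 ^ j) powr (- (s - n / p)) = q ^ j"
      by (simp add: q_def powr_realpow[symmetric] powr_powr mult.commute del: minus_diff_eq)
    finally show ?thesis by (simp add: L_def rr_def mult.assoc)
  qed
  define S where "S = L R * (1 + 1 / (1 - q0))"
  define m where "m j x = mean_on (B (rr j)) (\<lambda>z. f (x + z))" for j x
  \<comment> \<open>The support, translated, covers at most \<open>\<sigma>\<close> of the 2
    \<open>\<sigma>\<close> in the ball, so the zeros of f fill at least \<open>\<sigma>\<close>,
    which is at least 2 \<open>\<sigma>\<close> / 2^n. Their mean is 0, so \<open>step\<close>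
    bounds the mean over the ball itself.\<close>
  have m0: "\<bar>m 0 x\<bar> \<le> L R" for x
  proof -
    define D where "D = {w \<in> B R. f (x + w) = 0}"
    have [measurable]: "D \<in> sets borel" unfolding D_def by measurable
    have SS [measurable]: "supp_set f \<in> sets borel" unfolding supp_set_def by measurable
    have "emeasure lborel (B R) \<le> emeasure lborel (D \<union> {w. w + x \<in> supp_set f})"
      by (rule emeasure_mono) (auto simp: D_def supp_set_def add.commute)
    also have "\<dots> \<le> emeasure lborel D + emeasure lborel {w. w + x \<in> supp_set f}"
      by (rule emeasure_subadditive) auto
    also have "emeasure lborel {w. w + x \<in> supp_set f} = (\<integral>\<^sup>+w. indicator (supp_set f) (w + x) \<partial>lborel)"
      using nn_integral_indicator[of "{w. w + x \<in> supp_set f}" lborel]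
      by (simp add: indicator_def)
    also have "\<dots> = ennreal \<sigma>"
      by (subst nn_integral_lborel_translate) (auto simp: \<sigma>)
    finally have 1: "ennreal (2 * \<sigma>) \<le> emeasure lborel D + ennreal \<sigma>" using B_meas[OF R] by (simp add: Rn)
    have "emeasure lborel D \<le> emeasure lborel (B R)"
      by (rule emeasure_mono) (auto simp: D_def)
    then have "emeasure lborel D < \<infinity>" by (rule le_less_trans) (simp add: B_meas[OF R])
    then obtain d where d: "d \<ge> 0" "emeasure lborel D = ennreal d" by (cases "emeasure lborel D") auto
    have "2 * \<sigma> \<le> d + \<sigma>" using 1 d \<sigma>(2) by (simp add: ennreal_plus[symmetric] del: ennreal_plus)
    moreover have "R ^ DIM('a) * k / 2 ^ DIM('a) \<le> \<sigma>"
    proof -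
      have "2 * \<sigma> \<le> \<sigma> * 2 ^ DIM('a)"
        using \<sigma>(2) power_increasing[of 1 "DIM('a)" "2::real"] by (simp add: DIM_positive Suc_leI mult.commute)
      then show ?thesis by (simp add: Rn divide_le_eq)
    qed
    ultimately have "\<bar>mean_on (B R) (\<lambda>z. f (x + z)) - mean_on D (\<lambda>z. f (x + z))\<bar> \<le> L R"
      using d B_meas[OF R] R by (intro step[where d = d]) (auto simp: D_def)
    moreover have "mean_on D (\<lambda>z. f (x + z)) = 0"
    proof -
      have "(\<lambda>z. indicator D z * f (x + z)) = (\<lambda>_. 0)"
        by (auto simp: D_def split: split_indicator)
      then show ?thesis by (simp add: mean_on_def)
    qed
    ultimately show ?thesis by (simp add: m_def rr_def)
  qed
  have m_step: "\<bar>m j x - m (Suc j) x\<bar> \<le> L R * q ^ j" for j x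
  proof -
    have le: "rr (Suc j) \<le> rr j" using R by (simp add: rr_def field_simps)
    have "rr (Suc j) = rr j / 2" by (simp add: rr_def)
    then have half: "rr (Suc j) ^ DIM('a) * k = rr j ^ DIM('a) * k / 2 ^ DIM('a)"
      by (simp only: power_divide times_divide_eq_left)
    have "\<bar>mean_on (B (rr j)) (\<lambda>z. f (x + z)) - mean_on (B (rr (Suc j))) (\<lambda>z. f (x + z))\<bar> \<le> L (rr j)"
      by (rule step[OF rr Bs B_meas[OF rr] Bs B_meas[OF rr] _ B_mono[OF rr le]]) (auto simp: half)
    then show ?thesis by (simp add: m_def L_rr)
  qed
  have L0: "L R \<ge> 0" by (simp add: L_def)
  have m_bound: "\<bar>m j x\<bar> \<le> S" for j x
  proof -
    have "\<bar>m j x\<bar> \<le> L R + L R * (\<Sum>i<j. q ^ i)"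
    proof (induction j)
      case 0
      then show ?case using m0 by simp
    next
      case (Suc j)
      then show ?case using m_step[of j x] by (simp add: algebra_simps)
    qed
    also have "\<dots> \<le> L R + L R * (1 / (1 - q0))"
    proof -
      have "(\<Sum>i<j. q ^ i) \<le> 1 / (1 - q)" using q by (intro sum_geometric_le) auto
      also have "\<dots> \<le> 1 / (1 - q0)" using q by (intro divide_left_mono) auto
      finally show ?thesis using L0 by (intro add_left_mono mult_left_mono)
    qed
    finally show ?thesis by (simp add: S_def algebra_simps)
  qed
  \<comment> \<open>A Chebyshev argument: where |f| >= S + e, each average m j differs from f by at
    least e. By Jensen and Fubini the integral of |m j - f| powr p is at most c times rr j powr (s
    p), which tends to 0.\<close>
  have null: "emeasure lborel {x. \<bar>f x\<bar> \<ge> S + e} = 0" if e: "e > 0" for e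
  proof -
    let ?c = "3 * 4 powr p * p * (1 - s)"
    have bound: "ennreal (e powr p) * emeasure lborel {x. \<bar>f x\<bar> \<ge> S + e} \<le> ennreal (?c * rr j powr (s * p))" for j
    proof -
      define b where "b = rr j ^ DIM('a) * k"
      have b: "b > 0" using rr k by (simp add: b_def)
      have Bb: "emeasure lborel (B (rr j)) = ennreal b" using B_meas[OF rr] by (simp add: b_def)
      have "ennreal (e powr p) * emeasure lborel {x. \<bar>f x\<bar> \<ge> S + e} = (\<integral>\<^sup>+x. ennreal (e powr p) * indicator {x. \<bar>f x\<bar> \<ge> S + e} x \<partial>lborel)"
        by (rule nn_integral_cmult_indicator[symmetric]) measurable
      also have "\<dots> \<le> (\<integral>\<^sup>+x. ennreal (1 / b) * (\<integral>\<^sup>+z. indicator (B (rr j)) z * ennreal (\<bar>f (x + z) - f x\<bar> powr p) \<partial>lborel) \<partial>lborel)"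
      proof (rule nn_integral_mono)
        fix x
        have "ennreal (e powr p) \<le> ennreal (\<bar>m j x - f x\<bar> powr p)" if "\<bar>f x\<bar> \<ge> S + e"
          using that m_bound[of j x] e p by (intro ennreal_leI powr_mono2) auto
        moreover have "ennreal (\<bar>m j x - f x\<bar> powr p) \<le> ennreal (1 / b) * (\<integral>\<^sup>+z. indicator (B (rr j)) z * ennreal (\<bar>f (x + z) - f x\<bar> powr p) \<partial>lborel)"
          unfolding m_def using p Bb by (intro mean_on_powr_le[OF _ Bs Bb b] integrable_Lp_on_finite_measure[OF f Bs _ F]) auto
        ultimately show "ennreal (e powr p) * indicator {x. \<bar>f x\<bar> \<ge> S + e} x \<le> ennreal (1 / b) * (\<integral>\<^sup>+z. indicator (B (rr j)) z * ennreal (\<bar>f (x + z) - f x\<bar> powr p) \<partial>lborel)"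
          by (auto split: split_indicator simp del: ennreal_le_iff intro: order_trans)
      qed
      also have "\<dots> = ennreal (1 / b) * (\<integral>\<^sup>+x. \<integral>\<^sup>+z. indicator (B (rr j)) z * ennreal (\<bar>f (x + z) - f x\<bar> powr p) \<partial>lborel \<partial>lborel)"
        by (rule nn_integral_cmult) measurable
      also have "(\<integral>\<^sup>+x. \<integral>\<^sup>+z. indicator (B (rr j)) z * ennreal (\<bar>f (x + z) - f x\<bar> powr p) \<partial>lborel \<partial>lborel) =
         (\<integral>\<^sup>+z. \<integral>\<^sup>+x. indicator (B (rr j)) z * ennreal (\<bar>f (x + z) - f x\<bar> powr p) \<partial>lborel \<partial>lborel)"
        by (rule lborel_pair.Fubini') measurable
      also have "\<dots> = (\<integral>\<^sup>+z. indicator (B (rr j)) z * shift_energy p f z \<partial>lborel)"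
        by (simp add: nn_integral_cmult shift_energy_def)
      also have "\<dots> \<le> (\<integral>\<^sup>+z. ennreal (?c * rr j powr (s * p)) * indicator (B (rr j)) z \<partial>lborel)"
      proof (rule nn_integral_mono)
        fix z
        have "shift_energy p f z \<le> ennreal (?c * rr j powr (s * p))" if "z \<in> B (rr j)"
        proof -
          have "shift_energy p f z \<le> ennreal ?c * frac_gauge_pow s p f z"
            using p s s_pos by (intro shift_energy_le_frac_gauge_pow[OF f]) auto
          also have "\<dots> \<le> ennreal ?c * ennreal (rr j powr (s * p))"
            using that by (intro mult_left_mono) (auto simp: B_def)
          finally show ?thesis using p s by (simp add: ennreal_mult'[symmetric])
        qed
        then show "indicator (B (rr j)) z * shift_energy p f z \<le> ennreal (?c * rr j powr (s * p)) * indicator (B (rr j)) z"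
          by (auto split: split_indicator)
      qed
      also have "\<dots> = ennreal (?c * rr j powr (s * p)) * ennreal b"
        by (subst nn_integral_cmult_indicator) (auto simp: Bb)
      finally have "ennreal (e powr p) * emeasure lborel {x. \<bar>f x\<bar> \<ge> S + e} \<le> ennreal (1 / b) * (ennreal (?c * rr j powr (s * p)) * ennreal b)"
        by (simp add: mult_left_mono)
      also have "\<dots> = ennreal (?c * rr j powr (s * p))"
        using b p s by (simp add: ennreal_mult'[symmetric])
      finally show ?thesis .
    qed
    have "(\<lambda>j. rr j powr (s * p)) \<longlonglongrightarrow> 0"
    proof -
      have "rr = (\<lambda>j. R * (1 / 2) ^ j)" by (simp add: rr_def fun_eq_iff power_divide)
      moreover have "(\<lambda>j. R * (1 / 2) ^ j) \<longlonglongrightarrow> R * 0"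
        by (intro tendsto_mult LIMSEQ_power_zero) auto
      ultimately have "rr \<longlonglongrightarrow> 0" by simp
      then show ?thesis
        using s_pos p rr by (intro tendsto_zero_powrI[where b = "s * p"]) (auto intro!: always_eventually less_imp_le)
    qed
    then have "(\<lambda>j. ennreal (?c * rr j powr (s * p))) \<longlonglongrightarrow> ennreal (?c * 0)"
      by (intro tendsto_ennrealI tendsto_mult tendsto_const)
    then have "ennreal (e powr p) * emeasure lborel {x. \<bar>f x\<bar> \<ge> S + e} \<le> ennreal (?c * 0)"
      using bound by (intro LIMSEQ_le_const) auto
    then show ?thesis using e by simp
  qed
  have "AE x in lborel. \<bar>f x\<bar> < S + 1 / real (Suc j)" for j
    by (rule AE_I[OF _ null[of "1 / real (Suc j)"]]) auto
  then have "AE x in lborel. \<forall>j. \<bar>f x\<bar> < S + 1 / real (Suc j)"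
    by (simp add: AE_all_countable)
  then have "AE x in lborel. \<bar>f x\<bar> \<le> S"
  proof eventually_elim
    case (elim x)
    have "(\<lambda>j. S + 1 / real (Suc j)) \<longlonglongrightarrow> S + 0"
      by (intro tendsto_add tendsto_const LIMSEQ_Suc lim_1_over_n)
    then show ?case using elim by (intro LIMSEQ_le_const[of "\<lambda>j. S + 1 / real (Suc j)"]) (auto intro: less_imp_le)
  qed
  moreover have "S \<le> 2 * M powr (1 / p) * (1 + 1 / (1 - q0)) * \<sigma> powr (s / n - 1 / p) * (1 - s) powr (1 / p) * k powr (- s / n)"
  proof -
    define b where "b = s / n - 1 / p"
    have b: "0 < b" "b \<le> 1"
    proof -
      show "0 < b" using sn n p by (simp add: b_def field_simps)
      have "s / n \<le> 1" using s n by simp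
      moreover have "1 / p \<ge> 0" using p by simp
      ultimately show "b \<le> 1" unfolding b_def by linarith
    qed
    \<comment> \<open>The exponent b lies in (0, 1], so 2 powr b <= 2 gives the leading factor 2 of
      the constant. The powers - b and - 1 / p of k add up to - s / n.\<close>
    have "R powr (s - n / p) = (2 * \<sigma> / k) powr b"
      using n by (simp add: R_def powr_powr b_def field_simps)
    also have "\<dots> = 2 powr b * \<sigma> powr b * k powr (- b)"
      using \<sigma> k by (simp add: powr_mult powr_divide powr_minus_divide)
    also have "\<dots> \<le> 2 * \<sigma> powr b * k powr (- b)"
      using powr_mono[of b 1 2] b by (intro mult_right_mono) auto
    finally have "L R \<le> M powr (1 / p) * ((1 - s) / k) powr (1 / p) * (2 * \<sigma> powr b * k powr (- b))"
      unfolding L_def by (intro mult_left_mono) auto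
    also have "\<dots> = 2 * M powr (1 / p) * \<sigma> powr b * (1 - s) powr (1 / p) * (k powr (- b) * k powr (- (1 / p)))"
      using k s by (simp add: powr_divide powr_minus_divide mult_ac)
    also have "k powr (- b) * k powr (- (1 / p)) = k powr (- s / n)"
      by (simp add: powr_add[symmetric] b_def)
    finally have "S \<le> (2 * M powr (1 / p) * \<sigma> powr b * (1 - s) powr (1 / p) * k powr (- s / n)) * (1 + 1 / (1 - q0))"
      unfolding S_def using q by (intro mult_right_mono) (auto intro!: add_nonneg_nonneg)
    then show ?thesis by (simp add: b_def mult_ac)
  qed
  ultimately show ?thesis
    unfolding M_def q0_def by (auto elim!: eventually_mono)
qed

section \<open>Test functions and weak gradients\<close>

text \<open>The classical flat function exp(- 1/t) with an extra factor t^(- m); the index makes the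
  family closed under differentiation up to linear combinations.\<close>

definition flat_exp :: "nat \<Rightarrow> real \<Rightarrow> real" where
  "flat_exp m t = (if t > 0 then exp (- (1 / t)) / t ^ m else 0)"

lemma flat_exp_nonneg: "flat_exp m t \<ge> 0"
  by (simp add: flat_exp_def)

text \<open>One term, of order m + 2, of the exponential series at 1/t suffices. The quadratic bound
  makes the difference quotient at 0 vanish in the limit.\<close>

lemma flat_exp_le_square: "\<bar>flat_exp m t\<bar> \<le> fact (m + 2) * t\<^sup>2"
proof (cases "t > 0")
  case True
  have "(1 / t) ^ (m + 2) / fact (m + 2) \<le> exp (1 / t)"
    using sum_le_suminf[OF summable_exp[of "1 / t"], of "{m + 2}"] True
    by (simp add: exp_def divide_inverse mult.commute)
  then have "1 / exp (1 / t) \<le> 1 / ((1 / t) ^ (m + 2) / fact (m + 2))"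
    using True by (intro divide_left_mono) auto
  then have "exp (- (1 / t)) \<le> fact (m + 2) * t ^ (m + 2)"
    using True by (simp add: exp_minus inverse_eq_divide power_divide mult.commute del: fact_Suc power_Suc)
  then have "exp (- (1 / t)) / t ^ m \<le> fact (m + 2) * t ^ (m + 2) / t ^ m"
    using True by (intro divide_right_mono) auto
  then show ?thesis using True by (simp add: flat_exp_def power_add power2_eq_square)
qed (simp add: flat_exp_def)

lemma flat_exp_has_derivative:
  "(flat_exp m has_real_derivative (- real m * flat_exp (m + 1) t + flat_exp (m + 2) t)) (at t)"
proof -
  consider "t > 0" | "t < 0" | "t = 0" by linarith
  then show ?thesis
  proof cases
    case 1
    have "((\<lambda>t. exp (- (1 / t)) / t ^ m) has_real_derivative (- real m * flat_exp (m + 1) t + flat_exp (m + 2) t)) (at t)"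
      using 1 by (auto intro!: derivative_eq_intros simp: flat_exp_def field_simps power2_eq_square power_Suc[symmetric] simp del: power_Suc)
        (cases m; simp add: field_simps)
    then show ?thesis
      by (rule has_field_derivative_transform_within_open[of _ _ _ "{0<..}"]) (use 1 in \<open>auto simp: flat_exp_def\<close>)
  next
    case 2
    have "((\<lambda>t. 0) has_real_derivative (- real m * flat_exp (m + 1) t + flat_exp (m + 2) t)) (at t)"
      using 2 by (auto simp: flat_exp_def)
    then show ?thesis
      by (rule has_field_derivative_transform_within_open[of _ _ _ "{..<0}"]) (use 2 in \<open>auto simp: flat_exp_def\<close>)
  next
    case 3
    have "((\<lambda>h. flat_exp m h / h) \<longlongrightarrow> 0) (at 0)"
    proof (rule Lim_null_comparison)
      show "\<forall>\<^sub>F h in at 0. norm (flat_exp m h / h) \<le> fact (m + 2) * \<bar>h\<bar>"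
        using flat_exp_le_square[of m] unfolding eventually_at_filter
        by (auto simp: divide_le_eq power2_eq_square abs_mult mult.assoc intro!: always_eventually)
      have "((\<lambda>h. fact (m + 2) * \<bar>h\<bar>) \<longlongrightarrow> fact (m + 2) * \<bar>0::real\<bar>) (at 0)"
        by (intro tendsto_intros)
      then show "((\<lambda>h. fact (m + 2) * \<bar>h\<bar>) \<longlongrightarrow> (0::real)) (at 0)" by simp
    qed
    then show ?thesis using 3 unfolding DERIV_def by (simp add: flat_exp_def)
  qed
qed

text \<open>An algebra of functions closed under directional derivatives, which makes it an
  invariant for the coinductive predicate \<open>smooth_fun\<close>.\<close>

inductive bump_alg :: "('a::euclidean_space \<Rightarrow> real) \<Rightarrow> bool" where
  bump_alg_atom: "bump_alg (\<lambda>x. flat_exp m (x \<bullet> v + b))"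
| bump_alg_const: "bump_alg (\<lambda>_. c)"
| bump_alg_add: "bump_alg f \<Longrightarrow> bump_alg g \<Longrightarrow> bump_alg (\<lambda>x. f x + g x)"
| bump_alg_mult: "bump_alg f \<Longrightarrow> bump_alg g \<Longrightarrow> bump_alg (\<lambda>x. f x * g x)"

lemma bump_alg_has_derivative:
  assumes "bump_alg f"
  shows "\<exists>f'. (\<forall>x. (f has_derivative f' x) (at x)) \<and> (\<forall>w. bump_alg (\<lambda>x. f' x w))"
  using assms
proof induction
  case (bump_alg_atom m v b)
  let ?f' = "\<lambda>x w. (- real m * flat_exp (m + 1) (x \<bullet> v + b) + flat_exp (m + 2) (x \<bullet> v + b)) * (w \<bullet> v)"
  have "((\<lambda>x. flat_exp m (x \<bullet> v + b)) has_derivative ?f' x) (at x)" for x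
  proof -
    have "((\<lambda>x. x \<bullet> v + b) has_derivative (\<lambda>w. w \<bullet> v)) (at x)"
      by (auto intro!: derivative_eq_intros)
    from has_derivative_compose[OF this flat_exp_has_derivative[unfolded has_field_derivative_def]]
    show ?thesis by (simp add: mult.commute)
  qed
  moreover have "bump_alg (\<lambda>x. ?f' x w)" for w
    by (intro bump_alg.intros)
  ultimately show ?case by (intro exI[of _ ?f']) blast
next
  case (bump_alg_const c)
  then show ?case by (intro exI[of _ "\<lambda>x w. 0"]) (auto intro: bump_alg.bump_alg_const)
next
  case (bump_alg_add f g)
  then obtain f' g' where "\<forall>x. (f has_derivative f' x) (at x)" "\<forall>w. bump_alg (\<lambda>x. f' x w)"
    "\<forall>x. (g has_derivative g' x) (at x)" "\<forall>w. bump_alg (\<lambda>x. g' x w)" by blast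
  then show ?case
    by (intro exI[of _ "\<lambda>x w. f' x w + g' x w"]) (auto intro!: has_derivative_add bump_alg.bump_alg_add)
next
  case (bump_alg_mult f g)
  then obtain f' g' where "\<forall>x. (f has_derivative f' x) (at x)" "\<forall>w. bump_alg (\<lambda>x. f' x w)"
    "\<forall>x. (g has_derivative g' x) (at x)" "\<forall>w. bump_alg (\<lambda>x. g' x w)" by blast
  then show ?case using bump_alg_mult.hyps
    by (intro exI[of _ "\<lambda>x w. f x * g' x w + f' x w * g x"])
       (auto intro!: has_derivative_mult bump_alg.bump_alg_add bump_alg.bump_alg_mult)
qed

lemma bump_alg_derivative:
  assumes "bump_alg f"
  shows "(f has_derivative frechet_derivative f (at x)) (at x)"
    and "bump_alg (\<lambda>x. frechet_derivative f (at x) w)"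
proof -
  obtain f' where f': "\<forall>x. (f has_derivative f' x) (at x)" "\<forall>w. bump_alg (\<lambda>x. f' x w)"
    using bump_alg_has_derivative[OF assms] by blast
  then have eq: "frechet_derivative f (at x) = f' x" for x
    using frechet_derivative_at by metis
  show "(f has_derivative frechet_derivative f (at x)) (at x)" using f' by (simp add: eq)
  show "bump_alg (\<lambda>x. frechet_derivative f (at x) w)" using f' by (simp add: eq)
qed

lemma bump_alg_smooth:
  assumes "bump_alg f"
  shows "smooth_fun f"
  using assms
proof (coinduction arbitrary: f)
  case smooth_fun
  then show ?case
    using bump_alg_derivative by (auto simp: differentiable_def)
qed

lemma bump_alg_continuous: "bump_alg f \<Longrightarrow> continuous_on UNIV f"
  by (meson bump_alg_derivative(1) continuous_at_imp_continuous_on has_derivative_continuous)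

lemma bump_alg_translate:
  assumes "bump_alg f"
  shows "bump_alg (\<lambda>x. f (x + a))"
  using assms
proof induction
  case (bump_alg_atom m v b)
  have "bump_alg (\<lambda>x. flat_exp m (x \<bullet> v + (a \<bullet> v + b)))" by (rule bump_alg.bump_alg_atom)
  then show ?case by (simp add: inner_add_left add.assoc)
qed (auto intro: bump_alg.intros)

lemma bump_alg_prod:
  assumes "finite I" "\<And>i. i \<in> I \<Longrightarrow> bump_alg (f i)"
  shows "bump_alg (\<lambda>x. \<Prod>i\<in>I. f i x)"
  using assms by (induction I rule: finite_induct) (auto intro: bump_alg.intros)

text \<open>As exp(- 1 / (k t)) tends to 1 for fixed t > 0, these test functions, supported in the
  box and bounded by 1, converge pointwise to its indicator. They carry identities from test
  functions to boxes.\<close>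

definition box_bump :: "'a::euclidean_space \<Rightarrow> 'a \<Rightarrow> nat \<Rightarrow> 'a \<Rightarrow> real" where
  "box_bump a b k x = (\<Prod>i\<in>Basis. flat_exp 0 (real k * (x \<bullet> i - a \<bullet> i)) * flat_exp 0 (real k * (b \<bullet> i - x \<bullet> i)))"

lemma box_bump_alg: "bump_alg (box_bump a b k)"
proof -
  have "bump_alg (\<lambda>x. flat_exp 0 (x \<bullet> (real k *\<^sub>R i) + - (real k * (a \<bullet> i))) * flat_exp 0 (x \<bullet> (- real k *\<^sub>R i) + real k * (b \<bullet> i)))" for i :: 'a
    by (intro bump_alg.intros)
  then have "bump_alg (\<lambda>x. flat_exp 0 (real k * (x \<bullet> i - a \<bullet> i)) * flat_exp 0 (real k * (b \<bullet> i - x \<bullet> i)))" for i :: 'a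
    by (simp add: algebra_simps)
  then show ?thesis unfolding box_bump_def[abs_def] by (intro bump_alg_prod) auto
qed

lemma flat_exp_0_le_1: "flat_exp 0 t \<le> 1"
  by (simp add: flat_exp_def)

lemma box_bump_bounds: "0 \<le> box_bump a b k x" "box_bump a b k x \<le> 1"
  unfolding box_bump_def
  by (auto intro!: prod_nonneg prod_le_1 mult_le_one simp: flat_exp_nonneg flat_exp_0_le_1)

lemma box_bump_support:
  assumes "x \<notin> box a b"
  shows "box_bump a b k x = 0"
proof -
  obtain i where "i \<in> Basis" "x \<bullet> i \<le> a \<bullet> i \<or> b \<bullet> i \<le> x \<bullet> i"
    using assms by (auto simp: box_def not_less)
  then show ?thesis unfolding box_bump_def
    by (intro prod_zero bexI[of _ i]) (auto simp: flat_exp_def zero_less_mult_iff)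
qed

lemma box_bump_tendsto: "(\<lambda>k. box_bump a b k x) \<longlonglongrightarrow> indicator (box a b) x"
proof (cases "x \<in> box a b")
  case True
  have lim: "(\<lambda>k. flat_exp 0 (real k * t)) \<longlonglongrightarrow> 1" if "t > 0" for t
  proof -
    have "(\<lambda>k. 1 / real k * (1 / t)) \<longlonglongrightarrow> 0 * (1 / t)"
      by (intro tendsto_intros lim_1_over_n)
    then have "(\<lambda>k. exp (- (1 / real k * (1 / t)))) \<longlonglongrightarrow> exp (- (0 * (1 / t)))"
      by (intro tendsto_intros)
    then have "(\<lambda>k. exp (- (1 / real k * (1 / t)))) \<longlonglongrightarrow> 1" by simp
    then show ?thesis
      by (rule Lim_transform_eventually)
        (use that in \<open>auto simp: flat_exp_def intro!: eventually_mono[OF eventually_gt_at_top[of 0]]\<close>)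
  qed
  have "(\<lambda>k. box_bump a b k x) \<longlonglongrightarrow> (\<Prod>i\<in>(Basis :: 'a set). 1 * 1)"
    unfolding box_bump_def using True by (intro tendsto_prod tendsto_mult lim) (auto simp: box_def)
  then show ?thesis using True by simp
qed (simp add: box_bump_support)

lemma integral_lborel_translate:
  fixes f :: "'a::euclidean_space \<Rightarrow> real"
  assumes [measurable]: "f \<in> borel_measurable borel"
  shows "(\<integral>x. f (x + a) \<partial>lborel) = (\<integral>x. f x \<partial>lborel)"
proof -
  have "(\<integral>x. f x \<partial>distr lborel borel ((+) a)) = (\<integral>x. f (a + x) \<partial>lborel)"
    by (rule integral_distr) auto
  then show ?thesis by (simp add: lborel_distr_plus add.commute)
qed

lemma integral_Fubini_lborel:
  fixes u :: "'a::euclidean_space \<Rightarrow> 'b::euclidean_space \<Rightarrow> real"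
  assumes [measurable]: "case_prod u \<in> borel_measurable (lborel \<Otimes>\<^sub>M lborel)"
    and fin: "(\<integral>\<^sup>+x. \<integral>\<^sup>+t. ennreal \<bar>u x t\<bar> \<partial>lborel \<partial>lborel) < \<infinity>"
  shows "(\<integral>x. \<integral>t. u x t \<partial>lborel \<partial>lborel) = (\<integral>t. \<integral>x. u x t \<partial>lborel \<partial>lborel)"
proof -
  have "(\<integral>\<^sup>+y. ennreal (norm (case_prod u y)) \<partial>(lborel \<Otimes>\<^sub>M lborel)) = (\<integral>\<^sup>+x. \<integral>\<^sup>+t. ennreal \<bar>u x t\<bar> \<partial>lborel \<partial>lborel)"
    by (subst lborel.nn_integral_fst[symmetric]) auto
  then have "integrable (lborel \<Otimes>\<^sub>M lborel) (case_prod u)"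
    using fin by (intro integrableI_bounded) auto
  from lborel_pair.Fubini_integral[OF this] show ?thesis by simp
qed

lemma integrable_mult_bounded_support:
  fixes f \<eta> :: "'a::euclidean_space \<Rightarrow> real"
  assumes f [measurable]: "f \<in> borel_measurable borel" and \<eta> [measurable]: "\<eta> \<in> borel_measurable borel"
    and p: "p \<ge> 1" and F: "Lp_pow p f < \<infinity>"
    and \<eta>_le: "\<And>x. \<bar>\<eta> x\<bar> \<le> C * indicator (cball 0 \<rho>) x"
  shows "integrable lborel (\<lambda>x. f x * \<eta> x)"
proof (rule Bochner_Integration.integrable_bound)
  have cb: "cball (0::'a) \<rho> \<in> sets borel" by (intro borel_closed) auto
  have "integrable lborel (\<lambda>x. indicator (cball 0 \<rho>) x * f (0 + x))"
    by (rule integrable_Lp_on_finite_measure[OF f cb p F]) (use emeasure_bounded_finite[of "cball (0::'a) \<rho>"] in auto)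
  then show "integrable lborel (\<lambda>x. C * (indicator (cball 0 \<rho>) x * f x))" by simp
  show "AE x in lborel. norm (f x * \<eta> x) \<le> norm (C * (indicator (cball 0 \<rho>) x * f x))"
  proof (rule AE_I2)
    fix x
    have "\<bar>f x\<bar> * \<bar>\<eta> x\<bar> \<le> \<bar>f x\<bar> * \<bar>C * indicator (cball 0 \<rho>) x\<bar>"
      using \<eta>_le[of x] by (intro mult_left_mono) auto
    then show "norm (f x * \<eta> x) \<le> norm (C * (indicator (cball 0 \<rho>) x * f x))"
      by (simp add: abs_mult mult_ac)
  qed
qed measurable

lemma bump_bound:
  fixes \<eta> :: "'a::euclidean_space \<Rightarrow> real"
  assumes \<eta>: "bump_alg \<eta>" and supp: "\<And>x. norm x > \<rho> \<Longrightarrow> \<eta> x = 0"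
  shows "\<exists>C\<ge>0. \<forall>x. \<bar>\<eta> x\<bar> \<le> C * indicator (cball 0 \<rho>) x \<and> \<bar>frechet_derivative \<eta> (at x) z\<bar> \<le> C * indicator (cball 0 \<rho>) x"
proof -
  let ?D = "\<lambda>x. frechet_derivative \<eta> (at x) z"
  \<comment> \<open>The complement of the closed ball is open, so \<open>\<eta>\<close> vanishes
    near such x and its derivative vanishes too.\<close>
  have D0: "?D x = 0" if "norm x > \<rho>" for x
  proof -
    have "((\<lambda>_. 0) has_derivative (\<lambda>_. 0)) (at x)" by simp
    then have "(\<eta> has_derivative (\<lambda>_. 0)) (at x)"
      by (rule has_derivative_transform_within_open[of _ _ _ _ "- cball 0 \<rho>"]) (use that supp in auto)
    then show ?thesis using frechet_derivative_at by metis
  qed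
  have "compact (\<eta> ` cball 0 \<rho> \<union> ?D ` cball 0 \<rho>)"
    by (intro compact_Un compact_continuous_image continuous_on_subset[OF bump_alg_continuous] \<eta> bump_alg_derivative) auto
  then obtain C where C: "\<forall>y \<in> \<eta> ` cball 0 \<rho> \<union> ?D ` cball 0 \<rho>. norm y \<le> C"
    using bounded_iff compact_imp_bounded by blast
  show ?thesis
  proof (intro exI[of _ "max C 0"] conjI allI)
    fix x
    show "\<bar>\<eta> x\<bar> \<le> max C 0 * indicator (cball 0 \<rho>) x" "\<bar>?D x\<bar> \<le> max C 0 * indicator (cball 0 \<rho>) x"
      using C D0[of x] supp[of x] by (auto split: split_indicator intro: le_max_iff_disj[THEN iffD2])
  qed auto
qed

section \<open>Averages along segments and the difference formula\<close>

text \<open>If G is not integrable over the segment from x to x + z, the value is 0 by convention;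
  the upper bound \<open>line_mean_powr_le\<close> remains true there.\<close>

definition line_mean :: "('a::euclidean_space \<Rightarrow> real) \<Rightarrow> 'a \<Rightarrow> 'a \<Rightarrow> real" where
  "line_mean G z x = (\<integral>t. indicator {0..1} t * G (x + t *\<^sub>R z) \<partial>lborel)"

lemma line_mean_measurable [measurable]:
  assumes [measurable]: "G \<in> borel_measurable borel"
  shows "line_mean G z \<in> borel_measurable borel"
  unfolding line_mean_def[abs_def] by measurable

lemma line_mean_powr_le:
  assumes [measurable]: "G \<in> borel_measurable borel" and p: "p \<ge> 1"
  shows "ennreal (\<bar>line_mean G z x\<bar> powr p) \<le> (\<integral>\<^sup>+t. indicator {0..1} t * ennreal (\<bar>G (x + t *\<^sub>R z)\<bar> powr p) \<partial>lborel)"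
proof (cases "integrable lborel (\<lambda>t. indicator {0..1} t * G (x + t *\<^sub>R z))")
  case True
  have "ennreal (\<bar>mean_on {0..1} (\<lambda>t. G (x + t *\<^sub>R z)) - 0\<bar> powr p) \<le>
    ennreal (1 / 1) * (\<integral>\<^sup>+t. indicator {0..1} t * ennreal (\<bar>G (x + t *\<^sub>R z) - 0\<bar> powr p) \<partial>lborel)"
    by (rule mean_on_powr_le[OF p _ _ _ True]) auto
  then show ?thesis by (simp add: mean_on_def line_mean_def)
next
  case False
  then show ?thesis by (simp add: line_mean_def not_integrable_integral_eq)
qed

text \<open>Fubini and translation invariance. Besides bounding averages along segments, it passes
  between statements on almost every line and statements on almost every point.\<close>

lemma nn_integral_line:
  fixes u :: "'a::euclidean_space \<Rightarrow> ennreal"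
  assumes [measurable]: "u \<in> borel_measurable borel" "A \<in> sets borel"
  shows "(\<integral>\<^sup>+x. \<integral>\<^sup>+t. indicator A t * u (x + t *\<^sub>R z) \<partial>lborel \<partial>lborel) = emeasure lborel A * (\<integral>\<^sup>+x. u x \<partial>lborel)"
proof -
  have "(\<integral>\<^sup>+x. \<integral>\<^sup>+t. indicator A t * u (x + t *\<^sub>R z) \<partial>lborel \<partial>lborel) = (\<integral>\<^sup>+t. \<integral>\<^sup>+x. indicator A t * u (x + t *\<^sub>R z) \<partial>lborel \<partial>lborel)"
    by (rule lborel_pair.Fubini') measurable
  also have "\<dots> = (\<integral>\<^sup>+t. indicator A t * (\<integral>\<^sup>+x. u x \<partial>lborel) \<partial>lborel)"
    by (simp add: nn_integral_cmult nn_integral_lborel_translate)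
  also have "\<dots> = emeasure lborel A * (\<integral>\<^sup>+x. u x \<partial>lborel)"
    by (subst nn_integral_multc) auto
  finally show ?thesis .
qed

lemma nn_integral_line_mean_le:
  fixes G :: "'a::euclidean_space \<Rightarrow> real"
  assumes [measurable]: "G \<in> borel_measurable borel" and p: "p \<ge> 1"
  shows "(\<integral>\<^sup>+x. ennreal (\<bar>line_mean G z x\<bar> powr p) \<partial>lborel) \<le> Lp_pow p G"
proof -
  have "(\<integral>\<^sup>+x. ennreal (\<bar>line_mean G z x\<bar> powr p) \<partial>lborel) \<le>
     (\<integral>\<^sup>+x. \<integral>\<^sup>+t. indicator {0..1} t * ennreal (\<bar>G (x + t *\<^sub>R z)\<bar> powr p) \<partial>lborel \<partial>lborel)"
    by (intro nn_integral_mono line_mean_powr_le p) measurable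
  also have "\<dots> = emeasure lborel {0..1::real} * Lp_pow p G"
    by (rule nn_integral_line[of "\<lambda>x. ennreal (\<bar>G x\<bar> powr p)"]) auto
  finally show ?thesis by simp
qed

text \<open>Lebesgue differentiation over cubes with corner x: all their averages of u vanish, and
  they converge to u x outside a negligible set.\<close>

lemma AE_zero_if_box_integrals_zero:
  fixes u :: "'a::euclidean_space \<Rightarrow> real"
  assumes [measurable]: "u \<in> borel_measurable borel"
    and int: "\<And>a b. integrable lborel (\<lambda>x. indicator (cbox a b) x * u x)"
    and zero: "\<And>a b. (\<integral>x. indicator (box a b) x * u x \<partial>lborel) = 0"
  shows "AE x in lborel. u x = 0"
proof -
  have hk: "u integrable_on cbox a b \<and> integral (cbox a b) u = 0" for a b
  proof -
    have si: "set_integrable lborel (cbox a b) u" using int[of a b] by (simp add: set_integrable_def)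
    have "integral (cbox a b) u = (LINT x:cbox a b|lborel. u x)"
      using set_borel_integral_eq_integral(2)[OF si] by simp
    also have "\<dots> = (\<integral>x. indicator (box a b) x * u x \<partial>lborel)"
      unfolding set_lebesgue_integral_def real_scaleR_def
    proof (rule integral_cong_AE)
      \<comment> \<open>Bump functions approximate open boxes, differentiation uses closed ones; the
        boundary between them is null.\<close>
      have "AE x in lborel. x \<notin> cbox a b - box a b"
        by (rule AE_not_in[OF null_sets_cbox_Diff_box])
      then show "AE x in lborel. indicator (cbox a b) x * u x = indicator (box a b) x * u x"
        by eventually_elim (auto split: split_indicator dest: box_subset_cbox[THEN subsetD])
    qed auto
    finally show ?thesis using set_borel_integral_eq_integral(1)[OF si] zero by simp
  qed
  obtain N where N: "negligible N"
    "\<And>x e. x \<notin> N \<Longrightarrow> 0 < e \<Longrightarrow> \<exists>d>0. \<forall>h. 0 < h \<and> h < d \<longrightarrow> norm (integral (cbox x (x + h *\<^sub>R One)) u /\<^sub>R h ^ DIM('a) - u x) < e"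
    using integrable_ccontinuous_explicit[of u] hk by metis
  have "u x = 0" if x: "x \<notin> N" for x
  proof (rule ccontr)
    assume "u x \<noteq> 0"
    then obtain d where d: "d > 0" "\<forall>h. 0 < h \<and> h < d \<longrightarrow> norm (integral (cbox x (x + h *\<^sub>R One)) u /\<^sub>R h ^ DIM('a) - u x) < \<bar>u x\<bar>"
      using N(2)[OF x, of "\<bar>u x\<bar>"] by auto
    from d(2)[rule_format, of "d / 2"] d(1) show False by (simp add: hk)
  qed
  moreover have "AE x in lebesgue. x \<notin> N"
    using N(1) by (intro AE_not_in) (simp add: negligible_iff_null_sets)
  ultimately have "AE x in lebesgue. u x = 0" by (auto elim: eventually_mono)
  then show ?thesis by (simp add: AE_completion_iff)
qed

text \<open>The definition tests basis directions only; a general direction follows by linearity of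
  the derivative. Splitting the sum under the integral is allowed because f and g are locally
  integrable and \<open>\<eta>\<close> has bounded support.\<close>

lemma weak_gradient_direction:
  fixes f :: "'a::euclidean_space \<Rightarrow> real" and g :: "'a \<Rightarrow> 'a"
  assumes f [measurable]: "f \<in> borel_measurable borel" and g [measurable]: "g \<in> borel_measurable borel"
    and p: "p \<ge> 1" and F: "Lp_pow p f < \<infinity>"
    and G: "\<And>z. grad_energy p g z < \<infinity>"
    and weak: "weak_gradient f g" and \<eta>: "bump_alg \<eta>" and supp: "\<And>x. norm x > \<rho> \<Longrightarrow> \<eta> x = 0"
  shows "(\<integral>x. f x * frechet_derivative \<eta> (at x) z \<partial>lborel) = - (\<integral>x. (g x \<bullet> z) * \<eta> x \<partial>lborel)"
proof -
  have "bounded {x. \<eta> x \<noteq> 0}"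
    using supp by (intro bounded_subset[OF bounded_cball[of 0 \<rho>]]) (auto simp: not_less[symmetric])
  then have test: "test_fun \<eta>" by (simp add: test_fun_def bump_alg_smooth[OF \<eta>])
  have \<eta>m [measurable]: "\<eta> \<in> borel_measurable borel"
    by (rule borel_measurable_continuous_onI[OF bump_alg_continuous[OF \<eta>]])
  have Dm [measurable]: "(\<lambda>x. frechet_derivative \<eta> (at x) w) \<in> borel_measurable borel" for w
    by (rule borel_measurable_continuous_onI[OF bump_alg_continuous[OF bump_alg_derivative(2)[OF \<eta>]]])
  have eq: "(\<integral>x. f x * frechet_derivative \<eta> (at x) i \<partial>lborel) = - (\<integral>x. (g x \<bullet> i) * \<eta> x \<partial>lborel)" if "i \<in> Basis" for i
  proof -
    have "(\<integral>x. f x * frechet_derivative \<eta> (at x) i \<partial>lebesgue) = - (\<integral>x. (g x \<bullet> i) * \<eta> x \<partial>lebesgue)"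
      using weak test that unfolding weak_gradient_def by blast
    then show ?thesis by (subst (asm) (1 2) integral_completion) auto
  qed
  have int_f: "integrable lborel (\<lambda>x. f x * frechet_derivative \<eta> (at x) i)" for i
    using bump_bound[OF \<eta>, of \<rho> i] supp integrable_mult_bounded_support[OF f Dm p F] by blast
  have int_g: "integrable lborel (\<lambda>x. (g x \<bullet> i) * \<eta> x)" for i
  proof -
    obtain C where "\<And>x. \<bar>\<eta> x\<bar> \<le> C * indicator (cball 0 \<rho>) x"
      using bump_bound[OF \<eta>, of \<rho> 0] supp by blast
    then show ?thesis by (intro integrable_mult_bounded_support[OF _ \<eta>m p G]) auto
  qed
  have lin: "frechet_derivative \<eta> (at x) z = (\<Sum>i\<in>Basis. (z \<bullet> i) * frechet_derivative \<eta> (at x) i)" for x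
  proof -
    have "linear (frechet_derivative \<eta> (at x))"
      using bump_alg_derivative(1)[OF \<eta>] has_derivative_linear by blast
    then have "frechet_derivative \<eta> (at x) (\<Sum>i\<in>Basis. (z \<bullet> i) *\<^sub>R i) = (\<Sum>i\<in>Basis. (z \<bullet> i) * frechet_derivative \<eta> (at x) i)"
      by (simp add: linear_sum linear_cmul)
    then show ?thesis by (simp add: euclidean_representation)
  qed
  have "(\<integral>x. f x * frechet_derivative \<eta> (at x) z \<partial>lborel) = (\<integral>x. (\<Sum>i\<in>Basis. (z \<bullet> i) * (f x * frechet_derivative \<eta> (at x) i)) \<partial>lborel)"
    by (simp add: lin sum_distrib_left mult_ac)
  also have "\<dots> = (\<Sum>i\<in>Basis. (z \<bullet> i) * (\<integral>x. f x * frechet_derivative \<eta> (at x) i \<partial>lborel))"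
    by (subst Bochner_Integration.integral_sum) (auto intro!: int_f)
  also have "\<dots> = - (\<Sum>i\<in>Basis. (z \<bullet> i) * (\<integral>x. (g x \<bullet> i) * \<eta> x \<partial>lborel))"
    by (simp add: eq sum_negf)
  also have "(\<Sum>i\<in>Basis. (z \<bullet> i) * (\<integral>x. (g x \<bullet> i) * \<eta> x \<partial>lborel)) = (\<integral>x. (\<Sum>i\<in>Basis. (z \<bullet> i) * ((g x \<bullet> i) * \<eta> x)) \<partial>lborel)"
    by (subst Bochner_Integration.integral_sum) (auto intro!: int_g)
  also have "\<dots> = (\<integral>x. (g x \<bullet> z) * \<eta> x \<partial>lborel)"
    by (rule Bochner_Integration.integral_cong)
       (auto simp: euclidean_inner[of "g _" z] sum_distrib_left mult_ac)
  finally show ?thesis .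
qed

text \<open>The shift is moved from f to \<open>\<eta>\<close>, where the fundamental theorem of
  calculus holds classically; the weak gradient then acts on each translate of
  \<open>\<eta>\<close>, and the translation is moved back to g.\<close>

lemma weak_gradient_shift_test:
  fixes f :: "'a::euclidean_space \<Rightarrow> real" and g :: "'a \<Rightarrow> 'a"
  assumes f [measurable]: "f \<in> borel_measurable borel" and g [measurable]: "g \<in> borel_measurable borel"
    and p: "p \<ge> 1" and F: "Lp_pow p f < \<infinity>"
    and G: "\<And>z. grad_energy p g z < \<infinity>"
    and weak: "weak_gradient f g" and \<eta>: "bump_alg \<eta>" and supp: "\<And>x. norm x > \<rho> \<Longrightarrow> \<eta> x = 0"
  shows "(\<integral>x. (f (x + z) - f x) * \<eta> x \<partial>lborel) = (\<integral>x. line_mean (\<lambda>x. g x \<bullet> z) z x * \<eta> x \<partial>lborel)"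
proof -
  define D where "D x = frechet_derivative \<eta> (at x) z" for x
  have \<eta>m [measurable]: "\<eta> \<in> borel_measurable borel"
    by (rule borel_measurable_continuous_onI[OF bump_alg_continuous[OF \<eta>]])
  have Dcont: "continuous_on UNIV D"
    unfolding D_def[abs_def] by (rule bump_alg_continuous[OF bump_alg_derivative(2)[OF \<eta>]])
  then have Dm [measurable]: "D \<in> borel_measurable borel"
    by (rule borel_measurable_continuous_onI)
  obtain C where C: "C \<ge> 0" "\<And>x. \<bar>\<eta> x\<bar> \<le> C * indicator (cball 0 \<rho>) x" "\<And>x. \<bar>D x\<bar> \<le> C * indicator (cball 0 \<rho>) x"
    using bump_bound[OF \<eta>, of \<rho> z] supp unfolding D_def by blast
  \<comment> \<open>Contains the supports of all translates of \<open>\<eta>\<close> along the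
    segment, t in [0,1], and so provides one integrable majorant for both uses of Fubini.\<close>
  define Q where "Q = cball (0::'a) (\<rho> + norm z)"
  have [measurable]: "Q \<in> sets borel" unfolding Q_def by (intro borel_closed) auto
  have in_Q: "indicator (cball 0 \<rho>) (x - t *\<^sub>R z) \<le> (indicator Q x :: real)" if "t \<in> {0..1}" for x t
  proof -
    have "norm x \<le> norm (x - t *\<^sub>R z) + norm (t *\<^sub>R z)" using norm_triangle_sub[of x "t *\<^sub>R z"] by simp
    moreover have "norm (t *\<^sub>R z) \<le> norm z" using that by (simp add: mult_left_le_one_le)
    ultimately show ?thesis by (auto simp: Q_def split: split_indicator)
  qed
  have C_shift: "\<bar>\<eta> (x - t *\<^sub>R z)\<bar> \<le> C * indicator Q x" "\<bar>D (x - t *\<^sub>R z)\<bar> \<le> C * indicator Q x" if "t \<in> {0..1}" for x t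
    using C(2)[of "x - t *\<^sub>R z"] C(3)[of "x - t *\<^sub>R z"] mult_left_mono[OF in_Q[OF that, of x] C(1)] by auto
  have Q_fin: "(\<integral>\<^sup>+x. ennreal (\<bar>u x\<bar> * (C * indicator Q x)) \<partial>lborel) < \<infinity>"
    if [measurable]: "u \<in> borel_measurable borel" and U: "Lp_pow p u < \<infinity>" for u :: "'a \<Rightarrow> real"
  proof -
    have "integrable lborel (\<lambda>x. u x * (C * indicator Q x))"
      using C(1) by (intro integrable_mult_bounded_support[OF _ _ p U, of _ C "\<rho> + norm z"]) (auto simp: abs_mult Q_def[symmetric])
    then show ?thesis using C(1) by (simp add: integrable_iff_bounded abs_mult)
  qed
  have bump_shift: "bump_alg (\<lambda>x. \<eta> (x - t *\<^sub>R z))" for t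
    using bump_alg_translate[OF \<eta>, of "- t *\<^sub>R z"] by simp
  have D_shift: "frechet_derivative (\<lambda>x. \<eta> (x - t *\<^sub>R z)) (at x) z = D (x - t *\<^sub>R z)" for t x
  proof -
    have "((\<lambda>x. x - t *\<^sub>R z) has_derivative (\<lambda>w. w)) (at x)" by (auto intro!: derivative_eq_intros)
    from has_derivative_compose[OF this bump_alg_derivative(1)[OF \<eta>]]
    have "((\<lambda>x. \<eta> (x - t *\<^sub>R z)) has_derivative frechet_derivative \<eta> (at (x - t *\<^sub>R z))) (at x)" .
    then show ?thesis unfolding D_def using frechet_derivative_at by metis
  qed
  have FTC: "\<eta> (x - z) - \<eta> x = - (\<integral>t. indicator {0..1} t * D (x - t *\<^sub>R z) \<partial>lborel)" for x
  proof -
    have "(\<integral>t. - D (x - t *\<^sub>R z) * indicator {0..1} t \<partial>lborel) = \<eta> (x - 1 *\<^sub>R z) - \<eta> (x - 0 *\<^sub>R z)"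
    proof (rule integral_FTC_Icc_real)
      fix t :: real
      have "((\<lambda>t. x - t *\<^sub>R z) has_derivative (\<lambda>h. - h *\<^sub>R z)) (at t)"
        by (auto intro!: derivative_eq_intros)
      from has_derivative_compose[OF this bump_alg_derivative(1)[OF \<eta>]]
      have "((\<lambda>t. \<eta> (x - t *\<^sub>R z)) has_derivative (\<lambda>h. frechet_derivative \<eta> (at (x - t *\<^sub>R z)) (- h *\<^sub>R z))) (at t)" .
      moreover have "linear (frechet_derivative \<eta> (at (x - t *\<^sub>R z)))"
        using bump_alg_derivative(1)[OF \<eta>] has_derivative_linear by blast
      then have "(\<lambda>h. frechet_derivative \<eta> (at (x - t *\<^sub>R z)) (- h *\<^sub>R z)) = (*) (- D (x - t *\<^sub>R z))"
        by (simp add: fun_eq_iff linear_cmul linear_neg D_def)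
      ultimately show "((\<lambda>t. \<eta> (x - t *\<^sub>R z)) has_real_derivative - D (x - t *\<^sub>R z)) (at t)"
        unfolding has_field_derivative_def by simp
      have "continuous_on UNIV (\<lambda>t. - D (x - t *\<^sub>R z))"
        by (intro continuous_on_minus continuous_on_compose2[OF Dcont] continuous_intros) auto
      then show "isCont (\<lambda>t. - D (x - t *\<^sub>R z)) t"
        by (simp add: continuous_on_eq_continuous_at)
    qed simp
    then show ?thesis by (simp add: mult.commute)
  qed
  have Fz: "(\<integral>\<^sup>+x. ennreal (\<bar>f (x + z)\<bar> powr p) \<partial>lborel) < \<infinity>"
    using F nn_integral_lborel_translate[of "\<lambda>x. ennreal (\<bar>f x\<bar> powr p)" z] by simp
  have i1: "integrable lborel (\<lambda>x. f (x + z) * \<eta> x)" and i2: "integrable lborel (\<lambda>x. f x * \<eta> x)"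
    using C by (auto intro!: integrable_mult_bounded_support[OF _ \<eta>m p] F Fz)
  have i3: "integrable lborel (\<lambda>x. f x * \<eta> (x - z))"
    using C_shift(1)[of 1] C(1) unfolding Q_def by (intro integrable_mult_bounded_support[OF _ _ p F]) auto
  have "(\<integral>x. (f (x + z) - f x) * \<eta> x \<partial>lborel) = (\<integral>x. f (x + z) * \<eta> x \<partial>lborel) - (\<integral>x. f x * \<eta> x \<partial>lborel)"
    using i1 i2 by (simp add: left_diff_distrib)
  also have "(\<integral>x. f (x + z) * \<eta> x \<partial>lborel) = (\<integral>x. f x * \<eta> (x - z) \<partial>lborel)"
    using integral_lborel_translate[of "\<lambda>x. f x * \<eta> (x - z)" z] by simp
  also have "(\<integral>x. f x * \<eta> (x - z) \<partial>lborel) - (\<integral>x. f x * \<eta> x \<partial>lborel) = (\<integral>x. f x * (\<eta> (x - z) - \<eta> x) \<partial>lborel)"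
    using i3 i2 by (simp add: right_diff_distrib)
  also have "\<dots> = - (\<integral>x. \<integral>t. indicator {0..1} t * (f x * D (x - t *\<^sub>R z)) \<partial>lborel \<partial>lborel)"
    by (simp add: FTC mult_ac flip: integral_mult_right_zero)
  also have "(\<integral>x. \<integral>t. indicator {0..1} t * (f x * D (x - t *\<^sub>R z)) \<partial>lborel \<partial>lborel) = (\<integral>t. \<integral>x. indicator {0..1} t * (f x * D (x - t *\<^sub>R z)) \<partial>lborel \<partial>lborel)"
  proof (rule integral_Fubini_lborel)
    have "(\<integral>\<^sup>+x. \<integral>\<^sup>+t. ennreal \<bar>indicator {0..1} t * (f x * D (x - t *\<^sub>R z))\<bar> \<partial>lborel \<partial>lborel) \<le>
       (\<integral>\<^sup>+x. \<integral>\<^sup>+t. ennreal (\<bar>f x\<bar> * (C * indicator Q x)) * indicator {0..1::real} t \<partial>lborel \<partial>lborel)"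
    proof (intro nn_integral_mono)
      fix x :: 'a and t :: real
      have "\<bar>f x\<bar> * \<bar>D (x - t *\<^sub>R z)\<bar> \<le> \<bar>f x\<bar> * (C * indicator Q x)" if "t \<in> {0..1}"
        by (intro mult_left_mono C_shift that) auto
      then show "ennreal \<bar>indicator {0..1} t * (f x * D (x - t *\<^sub>R z))\<bar> \<le> ennreal (\<bar>f x\<bar> * (C * indicator Q x)) * indicator {0..1} t"
        by (cases "t \<in> {0..1}") (simp_all add: abs_mult ennreal_leI del: atLeastAtMost_iff)
    qed
    also have "\<dots> = (\<integral>\<^sup>+x. ennreal (\<bar>f x\<bar> * (C * indicator Q x)) \<partial>lborel)"
      by (simp add: nn_integral_cmult)
    also have "\<dots> < \<infinity>" by (rule Q_fin[OF f F])
    finally show "(\<integral>\<^sup>+x. \<integral>\<^sup>+t. ennreal \<bar>indicator {0..1} t * (f x * D (x - t *\<^sub>R z))\<bar> \<partial>lborel \<partial>lborel) < \<infinity>" .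
  qed measurable
  also have "- \<dots> = (\<integral>t. indicator {0..1} t * (- (\<integral>x. f x * D (x - t *\<^sub>R z) \<partial>lborel)) \<partial>lborel)"
    by simp
  \<comment> \<open>For each fixed t the translated bump again lies in \<open>bump_alg\<close> and
    has bounded support, so it is an admissible test function.\<close>
  also have "\<dots> = (\<integral>t. indicator {0..1} t * (\<integral>x. (g x \<bullet> z) * \<eta> (x - t *\<^sub>R z) \<partial>lborel) \<partial>lborel)"
  proof (rule Bochner_Integration.integral_cong)
    fix t :: real
    have "\<eta> (x - t *\<^sub>R z) = 0" if "t \<in> {0..1}" "norm x > \<rho> + norm z" for x
      using C_shift(1)[OF that(1), of x] that(2) by (auto simp: Q_def split: split_indicator_asm)
    then have "- (\<integral>x. f x * D (x - t *\<^sub>R z) \<partial>lborel) = (\<integral>x. (g x \<bullet> z) * \<eta> (x - t *\<^sub>R z) \<partial>lborel)" if "t \<in> {0..1}"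
      using weak_gradient_direction[OF f g p F G weak bump_shift, of "\<rho> + norm z" t z] that
      by (simp add: D_shift)
    then show "indicator {0..1} t * (- (\<integral>x. f x * D (x - t *\<^sub>R z) \<partial>lborel)) = indicator {0..1} t * (\<integral>x. (g x \<bullet> z) * \<eta> (x - t *\<^sub>R z) \<partial>lborel)"
      by (auto split: split_indicator)
  qed simp
  also have "\<dots> = (\<integral>t. \<integral>x. indicator {0..1} t * ((g (x + t *\<^sub>R z) \<bullet> z) * \<eta> x) \<partial>lborel \<partial>lborel)"
    using integral_lborel_translate[of "\<lambda>x. (g x \<bullet> z) * \<eta> (x - t *\<^sub>R z)" "t *\<^sub>R z" for t] by simp
  also have "\<dots> = (\<integral>x. \<integral>t. indicator {0..1} t * ((g (x + t *\<^sub>R z) \<bullet> z) * \<eta> x) \<partial>lborel \<partial>lborel)"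
  proof (rule integral_Fubini_lborel[symmetric])
    have "(\<integral>\<^sup>+x. \<integral>\<^sup>+t. ennreal \<bar>indicator {0..1} t * ((g (x + t *\<^sub>R z) \<bullet> z) * \<eta> x)\<bar> \<partial>lborel \<partial>lborel) =
       (\<integral>\<^sup>+x. \<integral>\<^sup>+t. indicator {0..1} t * ennreal (\<bar>g (x + t *\<^sub>R z) \<bullet> z\<bar> * \<bar>\<eta> x\<bar>) \<partial>lborel \<partial>lborel)"
      by (intro nn_integral_cong) (auto simp: abs_mult split: split_indicator)
    also have "\<dots> = (\<integral>\<^sup>+t. \<integral>\<^sup>+x. indicator {0..1} t * ennreal (\<bar>g (x + t *\<^sub>R z) \<bullet> z\<bar> * \<bar>\<eta> x\<bar>) \<partial>lborel \<partial>lborel)"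
      by (rule lborel_pair.Fubini') measurable
    also have "\<dots> = (\<integral>\<^sup>+t. indicator {0..1} t * (\<integral>\<^sup>+x. ennreal (\<bar>g x \<bullet> z\<bar> * \<bar>\<eta> (x - t *\<^sub>R z)\<bar>) \<partial>lborel) \<partial>lborel)"
      using nn_integral_lborel_translate[of "\<lambda>x. ennreal (\<bar>g x \<bullet> z\<bar> * \<bar>\<eta> (x - t *\<^sub>R z)\<bar>)" "t *\<^sub>R z" for t]
      by (simp add: nn_integral_cmult)
    also have "\<dots> \<le> (\<integral>\<^sup>+t. indicator {0..1::real} t * (\<integral>\<^sup>+x. ennreal (\<bar>g x \<bullet> z\<bar> * (C * indicator Q x)) \<partial>lborel) \<partial>lborel)"
    proof (intro nn_integral_mono)
      fix t :: real
      have "(\<integral>\<^sup>+x. ennreal (\<bar>g x \<bullet> z\<bar> * \<bar>\<eta> (x - t *\<^sub>R z)\<bar>) \<partial>lborel) \<le> (\<integral>\<^sup>+x. ennreal (\<bar>g x \<bullet> z\<bar> * (C * indicator Q x)) \<partial>lborel)" if "t \<in> {0..1}"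
        by (intro nn_integral_mono ennreal_leI mult_left_mono C_shift that) auto
      then show "indicator {0..1} t * (\<integral>\<^sup>+x. ennreal (\<bar>g x \<bullet> z\<bar> * \<bar>\<eta> (x - t *\<^sub>R z)\<bar>) \<partial>lborel) \<le>
         indicator {0..1} t * (\<integral>\<^sup>+x. ennreal (\<bar>g x \<bullet> z\<bar> * (C * indicator Q x)) \<partial>lborel)"
        by (auto split: split_indicator)
    qed
    also have "\<dots> = (\<integral>\<^sup>+x. ennreal (\<bar>g x \<bullet> z\<bar> * (C * indicator Q x)) \<partial>lborel)"
      by (subst nn_integral_multc) auto
    also have "\<dots> < \<infinity>" by (rule Q_fin[OF _ G]) measurable
    finally show "(\<integral>\<^sup>+x. \<integral>\<^sup>+t. ennreal \<bar>indicator {0..1} t * ((g (x + t *\<^sub>R z) \<bullet> z) * \<eta> x)\<bar> \<partial>lborel \<partial>lborel) < \<infinity>" .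
  qed measurable
  also have "\<dots> = (\<integral>x. line_mean (\<lambda>x. g x \<bullet> z) z x * \<eta> x \<partial>lborel)"
    unfolding line_mean_def by (simp add: mult.assoc[symmetric])
  finally show ?thesis .
qed

text \<open>The tested identity passes from bump functions to indicators of boxes by dominated
  convergence, and box integrals determine a function. The exceptional set may depend on z, which is
  harmless as \<open>shift_energy\<close> integrates over x for one z at a time.\<close>

lemma weak_gradient_shift_AE:
  fixes f :: "'a::euclidean_space \<Rightarrow> real" and g :: "'a \<Rightarrow> 'a"
  assumes f [measurable]: "f \<in> borel_measurable borel" and g [measurable]: "g \<in> borel_measurable borel"
    and p: "p \<ge> 1" and F: "Lp_pow p f < \<infinity>"
    and G: "\<And>z. grad_energy p g z < \<infinity>"
    and weak: "weak_gradient f g"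
  shows "AE x in lborel. f (x + z) - f x = line_mean (\<lambda>x. g x \<bullet> z) z x"
proof -
  define L where "L = line_mean (\<lambda>x. g x \<bullet> z) z"
  have Lm [measurable]: "L \<in> borel_measurable borel" unfolding L_def by measurable
  have L_fin: "Lp_pow p L < \<infinity>"
    unfolding L_def by (rule le_less_trans[OF nn_integral_line_mean_le G]) (use p in auto)
  have Fz: "(\<integral>\<^sup>+x. ennreal (\<bar>f (x + z)\<bar> powr p) \<partial>lborel) < \<infinity>"
    using F nn_integral_lborel_translate[of "\<lambda>x. ennreal (\<bar>f x\<bar> powr p)" z] by simp
  define u where "u x = f (x + z) - f x - L x" for x
  have um [measurable]: "u \<in> borel_measurable borel" unfolding u_def[abs_def] by measurable
  have intA: "integrable lborel (\<lambda>x. indicator A x * u x)" if [measurable]: "A \<in> sets borel" and "bounded A" for A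
  proof -
    have fin: "emeasure lborel A < \<infinity>" by (rule emeasure_bounded_finite) fact
    have "integrable lborel (\<lambda>x. indicator A x * f ((0 + x) + z))" "integrable lborel (\<lambda>x. indicator A x * f (0 + x))"
      "integrable lborel (\<lambda>x. indicator A x * L (0 + x))"
      using fin by (intro integrable_Lp_on_finite_measure[OF _ _ p] F Fz L_fin; simp)+
    then have "integrable lborel (\<lambda>x. indicator A x * f (x + z) - indicator A x * f x - indicator A x * L x)"
      by (intro Bochner_Integration.integrable_diff) auto
    then show ?thesis by (simp add: u_def right_diff_distrib)
  qed
  have "AE x in lborel. u x = 0"
  proof (rule AE_zero_if_box_integrals_zero[OF um])
    fix a b :: 'a
    show "integrable lborel (\<lambda>x. indicator (cbox a b) x * u x)" by (rule intA) auto
    have ibox: "integrable lborel (\<lambda>x. indicator (box a b) x * u x)" by (rule intA) auto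
    obtain \<rho> where \<rho>: "box a b \<subseteq> cball 0 \<rho>"
      using bounded_box[of a b] unfolding bounded_iff by (auto simp: subset_iff)
    have bm [measurable]: "box_bump a b k \<in> borel_measurable borel" for k
      by (rule borel_measurable_continuous_onI[OF bump_alg_continuous[OF box_bump_alg]])
    have supp: "box_bump a b k x = 0" if "norm x > \<rho>" for k x
      using that \<rho> by (intro box_bump_support) auto
    have le: "\<bar>box_bump a b k x\<bar> \<le> 1 * indicator (cball 0 \<rho>) x" for k x
      using box_bump_bounds[of a b k x] supp[of x k] by (auto split: split_indicator)
    have zero: "(\<integral>x. u x * box_bump a b k x \<partial>lborel) = 0" for k
    proof -
      let ?\<eta> = "box_bump a b k"
      have i: "integrable lborel (\<lambda>x. f (x + z) * ?\<eta> x)" "integrable lborel (\<lambda>x. f x * ?\<eta> x)" "integrable lborel (\<lambda>x. L x * ?\<eta> x)"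
        using integrable_mult_bounded_support[OF _ bm p Fz le] integrable_mult_bounded_support[OF f bm p F le]
          integrable_mult_bounded_support[OF Lm bm p L_fin le] by simp_all
      have "(\<integral>x. u x * ?\<eta> x \<partial>lborel) = (\<integral>x. (f (x + z) - f x) * ?\<eta> x \<partial>lborel) - (\<integral>x. L x * ?\<eta> x \<partial>lborel)"
        using i by (simp add: u_def left_diff_distrib)
      also have "\<dots> = 0"
        using weak_gradient_shift_test[OF f g p F G weak box_bump_alg, of \<rho> a b k z] supp by (simp add: L_def)
      finally show ?thesis .
    qed
    have "(\<lambda>k. \<integral>x. u x * box_bump a b k x \<partial>lborel) \<longlonglongrightarrow> (\<integral>x. u x * indicator (box a b) x \<partial>lborel)"
    proof (rule integral_dominated_convergence[where w = "\<lambda>x. \<bar>indicator (box a b) x * u x\<bar>"])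
      show "integrable lborel (\<lambda>x. \<bar>indicator (box a b) x * u x\<bar>)" using ibox by (rule integrable_abs)
      show "AE x in lborel. (\<lambda>k. u x * box_bump a b k x) \<longlonglongrightarrow> u x * indicator (box a b) x"
        by (intro AE_I2 tendsto_intros box_bump_tendsto)
      show "AE x in lborel. norm (u x * box_bump a b k x) \<le> \<bar>indicator (box a b) x * u x\<bar>" for k
        using box_bump_bounds[of a b k] box_bump_support[of _ a b k]
        by (intro AE_I2) (auto simp: abs_mult mult_left_le split: split_indicator)
    qed measurable
    then show "(\<integral>x. indicator (box a b) x * u x \<partial>lborel) = 0"
      by (simp add: zero LIMSEQ_const_iff mult.commute)
  qed
  then show ?thesis by eventually_elim (simp add: u_def L_def)
qed

lemma shift_energy_eq_line_mean:
  fixes f :: "'a::euclidean_space \<Rightarrow> real" and g :: "'a \<Rightarrow> 'a"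
  assumes f [measurable]: "f \<in> borel_measurable borel" and g [measurable]: "g \<in> borel_measurable borel"
    and p: "p \<ge> 1" and F: "Lp_pow p f < \<infinity>"
    and G: "\<And>z. grad_energy p g z < \<infinity>"
    and weak: "weak_gradient f g"
  shows "shift_energy p f z = (\<integral>\<^sup>+x. ennreal (\<bar>line_mean (\<lambda>x. g x \<bullet> z) z x\<bar> powr p) \<partial>lborel)"
  unfolding shift_energy_def
  by (rule nn_integral_cong_AE) (use weak_gradient_shift_AE[OF assms, of z] in auto)

lemma shift_energy_le_grad:
  fixes f :: "'a::euclidean_space \<Rightarrow> real" and g :: "'a \<Rightarrow> 'a"
  assumes f [measurable]: "f \<in> borel_measurable borel" and g [measurable]: "g \<in> borel_measurable borel"
    and p: "p \<ge> 1" and F: "Lp_pow p f < \<infinity>"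
    and G: "\<And>z. grad_energy p g z < \<infinity>"
    and weak: "weak_gradient f g"
  shows "shift_energy p f z \<le> grad_energy p g z"
  unfolding shift_energy_eq_line_mean[OF assms] by (rule nn_integral_line_mean_le) (use p in auto)

section \<open>Differentiation along lines and the lower bound\<close>

text \<open>All quantifiers range over countable sets, which makes the set of points of convergence
  visibly Borel.\<close>

lemma LIMSEQ_iff_inverse_Suc:
  fixes X :: "nat \<Rightarrow> real"
  shows "X \<longlonglongrightarrow> L \<longleftrightarrow> (\<forall>m. \<exists>N. \<forall>k. k \<ge> N \<longrightarrow> \<bar>X k - L\<bar> < 1 / real (Suc m))"
proof
  assume "X \<longlonglongrightarrow> L"
  then show "\<forall>m. \<exists>N. \<forall>k. k \<ge> N \<longrightarrow> \<bar>X k - L\<bar> < 1 / real (Suc m)"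
    by (auto simp: LIMSEQ_iff)
next
  assume *: "\<forall>m. \<exists>N. \<forall>k. k \<ge> N \<longrightarrow> \<bar>X k - L\<bar> < 1 / real (Suc m)"
  show "X \<longlonglongrightarrow> L"
  proof (rule LIMSEQ_I)
    fix r :: real
    assume "r > 0"
    then obtain m where m: "1 / real (Suc m) < r" using reals_Archimedean by (auto simp: inverse_eq_divide)
    from * obtain N where N: "\<forall>k. k \<ge> N \<longrightarrow> \<bar>X k - L\<bar> < 1 / real (Suc m)" by blast
    show "\<exists>N. \<forall>k\<ge>N. norm (X k - L) < r"
      by (rule exI[of _ N]) (use N m in force)
  qed
qed

text \<open>On a fixed line the segment averages become averages of one real function over short
  intervals, the form needed by one-dimensional differentiation.\<close>

lemma line_mean_eq_interval_mean:
  fixes G :: "'a::euclidean_space \<Rightarrow> real"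
  assumes h: "h > 0" and int: "set_integrable lborel {\<tau>..\<tau> + h} (\<lambda>\<sigma>. G (x + \<sigma> *\<^sub>R \<xi>))"
  shows "line_mean G (h *\<^sub>R \<xi>) (x + \<tau> *\<^sub>R \<xi>) = integral {\<tau>..\<tau> + h} (\<lambda>\<sigma>. G (x + \<sigma> *\<^sub>R \<xi>)) / h"
proof -
  have "integral {\<tau>..\<tau> + h} (\<lambda>\<sigma>. G (x + \<sigma> *\<^sub>R \<xi>)) = (\<integral>\<sigma>. indicator {\<tau>..\<tau> + h} \<sigma> * G (x + \<sigma> *\<^sub>R \<xi>) \<partial>lborel)"
    using set_borel_integral_eq_integral(2)[OF int] by (simp add: set_lebesgue_integral_def)
  also have "\<dots> = h * (\<integral>t. indicator {\<tau>..\<tau> + h} (\<tau> + h * t) * G (x + (\<tau> + h * t) *\<^sub>R \<xi>) \<partial>lborel)"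
    using lborel_integral_real_affine[of h "\<lambda>\<sigma>. indicator {\<tau>..\<tau> + h} \<sigma> * G (x + \<sigma> *\<^sub>R \<xi>)" \<tau>] h by simp
  also have "(\<integral>t. indicator {\<tau>..\<tau> + h} (\<tau> + h * t) * G (x + (\<tau> + h * t) *\<^sub>R \<xi>) \<partial>lborel) = line_mean G (h *\<^sub>R \<xi>) (x + \<tau> *\<^sub>R \<xi>)"
    unfolding line_mean_def using h
    by (intro Bochner_Integration.integral_cong)
       (auto simp: scaleR_left_distrib add.assoc mult.commute zero_le_mult_iff mult_le_cancel_left1 split: split_indicator)
  finally show ?thesis using h by simp
qed

text \<open>One-dimensional Lebesgue differentiation along almost every line parallel to \<open>\<xi>\<close>;
  by Fubini the exceptional set is null.\<close>
lemma line_mean_tendsto_AE: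
  fixes G :: "'a::euclidean_space \<Rightarrow> real"
  assumes Gm [measurable]: "G \<in> borel_measurable borel" and p: "p \<ge> 1"
    and G: "Lp_pow p G < \<infinity>"
    and t: "\<And>k. t k > 0" "t \<longlonglongrightarrow> 0"
  shows "AE x in lborel. (\<lambda>k. line_mean G (t k *\<^sub>R \<xi>) x) \<longlonglongrightarrow> G x"
proof -
  define B where "B = {x. \<not> (\<forall>m. \<exists>N. \<forall>k. k \<ge> N \<longrightarrow> \<bar>line_mean G (t k *\<^sub>R \<xi>) x - G x\<bar> < 1 / real (Suc m))}"
  have Bm [measurable]: "B \<in> sets borel" unfolding B_def by measurable
  have B_iff: "x \<notin> B \<longleftrightarrow> (\<lambda>k. line_mean G (t k *\<^sub>R \<xi>) x) \<longlonglongrightarrow> G x" for x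
    by (simp add: B_def LIMSEQ_iff_inverse_Suc)
  \<comment> \<open>On almost every line G lies in L^p over each bounded interval; countably many
    intervals suffice, so one null set of lines is discarded.\<close>
  have "AE x in lborel. (\<integral>\<^sup>+\<tau>. indicator {- real m..real m} \<tau> * ennreal (\<bar>G (x + \<tau> *\<^sub>R \<xi>)\<bar> powr p) \<partial>lborel) \<noteq> \<infinity>" for m
  proof (rule nn_integral_noteq_infinite)
    have "(\<integral>\<^sup>+x. \<integral>\<^sup>+\<tau>. indicator {- real m..real m} \<tau> * ennreal (\<bar>G (x + \<tau> *\<^sub>R \<xi>)\<bar> powr p) \<partial>lborel \<partial>lborel)
      = emeasure lborel {- real m..real m} * Lp_pow p G"
      by (rule nn_integral_line[of "\<lambda>x. ennreal (\<bar>G x\<bar> powr p)"]) auto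
    also have "\<dots> < \<infinity>" using G by (simp add: ennreal_mult_less_top)
    finally show "(\<integral>\<^sup>+x. \<integral>\<^sup>+\<tau>. indicator {- real m..real m} \<tau> * ennreal (\<bar>G (x + \<tau> *\<^sub>R \<xi>)\<bar> powr p) \<partial>lborel \<partial>lborel) \<noteq> \<infinity>"
      by simp
  qed measurable
  then have "AE x in lborel. \<forall>m. (\<integral>\<^sup>+\<tau>. indicator {- real m..real m} \<tau> * ennreal (\<bar>G (x + \<tau> *\<^sub>R \<xi>)\<bar> powr p) \<partial>lborel) \<noteq> \<infinity>"
    by (simp add: AE_all_countable)
  then have line: "AE x in lborel. (\<integral>\<^sup>+\<tau>. indicator {0..1} \<tau> * indicator B (x + \<tau> *\<^sub>R \<xi>) \<partial>lborel) = (0::ennreal)"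
  proof eventually_elim
    case (elim x)
    define v where "v \<tau> = G (x + \<tau> *\<^sub>R \<xi>)" for \<tau>
    have [measurable]: "v \<in> borel_measurable borel" unfolding v_def[abs_def] by measurable
    \<comment> \<open>The p-norm of v is controlled on bounded intervals only. The integrability
      lemma is therefore applied to v times the indicator, a product that a second factor of the
      indicator leaves unchanged.\<close>
    have si: "set_integrable lborel {- real m..real m} v" for m
    proof -
      let ?I = "{- real m..real m}"
      have "(\<integral>\<^sup>+\<tau>. ennreal (\<bar>indicator ?I \<tau> * v \<tau>\<bar> powr p) \<partial>lborel) = (\<integral>\<^sup>+\<tau>. indicator ?I \<tau> * ennreal (\<bar>v \<tau>\<bar> powr p) \<partial>lborel)"
        by (intro nn_integral_cong) (auto split: split_indicator)
      also have "\<dots> < \<infinity>" using elim[rule_format, of m] by (simp add: v_def less_top)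
      finally have "integrable lborel (\<lambda>\<tau>. indicator ?I \<tau> * (indicator ?I (0 + \<tau>) * v (0 + \<tau>)))"
        by (intro integrable_Lp_on_finite_measure[OF _ _ p]) auto
      moreover have "indicator ?I \<tau> * (indicator ?I \<tau> * v \<tau>) = indicator ?I \<tau> * v \<tau>" for \<tau>
        by (auto split: split_indicator)
      ultimately show ?thesis by (simp add: set_integrable_def)
    qed
    have si': "set_integrable lborel {a..b} v" for a b
    proof -
      obtain m where "max \<bar>a\<bar> \<bar>b\<bar> \<le> real m" using real_arch_simple by blast
      then show ?thesis by (intro set_integrable_subset[OF si[of m]]) auto
    qed
    have "v integrable_on cbox a b" for a b
      using set_borel_integral_eq_integral(1)[OF si'] by (simp add: cbox_interval)
    then obtain N where N: "negligible N"
      "\<And>\<tau> e. \<tau> \<notin> N \<Longrightarrow> 0 < e \<Longrightarrow> \<exists>d>0. \<forall>h. 0 < h \<and> h < d \<longrightarrow> norm (integral (cbox \<tau> (\<tau> + h *\<^sub>R One)) v /\<^sub>R h ^ DIM(real) - v \<tau>) < e"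
      using integrable_ccontinuous_explicit[of v] by metis
    have "x + \<tau> *\<^sub>R \<xi> \<notin> B" if \<tau>: "\<tau> \<notin> N" for \<tau>
      unfolding B_iff
    proof (rule LIMSEQ_I)
      fix e :: real
      assume "e > 0"
      then obtain d where d: "d > 0" "\<And>h. 0 < h \<Longrightarrow> h < d \<Longrightarrow> norm (integral (cbox \<tau> (\<tau> + h *\<^sub>R One)) v /\<^sub>R h ^ DIM(real) - v \<tau>) < e"
        using N(2)[OF \<tau>] by metis
      obtain k0 where k0: "\<And>k. k \<ge> k0 \<Longrightarrow> norm (t k - 0) < d"
        using LIMSEQ_D[OF t(2) d(1)] by blast
      have "norm (line_mean G (t k *\<^sub>R \<xi>) (x + \<tau> *\<^sub>R \<xi>) - G (x + \<tau> *\<^sub>R \<xi>)) < e" if "k \<ge> k0" for k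
      proof -
        have "line_mean G (t k *\<^sub>R \<xi>) (x + \<tau> *\<^sub>R \<xi>) = integral {\<tau>..\<tau> + t k} v / t k"
          unfolding v_def by (rule line_mean_eq_interval_mean[OF t(1)]) (use si' in \<open>simp add: v_def[abs_def]\<close>)
        then show ?thesis
          using d(2)[of "t k"] t(1)[of k] k0[OF that] by (simp add: v_def cbox_interval divide_inverse mult.commute)
      qed
      then show "\<exists>no. \<forall>k\<ge>no. norm (line_mean G (t k *\<^sub>R \<xi>) (x + \<tau> *\<^sub>R \<xi>) - G (x + \<tau> *\<^sub>R \<xi>)) < e" by blast
    qed
    moreover have "AE \<tau> in lebesgue. \<tau> \<notin> N"
      using N(1) by (intro AE_not_in) (simp add: negligible_iff_null_sets)
    ultimately have "AE \<tau> in lebesgue. x + \<tau> *\<^sub>R \<xi> \<notin> B" by (auto elim: eventually_mono)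
    then have "AE \<tau> in lborel. x + \<tau> *\<^sub>R \<xi> \<notin> B" by (simp add: AE_completion_iff)
    then have "(\<integral>\<^sup>+\<tau>. indicator {0..1} \<tau> * indicator B (x + \<tau> *\<^sub>R \<xi>) \<partial>lborel) = (\<integral>\<^sup>+\<tau>. 0 \<partial>(lborel :: real measure))"
      by (intro nn_integral_cong_AE) (auto elim!: eventually_mono)
    then show ?case by simp
  qed
  \<comment> \<open>The unit interval has measure 1, so the measure of \<open>B\<close> equals the
    integral over x of the time that the segment from x spends in \<open>B\<close>, and this time is
    0 for almost every x.\<close>
  have "emeasure lborel B = emeasure lborel {0..1::real} * (\<integral>\<^sup>+x. indicator B x \<partial>lborel)" by simp
  also have "\<dots> = (\<integral>\<^sup>+x. \<integral>\<^sup>+\<tau>. indicator {0..1} \<tau> * indicator B (x + \<tau> *\<^sub>R \<xi>) \<partial>lborel \<partial>lborel)"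
    by (rule nn_integral_line[symmetric]) auto
  also have "\<dots> = (\<integral>\<^sup>+x. 0 \<partial>(lborel :: 'a measure))"
    by (rule nn_integral_cong_AE[OF line])
  finally have "B \<in> null_sets lborel" by (simp add: null_sets_def)
  from AE_not_in[OF this] show ?thesis by (simp add: B_iff)
qed

text \<open>Negating the claim yields a sequence t k -> 0 with small energies. A sequence is the
  right setting, since almost everywhere convergence of the averages and Fatou's lemma are both
  countable statements.\<close>

lemma shift_energy_ge_grad:
  fixes f :: "'a::euclidean_space \<Rightarrow> real" and g :: "'a \<Rightarrow> 'a"
  assumes f [measurable]: "f \<in> borel_measurable borel" and g [measurable]: "g \<in> borel_measurable borel"
    and p: "p \<ge> 1" and F: "Lp_pow p f < \<infinity>"
    and G: "\<And>z. grad_energy p g z < \<infinity>"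
    and weak: "weak_gradient f g"
    and c: "c \<ge> 0" "ennreal c < grad_energy p g \<xi>"
  shows "\<exists>\<delta>>0. \<forall>t. 0 < t \<and> t < \<delta> \<longrightarrow> ennreal (c * t powr p) \<le> shift_energy p f (t *\<^sub>R \<xi>)"
proof (rule ccontr)
  assume "\<not> ?thesis"
  then have "\<forall>k. \<exists>t. 0 < t \<and> t < 1 / real (Suc k) \<and> \<not> ennreal (c * t powr p) \<le> shift_energy p f (t *\<^sub>R \<xi>)"
    by (metis of_nat_0_less_iff zero_less_Suc zero_less_divide_1_iff)
  then obtain t where t: "\<And>k. 0 < t k" "\<And>k. t k < 1 / real (Suc k)"
    "\<And>k. shift_energy p f (t k *\<^sub>R \<xi>) < ennreal (c * t k powr p)"
    by (metis not_le)
  have t0: "t \<longlonglongrightarrow> 0"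
    by (rule tendsto_sandwich[OF _ _ tendsto_const LIMSEQ_Suc[OF lim_1_over_n]])
       (auto intro!: always_eventually less_imp_le t simp del: of_nat_Suc)
  let ?G = "\<lambda>x. g x \<bullet> \<xi>"
  let ?A = "\<lambda>k x. line_mean ?G (t k *\<^sub>R \<xi>) x"
  have A_le: "(\<integral>\<^sup>+x. ennreal (\<bar>?A k x\<bar> powr p) \<partial>lborel) \<le> ennreal c" for k
  proof -
    \<comment> \<open>The factor t k of the direction comes out of the inner product; dividing the
      energy by t k powr p therefore leaves the averages of g in the fixed direction
      \<open>\<xi>\<close>.\<close>
    have lm: "line_mean (\<lambda>x. g x \<bullet> (t k *\<^sub>R \<xi>)) (t k *\<^sub>R \<xi>) x = t k * ?A k x" for x
      by (simp add: line_mean_def mult.left_commute)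
    have "ennreal (t k powr p) * (\<integral>\<^sup>+x. ennreal (\<bar>?A k x\<bar> powr p) \<partial>lborel) = (\<integral>\<^sup>+x. ennreal (\<bar>t k * ?A k x\<bar> powr p) \<partial>lborel)"
      using t(1)[of k] by (subst nn_integral_cmult[symmetric]) (auto simp: abs_mult powr_mult ennreal_mult')
    also have "\<dots> = shift_energy p f (t k *\<^sub>R \<xi>)"
      by (simp only: shift_energy_eq_line_mean[OF f g p F G weak] lm)
    also have "\<dots> \<le> ennreal (t k powr p) * ennreal c"
      using t(3)[of k] c by (simp add: ennreal_mult'[symmetric] mult.commute less_imp_le)
    finally show ?thesis using t(1)[of k] by (subst (asm) ennreal_mult_le_mult_iff) auto
  qed
  have "AE x in lborel. (\<lambda>k. ?A k x) \<longlonglongrightarrow> ?G x"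
    by (rule line_mean_tendsto_AE[OF _ p G t(1) t0]) measurable
  then have "AE x in lborel. ennreal (\<bar>?G x\<bar> powr p) = liminf (\<lambda>k. ennreal (\<bar>?A k x\<bar> powr p))"
  proof eventually_elim
    case (elim x)
    then have "(\<lambda>k. ennreal (\<bar>?A k x\<bar> powr p)) \<longlonglongrightarrow> ennreal (\<bar>?G x\<bar> powr p)"
      using p by (intro tendsto_ennrealI tendsto_powr' tendsto_rabs tendsto_const) auto
    then show ?case by (rule lim_imp_Liminf[OF sequentially_bot, symmetric])
  qed
  then have "(\<integral>\<^sup>+x. ennreal (\<bar>?G x\<bar> powr p) \<partial>lborel) = (\<integral>\<^sup>+x. liminf (\<lambda>k. ennreal (\<bar>?A k x\<bar> powr p)) \<partial>lborel)"
    by (rule nn_integral_cong_AE)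
  also have "\<dots> \<le> liminf (\<lambda>k. \<integral>\<^sup>+x. ennreal (\<bar>?A k x\<bar> powr p) \<partial>lborel)"
    by (rule nn_integral_liminf) measurable
  also have "\<dots> \<le> ennreal c"
    using Liminf_mono[of "\<lambda>k. \<integral>\<^sup>+x. ennreal (\<bar>?A k x\<bar> powr p) \<partial>lborel" "\<lambda>_. ennreal c" sequentially] A_le
    by (simp add: Liminf_const)
  finally show False using c(2) by simp
qed

section \<open>The gauge bounded by the gradient energy\<close>

text \<open>An interpolation between gradient energy and norm with weights s and 1 - s. An upper
  bound \<open>N\<close> > 0 replaces the energy itself, so that zero energy, as at
  \<open>\<xi>\<close> = 0, is covered.\<close>

lemma frac_gauge_pow_le_grad:
  fixes f :: "'a::euclidean_space \<Rightarrow> real" and g :: "'a \<Rightarrow> 'a"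
  assumes f [measurable]: "f \<in> borel_measurable borel" and g [measurable]: "g \<in> borel_measurable borel"
    and p: "p \<ge> 1" and s: "0 < s" "s < 1"
    and F: "Lp_pow p f = ennreal F" "F > 0"
    and G: "\<And>z. grad_energy p g z < \<infinity>"
    and weak: "weak_gradient f g"
    and N: "grad_energy p g \<xi> \<le> ennreal N" "N > 0"
  shows "frac_gauge_pow s p f \<xi> \<le> ennreal (N powr s * (2 powr p * F) powr (1 - s) / (p * s * (1 - s)))"
proof -
  have F': "Lp_pow p f < \<infinity>" using F by simp
  define \<Phi> where "\<Phi> = 2 powr p * F"
  have \<Phi>: "\<Phi> > 0" using F by (simp add: \<Phi>_def)
  \<comment> \<open>The solution of T powr p * N = \<open>\<Phi>\<close>, where the gradient bound
    and the norm bound on the shift energy agree. Both parts of the integral then have the same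
    numerator, and 1 / (p (1 - s)) + 1 / (s p) = 1 / (p s (1 - s)).\<close>
  define T where "T = (\<Phi> / N) powr (1 / p)"
  have T: "T > 0" using \<Phi> N by (simp add: T_def)
  let ?w = "\<lambda>t::real. ennreal (t powr (- s * p) / t)"
  have small: "shift_energy p f (t *\<^sub>R \<xi>) \<le> ennreal (t powr p * N)" if "t > 0" for t
  proof -
    have "shift_energy p f (t *\<^sub>R \<xi>) \<le> (\<integral>\<^sup>+x. ennreal (\<bar>g x \<bullet> (t *\<^sub>R \<xi>)\<bar> powr p) \<partial>lborel)"
      by (rule shift_energy_le_grad[OF f g p F' G weak])
    also have "\<dots> = ennreal (t powr p) * grad_energy p g \<xi>"
      using that by (subst nn_integral_cmult[symmetric]) (auto simp: abs_mult powr_mult ennreal_mult')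
    also have "\<dots> \<le> ennreal (t powr p) * ennreal N" by (intro mult_left_mono N) auto
    finally show ?thesis by (simp add: ennreal_mult')
  qed
  have large: "shift_energy p f z \<le> ennreal \<Phi>" for z
    using shift_energy_le_norm[OF f p, of z] F by (simp add: ennreal_mult' \<Phi>_def)
  have "frac_gauge_pow s p f \<xi> \<le> (\<integral>\<^sup>+t. (indicator {0<..<T} t * ennreal (t powr (p * (1 - s)) / t)) * ennreal N
     + (indicator {T..} t * ennreal (t powr (- (s * p)) / t)) * ennreal \<Phi> \<partial>lborel)"
    unfolding frac_gauge_pow_eq_shift_energy
  proof (rule nn_integral_mono)
    fix t :: real
    consider "t \<le> 0" | "0 < t" "t < T" | "T \<le> t" "0 < t" by linarith
    then show "indicator {0<..} t * ?w t * shift_energy p f (t *\<^sub>R \<xi>) \<le>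
      (indicator {0<..<T} t * ennreal (t powr (p * (1 - s)) / t)) * ennreal N + (indicator {T..} t * ennreal (t powr (- (s * p)) / t)) * ennreal \<Phi>"
    proof cases
      case 2
      have "?w t * shift_energy p f (t *\<^sub>R \<xi>) \<le> ?w t * ennreal (t powr p * N)"
        using 2 by (intro mult_left_mono small) auto
      also have "\<dots> = ennreal (t powr (- s * p) / t * (t powr p * N))"
        using 2 by (intro ennreal_mult'[symmetric]) auto
      also have "t powr (- s * p) / t * (t powr p * N) = t powr (p * (1 - s)) / t * N"
        using 2 by (simp add: powr_add[symmetric] algebra_simps)
      also have "ennreal \<dots> = ennreal (t powr (p * (1 - s)) / t) * ennreal N"
        using 2 by (intro ennreal_mult') auto
      finally show ?thesis using 2 by simp
    next
      case 3
      then show ?thesis using mult_left_mono[OF large[of "t *\<^sub>R \<xi>"], of "?w t"] T by simp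
    qed simp
  qed
  also have "\<dots> = (\<integral>\<^sup>+t. indicator {0<..<T} t * ennreal (t powr (p * (1 - s)) / t) \<partial>lborel) * ennreal N
     + (\<integral>\<^sup>+t. indicator {T..} t * ennreal (t powr (- (s * p)) / t) \<partial>lborel) * ennreal \<Phi>"
    by (simp add: nn_integral_add nn_integral_multc)
  also have "\<dots> = ennreal (T powr (p * (1 - s)) / (p * (1 - s))) * ennreal N + ennreal (T powr (- (s * p)) / (s * p)) * ennreal \<Phi>"
    using T p s by (subst nn_integral_powr_head nn_integral_powr_tail; simp)+
  also have "\<dots> = ennreal (T powr (p * (1 - s)) / (p * (1 - s)) * N + T powr (- (s * p)) / (s * p) * \<Phi>)"
    using N \<Phi> p s by (simp add: ennreal_mult'[symmetric] ennreal_plus[symmetric] del: ennreal_plus)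
  also have "T powr (p * (1 - s)) / (p * (1 - s)) * N + T powr (- (s * p)) / (s * p) * \<Phi> = N powr s * \<Phi> powr (1 - s) / (p * s * (1 - s))"
  proof -
    have "T powr (p * (1 - s)) * N = N powr s * \<Phi> powr (1 - s)"
      using N \<Phi> p by (simp add: T_def powr_powr powr_divide powr_diff)
    moreover have "T powr (- (s * p)) * \<Phi> = N powr s * \<Phi> powr (1 - s)"
      using N \<Phi> p by (simp add: T_def powr_powr powr_divide powr_diff powr_minus_divide)
    ultimately have "T powr (p * (1 - s)) / (p * (1 - s)) * N + T powr (- (s * p)) / (s * p) * \<Phi> =
       N powr s * \<Phi> powr (1 - s) / (p * (1 - s)) + N powr s * \<Phi> powr (1 - s) / (s * p)"
      by (simp add: mult.commute)
    also have "\<dots> = N powr s * \<Phi> powr (1 - s) / (p * s * (1 - s))"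
      using p s by (simp add: divide_simps) (simp add: algebra_simps)
    finally show ?thesis .
  qed
  finally show ?thesis by (simp add: \<Phi>_def)
qed

section \<open>Comparison with the polar projection body\<close>

lemma polar_proj_body_eq:
  "polar_proj_body p g = {\<xi>. grad_energy p g \<xi> \<le> 1}"
  by (simp add: polar_proj_body_def nn_integral_completion)

lemma polar_proj_body_sets [measurable]:
  fixes g :: "'a::euclidean_space \<Rightarrow> 'a"
  assumes [measurable]: "g \<in> borel_measurable borel"
  shows "polar_proj_body p g \<in> sets borel"
proof -
  have "(\<lambda>\<xi>. \<integral>\<^sup>+x. ennreal (\<bar>g x \<bullet> \<xi>\<bar> powr p) \<partial>lborel) \<in> borel_measurable borel" by measurable
  then show ?thesis unfolding polar_proj_body_eq by measurable
qed

lemma grad_energy_sublevel: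
  fixes g :: "'a::euclidean_space \<Rightarrow> 'a"
  assumes [measurable]: "g \<in> borel_measurable borel" and r: "r > 0"
  shows "{\<xi>. grad_energy p g \<xi> \<le> ennreal (r powr p)} = {\<xi>. \<xi> /\<^sub>R r \<in> polar_proj_body p g}"
proof -
  have scale: "grad_energy p g \<xi> = ennreal (r powr p) * (\<integral>\<^sup>+x. ennreal (\<bar>g x \<bullet> (\<xi> /\<^sub>R r)\<bar> powr p) \<partial>lborel)" for \<xi>
  proof -
    have "ennreal (\<bar>g x \<bullet> \<xi>\<bar> powr p) = ennreal (r powr p) * ennreal (\<bar>g x \<bullet> (\<xi> /\<^sub>R r)\<bar> powr p)" for x
    proof -
      have "\<bar>g x \<bullet> \<xi>\<bar> = r * \<bar>g x \<bullet> (\<xi> /\<^sub>R r)\<bar>" using r by (simp add: abs_mult)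
      then have "\<bar>g x \<bullet> \<xi>\<bar> powr p = r powr p * \<bar>g x \<bullet> (\<xi> /\<^sub>R r)\<bar> powr p"
        using r by (simp only:) (rule powr_mult; simp)
      then show ?thesis by (simp add: ennreal_mult'[symmetric])
    qed
    then show ?thesis by (simp only:) (rule nn_integral_cmult, measurable)
  qed
  have "grad_energy p g \<xi> \<le> ennreal (r powr p) \<longleftrightarrow> \<xi> /\<^sub>R r \<in> polar_proj_body p g" for \<xi>
    using r ennreal_mult_le_mult_iff[of "ennreal (r powr p)" "\<integral>\<^sup>+x. ennreal (\<bar>g x \<bullet> (\<xi> /\<^sub>R r)\<bar> powr p) \<partial>lborel" 1]
    unfolding polar_proj_body_eq scale[of \<xi>] by simp
  then show ?thesis by simp
qed

lemma emeasure_grad_energy_sublevel: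
  fixes g :: "'a::euclidean_space \<Rightarrow> 'a"
  assumes g: "g \<in> borel_measurable borel" and r: "r > 0"
  shows "emeasure lborel {\<xi>. grad_energy p g \<xi> \<le> ennreal (r powr p)} =
    ennreal (r ^ DIM('a)) * emeasure lborel (polar_proj_body p g)"
  unfolding grad_energy_sublevel[OF g r]
  by (rule emeasure_lborel_scaleR[OF polar_proj_body_sets[OF g] r])

text \<open>With r powr p = F / 2, every shift of gradient energy at most r powr p has shift energy
  at most F / 2, so absorption bounds the dilate of the polar body by r. The estimate both bounds
  the norm of f and gives the polar body finite volume.\<close>

lemma affine_poincare:
  fixes f :: "'a::euclidean_space \<Rightarrow> real" and g :: "'a \<Rightarrow> 'a"
  assumes f [measurable]: "f \<in> borel_measurable borel" and g [measurable]: "g \<in> borel_measurable borel"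
    and p: "p \<ge> 1"
    and F: "Lp_pow p f = ennreal F" "F > 0"
    and G: "\<And>z. grad_energy p g z < \<infinity>"
    and weak: "weak_gradient f g"
  shows "ennreal (((F / 2) powr (1 / p)) ^ DIM('a)) * emeasure lborel (polar_proj_body p g) \<le> 2 * emeasure lborel (supp_set f)"
proof -
  have F': "Lp_pow p f < \<infinity>" using F by simp
  define r where "r = (F / 2) powr (1 / p)"
  have r: "r > 0" "r powr p = F / 2" using F p by (auto simp: r_def powr_powr)
  have "emeasure lborel {\<xi>. grad_energy p g \<xi> \<le> ennreal (r powr p)} \<le> 2 * emeasure lborel (supp_set f)"
  proof (rule emeasure_small_shift_energy_le[OF f _ F])
    show "{\<xi>. grad_energy p g \<xi> \<le> ennreal (r powr p)} \<in> sets borel"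
      unfolding grad_energy_sublevel[OF g r(1)] by measurable
    show "shift_energy p f z \<le> ennreal (F / 2)"
      if "z \<in> {\<xi>. grad_energy p g \<xi> \<le> ennreal (r powr p)}" for z
      using order_trans[OF shift_energy_le_grad[OF f g p F' G weak]] that r(2) by simp
  qed
  then show ?thesis unfolding emeasure_grad_energy_sublevel[OF g r(1)] by (simp add: r_def)
qed

lemma emeasure_polar_proj_body_pos:
  fixes g :: "'a::euclidean_space \<Rightarrow> 'a"
  assumes [measurable]: "g \<in> borel_measurable borel" and p: "p \<ge> 1"
    and fin: "(\<integral>\<^sup>+x. ennreal (norm (g x) powr p) \<partial>lborel) < \<infinity>"
  shows "emeasure lborel (polar_proj_body p g) > 0"
proof -
  obtain b where b: "b \<ge> 0" "(\<integral>\<^sup>+x. ennreal (norm (g x) powr p) \<partial>lborel) = ennreal b"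
    using fin by (cases "\<integral>\<^sup>+x. ennreal (norm (g x) powr p) \<partial>lborel") auto
  \<comment> \<open>Small enough that \<open>\<rho>\<close> powr p * b <= 1; the summand 1 keeps the
    radius meaningful when b = 0.\<close>
  define \<rho> where "\<rho> = (1 / (b + 1)) powr (1 / p)"
  have \<rho>: "\<rho> > 0" "\<rho> powr p = 1 / (b + 1)" using b p by (auto simp: \<rho>_def powr_powr)
  have "cball 0 \<rho> \<subseteq> polar_proj_body p g"
  proof
    fix \<xi> :: 'a
    assume "\<xi> \<in> cball 0 \<rho>"
    then have \<xi>: "norm \<xi> \<le> \<rho>" by simp
    have "grad_energy p g \<xi> \<le> (\<integral>\<^sup>+x. ennreal (\<rho> powr p) * ennreal (norm (g x) powr p) \<partial>lborel)"
    proof (rule nn_integral_mono)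
      fix x
      have "\<bar>g x \<bullet> \<xi>\<bar> \<le> norm (g x) * \<rho>"
        using Cauchy_Schwarz_ineq2[of "g x" \<xi>] mult_left_mono[OF \<xi>, of "norm (g x)"] by simp
      then have "\<bar>g x \<bullet> \<xi>\<bar> powr p \<le> (\<rho> * norm (g x)) powr p"
        using p by (intro powr_mono2) (auto simp: mult.commute)
      then show "ennreal (\<bar>g x \<bullet> \<xi>\<bar> powr p) \<le> ennreal (\<rho> powr p) * ennreal (norm (g x) powr p)"
        using \<rho>(1) by (simp add: powr_mult ennreal_mult'[symmetric])
    qed
    also have "\<dots> = ennreal (\<rho> powr p) * ennreal b" by (simp add: nn_integral_cmult b)
    also have "\<dots> = ennreal (b / (b + 1))" using b by (simp add: \<rho> ennreal_mult'[symmetric])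
    also have "\<dots> \<le> ennreal 1" using b by (intro ennreal_leI) simp
    finally show "\<xi> \<in> polar_proj_body p g" by (simp add: polar_proj_body_eq)
  qed
  then have "emeasure lborel (cball (0::'a) \<rho>) \<le> emeasure lborel (polar_proj_body p g)"
    by (intro emeasure_mono) auto
  moreover have "emeasure lborel (cball (0::'a) \<rho>) > 0"
    using emeasure_cball[of \<rho> "0::'a"] \<rho>(1) unit_ball_vol_pos[of "real DIM('a)"] by (simp add: ennreal_zero_less_mult_iff)
  ultimately show ?thesis by (rule less_le_trans[rotated])
qed

text \<open>The dilation factor \<open>\<mu>\<close> is chosen so that N = \<open>\<mu>\<close> powr
  p makes the bound of \<open>frac_gauge_pow_le_grad\<close> exactly c. The level c = 1 serves the
  inequality (b), c = 1 / (p (1 - s)) the limit (c).\<close>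

lemma emeasure_frac_gauge_pow_sublevel_ge:
  fixes f :: "'a::euclidean_space \<Rightarrow> real" and g :: "'a \<Rightarrow> 'a"
  assumes f [measurable]: "f \<in> borel_measurable borel" and g [measurable]: "g \<in> borel_measurable borel"
    and p: "p \<ge> 1" and s: "0 < s" "s < 1"
    and F: "Lp_pow p f = ennreal F" "F > 0"
    and G: "\<And>z. grad_energy p g z < \<infinity>"
    and weak: "weak_gradient f g" and c: "c > 0"
    and \<mu>: "\<mu> = (c * p * s * (1 - s) * (2 powr p * F) powr (s - 1)) powr (1 / (s * p))"
  shows "ennreal (\<mu> ^ DIM('a)) * emeasure lborel (polar_proj_body p g) \<le> emeasure lborel {\<xi>. frac_gauge_pow s p f \<xi> \<le> ennreal c}"
proof -
  have \<mu>0: "\<mu> > 0" using c p s F by (simp add: \<mu>)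
  have eq: "(\<mu> powr p) powr s * (2 powr p * F) powr (1 - s) / (p * s * (1 - s)) = c"
  proof -
    have "(\<mu> powr p) powr s = c * p * s * (1 - s) * (2 powr p * F) powr (s - 1)"
      using c p s F by (simp add: \<mu> powr_powr mult.commute[of p s])
    also have "(2 powr p * F) powr (s - 1) = 1 / (2 powr p * F) powr (1 - s)"
      using powr_minus_divide[of "2 powr p * F" "1 - s"] by simp
    finally show ?thesis using c p s F by simp
  qed
  have "{\<xi>. grad_energy p g \<xi> \<le> ennreal (\<mu> powr p)} \<subseteq> {\<xi>. frac_gauge_pow s p f \<xi> \<le> ennreal c}"
    using frac_gauge_pow_le_grad[OF f g p s F G weak, of _ "\<mu> powr p"] \<mu>0 unfolding eq by auto
  then show ?thesis
    unfolding emeasure_grad_energy_sublevel[OF g \<mu>0, symmetric] by (intro emeasure_mono) auto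
qed

text \<open>The dilate inclusion gives the power s of X = (\<open>\<sigma>\<close> / P) powr (1 /
  n), multiplied by the norm factor \<open>\<Phi>\<close> powr ((1 - s) / p); Poincare bounds that
  factor by 8 X powr (1 - s), and the powers of X add up to 1.\<close>

lemma frac_polar_le_polar:
  fixes f :: "'a::euclidean_space \<Rightarrow> real" and g :: "'a \<Rightarrow> 'a"
  defines "n \<equiv> real DIM('a)"
  assumes f [measurable]: "f \<in> borel_measurable borel" and g [measurable]: "g \<in> borel_measurable borel"
    and p: "p \<ge> 1" and s: "0 < s" "s < 1"
    and F: "Lp_pow p f = ennreal F" "F > 0"
    and G: "\<And>z. grad_energy p g z < \<infinity>"
    and weak: "weak_gradient f g"
    and \<sigma>: "emeasure lborel (supp_set f) = ennreal \<sigma>" "\<sigma> > 0"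
    and P: "emeasure lborel (polar_proj_body p g) = ennreal P" "P > 0"
    and k: "emeasure lborel (frac_polar_proj_body s p f) = ennreal k" "k \<ge> 0"
  shows "(s * (1 - s)) powr (1 / p) * \<sigma> powr (s / n) * k powr (- s / n) \<le> 8 * \<sigma> powr (1 / n) * P powr (- 1 / n)"
proof -
  have n: "n \<ge> 1" by (simp add: n_def DIM_positive Suc_leI)
  define \<Phi> where "\<Phi> = 2 powr p * F"
  have \<Phi>: "\<Phi> > 0" using F by (simp add: \<Phi>_def)
  define \<mu> where "\<mu> = (1 * p * s * (1 - s) * \<Phi> powr (s - 1)) powr (1 / (s * p))"
  have \<mu>: "\<mu> > 0" using p s \<Phi> by (simp add: \<mu>_def)
  have \<mu>n: "\<mu> ^ DIM('a) = \<mu> powr n" using \<mu> by (simp add: n_def powr_realpow)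
  have "ennreal (\<mu> ^ DIM('a)) * ennreal P \<le> ennreal k"
    using emeasure_frac_gauge_pow_sublevel_ge[OF f g p s F G weak, of 1 \<mu>] P k
    by (simp add: \<mu>_def \<Phi>_def frac_polar_proj_body_def)
  then have "\<mu> powr n * P \<le> k" using P k \<mu> by (simp add: ennreal_mult'[symmetric] \<mu>n)
  \<comment> \<open>The lower bound for k must be positive for \<open>powr_mono2'\<close> to compare
    powers with the negative exponent - s / n.\<close>
  moreover have "\<mu> powr n * P > 0" using \<mu> P by simp
  ultimately have "k powr (- s / n) \<le> (\<mu> powr n * P) powr (- s / n)"
    using s n by (intro powr_mono2') (auto simp: divide_nonneg_pos)
  also have "\<dots> = \<mu> powr (- s) * P powr (- s / n)"
    using n \<mu> P by (simp add: powr_mult powr_powr)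
  also have "\<mu> powr (- s) = (p * s * (1 - s)) powr (- 1 / p) * \<Phi> powr ((1 - s) / p)"
  proof -
    have "\<mu> powr (- s) = (p * s * (1 - s) * \<Phi> powr (s - 1)) powr (- 1 / p)"
      using s p by (simp add: \<mu>_def powr_powr)
    also have "\<dots> = (p * s * (1 - s)) powr (- 1 / p) * \<Phi> powr ((s - 1) * (- 1 / p))"
      using s p \<Phi> by (simp add: powr_mult powr_powr)
    also have "(s - 1) * (- 1 / p) = (1 - s) / p" using p by (simp add: field_simps)
    finally show ?thesis .
  qed
  also have "(p * s * (1 - s)) powr (- 1 / p) = p powr (- 1 / p) * (s * (1 - s)) powr (- 1 / p)"
    using p s by (simp add: powr_mult mult.assoc)
  finally have k_le: "k powr (- s / n) \<le> p powr (- 1 / p) * (s * (1 - s)) powr (- 1 / p) * \<Phi> powr ((1 - s) / p) * P powr (- s / n)" .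
  define X where "X = (\<sigma> / P) powr (1 / n)"
  have X: "X > 0" using \<sigma> P by (simp add: X_def)
  have poinc: "(F / 2) powr (1 / p) \<le> (2 * \<sigma> / P) powr (1 / n)"
  proof -
    let ?r = "(F / 2) powr (1 / p)"
    have "ennreal (?r ^ DIM('a)) * ennreal P \<le> 2 * ennreal \<sigma>"
      using affine_poincare[OF f g p F G weak] P \<sigma> by simp
    then have "ennreal (?r ^ DIM('a) * P) \<le> ennreal (2 * \<sigma>)"
    proof -
      assume "ennreal (?r ^ DIM('a)) * ennreal P \<le> 2 * ennreal \<sigma>"
      moreover have "ennreal (?r ^ DIM('a)) * ennreal P = ennreal (?r ^ DIM('a) * P)"
        by (rule ennreal_mult'[symmetric]) simp
      moreover have "2 * ennreal \<sigma> = ennreal (2 * \<sigma>)" by (simp add: ennreal_mult')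
      ultimately show ?thesis by simp
    qed
    then have "?r ^ DIM('a) * P \<le> 2 * \<sigma>" using \<sigma> by (subst (asm) ennreal_le_iff) auto
    then have "?r powr n \<le> 2 * \<sigma> / P" using P F by (simp add: n_def powr_realpow pos_le_divide_eq)
    then have "(?r powr n) powr (1 / n) \<le> (2 * \<sigma> / P) powr (1 / n)" using n by (intro powr_mono2) auto
    then show ?thesis using n by (simp add: powr_powr)
  qed
  \<comment> \<open>Three factors 2: from the 2 powr p in \<open>\<Phi>\<close>, from 2 powr (1 / p)
    for F / 2, and from 2 powr (1 / n) for twice the support.\<close>
  have "\<Phi> powr (1 / p) \<le> 8 * X"
  proof -
    have "\<Phi> powr (1 / p) = 2 * F powr (1 / p)" using F p by (simp add: \<Phi>_def powr_mult powr_powr)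
    also have "F powr (1 / p) = 2 powr (1 / p) * (F / 2) powr (1 / p)" using F by (simp add: powr_mult[symmetric])
    also have "\<dots> \<le> 2 * (2 * \<sigma> / P) powr (1 / n)"
      using poinc p powr_mono[of "1 / p" 1 2] by (intro mult_mono) auto
    also have "(2 * \<sigma> / P) powr (1 / n) = 2 powr (1 / n) * X"
      using \<sigma> P by (simp add: X_def powr_mult[symmetric])
    also have "\<dots> \<le> 2 * X"
      using X n powr_mono[of "1 / n" 1 2] by (intro mult_right_mono) auto
    finally show ?thesis by simp
  qed
  then have "(\<Phi> powr (1 / p)) powr (1 - s) \<le> (8 * X) powr (1 - s)"
    using s by (intro powr_mono2) auto
  also have "\<dots> = 8 powr (1 - s) * X powr (1 - s)" using X by (simp add: powr_mult)
  also have "\<dots> \<le> 8 * X powr (1 - s)" using s powr_mono[of "1 - s" 1 8] by (intro mult_right_mono) auto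
  finally have \<Phi>_le: "\<Phi> powr ((1 - s) / p) \<le> 8 * X powr (1 - s)" by (simp add: powr_powr)
  have "(s * (1 - s)) powr (1 / p) * \<sigma> powr (s / n) * k powr (- s / n) \<le>
     (s * (1 - s)) powr (1 / p) * \<sigma> powr (s / n) * (p powr (- 1 / p) * (s * (1 - s)) powr (- 1 / p) * \<Phi> powr ((1 - s) / p) * P powr (- s / n))"
    by (intro mult_left_mono k_le) auto
  also have "\<dots> = ((s * (1 - s)) powr (1 / p) * (s * (1 - s)) powr (- 1 / p)) * p powr (- 1 / p) * (\<sigma> powr (s / n) * P powr (- s / n)) * \<Phi> powr ((1 - s) / p)"
    by simp
  also have "(s * (1 - s)) powr (1 / p) * (s * (1 - s)) powr (- 1 / p) = 1"
    using s by (simp add: powr_add[symmetric])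
  also have "\<sigma> powr (s / n) * P powr (- s / n) = X powr s"
    using \<sigma> P by (simp add: X_def powr_powr powr_divide powr_minus_divide)
  also have "1 * p powr (- 1 / p) * X powr s * \<Phi> powr ((1 - s) / p) \<le> 1 * X powr s * (8 * X powr (1 - s))"
  proof (intro mult_mono \<Phi>_le)
    show "1 * p powr (- 1 / p) \<le> 1" using p powr_mono[of "- 1 / p" 0 p] by simp
  qed auto
  also have "\<dots> = 8 * X" using X by (simp add: powr_add[symmetric])
  also have "X = \<sigma> powr (1 / n) * P powr (- 1 / n)"
    using \<sigma> P by (simp add: X_def powr_divide powr_minus_divide)
  finally show ?thesis by simp
qed

section \<open>The limit as s tends to 1\<close>

text \<open>At the level 1 / (p (1 - s)) the factor 1 - s of the energy bound cancels, so one
  dilation brings all these sets into the set of shifts of energy at most F / 2, which has finite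
  measure. This provides the majorant for dominated convergence.\<close>

lemma normalized_body_bound:
  fixes f :: "'a::euclidean_space \<Rightarrow> real"
  assumes f [measurable]: "f \<in> borel_measurable borel" and p: "p \<ge> 1"
    and F: "Lp_pow p f = ennreal F" "F > 0"
    and \<sigma>: "emeasure lborel (supp_set f) < \<infinity>"
  shows "\<exists>D \<in> sets borel. emeasure lborel D < \<infinity> \<and>
    (\<forall>s \<in> {1/2<..<1}. {\<xi>. frac_gauge_pow s p f \<xi> \<le> ennreal (1 / (p * (1 - s)))} \<subseteq> D)"
proof -
  \<comment> \<open>The second entry gives 3 * 4 powr p * r powr (p / 2) <= F / 2; r <= 1 together
    with s > 1/2 replaces the exponent s p by p / 2.\<close>
  define r where "r = min 1 ((F / (6 * 4 powr p)) powr (2 / p))"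
  have r: "0 < r" "r \<le> 1" using F by (auto simp: r_def)
  have r_le: "3 * 4 powr p * r powr (p / 2) \<le> F / 2"
  proof -
    have "r powr (p / 2) \<le> ((F / (6 * 4 powr p)) powr (2 / p)) powr (p / 2)"
      using p r by (intro powr_mono2) (auto simp: r_def)
    also have "\<dots> = F / (6 * 4 powr p)" using p F by (simp add: powr_powr)
    finally show ?thesis by (simp add: field_simps)
  qed
  define E where "E = {z. shift_energy p f z \<le> ennreal (F / 2)}"
  have [measurable]: "E \<in> sets borel" unfolding E_def by measurable
  define D where "D = {\<xi>. \<xi> /\<^sub>R (1 / r) \<in> E}"
  have "emeasure lborel E \<le> 2 * emeasure lborel (supp_set f)"
    by (rule emeasure_small_shift_energy_le[OF f _ F]) (auto simp: E_def)
  also have "\<dots> < \<infinity>" using \<sigma> by (simp add: ennreal_mult_less_top)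
  finally have "emeasure lborel D < \<infinity>"
    using r emeasure_lborel_scaleR[of E "1 / r"] by (simp add: D_def ennreal_mult_less_top)
  moreover have "D \<in> sets borel" unfolding D_def by measurable
  moreover have "{\<xi>. frac_gauge_pow s p f \<xi> \<le> ennreal (1 / (p * (1 - s)))} \<subseteq> D" if s: "s \<in> {1/2<..<1}" for s
  proof
    fix \<xi>
    assume "\<xi> \<in> {\<xi>. frac_gauge_pow s p f \<xi> \<le> ennreal (1 / (p * (1 - s)))}"
    then have \<xi>: "frac_gauge_pow s p f \<xi> \<le> ennreal (1 / (p * (1 - s)))" by simp
    have "shift_energy p f (r *\<^sub>R \<xi>) \<le> ennreal (3 * 4 powr p * p * (1 - s)) * frac_gauge_pow s p f (r *\<^sub>R \<xi>)"
      using s by (intro shift_energy_le_frac_gauge_pow[OF f p]) auto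
    also have "\<dots> = ennreal (3 * 4 powr p * p * (1 - s)) * (ennreal (r powr (s * p)) * frac_gauge_pow s p f \<xi>)"
      by (simp add: frac_gauge_pow_scaleR[OF f r(1)])
    also have "\<dots> \<le> ennreal (3 * 4 powr p * p * (1 - s)) * (ennreal (r powr (s * p)) * ennreal (1 / (p * (1 - s))))"
      by (intro mult_left_mono \<xi>) auto
    also have "\<dots> = ennreal (3 * 4 powr p * r powr (s * p))"
      using p s by (simp add: ennreal_mult'[symmetric])
    also have "\<dots> \<le> ennreal (F / 2)"
    proof (rule ennreal_leI)
      have "r powr (s * p) \<le> r powr (p / 2)"
        using r p s by (intro powr_mono') auto
      then have "3 * 4 powr p * r powr (s * p) \<le> 3 * 4 powr p * r powr (p / 2)" by simp
      then show "3 * 4 powr p * r powr (s * p) \<le> F / 2" using r_le by linarith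
    qed
    finally show "\<xi> \<in> D" by (simp add: D_def E_def)
  qed
  ultimately show ?thesis by blast
qed

text \<open>Near t = 0 alone the gauge integral is at least c \<open>\<delta>\<close> powr (p (1 -
  s)) / (p (1 - s)), and the power of \<open>\<delta>\<close> tends to 1: the singular factor 1 / (1
  - s) comes entirely from small t.\<close>

lemma frac_gauge_pow_eventually_large:
  fixes f :: "'a::euclidean_space \<Rightarrow> real" and g :: "'a \<Rightarrow> 'a"
  assumes f [measurable]: "f \<in> borel_measurable borel" and g [measurable]: "g \<in> borel_measurable borel"
    and p: "p \<ge> 1" and F: "Lp_pow p f < \<infinity>"
    and G: "\<And>z. grad_energy p g z < \<infinity>"
    and weak: "weak_gradient f g" and \<xi>: "\<xi> \<notin> polar_proj_body p g"
  shows "\<forall>\<^sub>F s in at_left 1. \<not> frac_gauge_pow s p f \<xi> \<le> ennreal (1 / (p * (1 - s)))"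
proof -
  obtain N where N: "N \<ge> 0" "grad_energy p g \<xi> = ennreal N"
    using G[of \<xi>] by (cases "grad_energy p g \<xi>") auto
  have "N > 1" using \<xi> N by (simp add: polar_proj_body_eq not_le)
  \<comment> \<open>The gap below N allows for the lower limit of the energies, the gap above 1 for
    the factor \<open>\<delta>\<close> powr (p (1 - s)).\<close>
  then obtain c where c: "1 < c" "c < N" using dense by blast
  then have "ennreal c < grad_energy p g \<xi>"
    using N by (simp add: ennreal_less_iff)
  then obtain \<delta> where \<delta>: "\<delta> > 0" "\<And>t. 0 < t \<Longrightarrow> t < \<delta> \<Longrightarrow> ennreal (c * t powr p) \<le> shift_energy p f (t *\<^sub>R \<xi>)"
    using shift_energy_ge_grad[OF f g p F G weak, of c \<xi>] c by auto
  have lower: "ennreal (c * \<delta> powr (p * (1 - s)) / (p * (1 - s))) \<le> frac_gauge_pow s p f \<xi>" if s: "s < 1" for s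
  proof -
    have "(\<integral>\<^sup>+t. (indicator {0<..<\<delta>} t * ennreal (t powr (p * (1 - s)) / t)) * ennreal c \<partial>lborel) \<le> frac_gauge_pow s p f \<xi>"
      unfolding frac_gauge_pow_eq_shift_energy
    proof (rule nn_integral_mono)
      fix t :: real
      show "indicator {0<..<\<delta>} t * ennreal (t powr (p * (1 - s)) / t) * ennreal c \<le>
        indicator {0<..} t * ennreal (t powr (- s * p) / t) * shift_energy p f (t *\<^sub>R \<xi>)"
      proof (cases "t \<in> {0<..<\<delta>}")
        case True
        have "ennreal (t powr (p * (1 - s)) / t) * ennreal c = ennreal (t powr (p * (1 - s)) / t * c)"
          using True by (intro ennreal_mult'[symmetric]) auto
        also have "t powr (p * (1 - s)) / t * c = t powr (- s * p) / t * (c * t powr p)"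
          using True by (simp add: powr_add[symmetric] algebra_simps)
        also have "ennreal \<dots> = ennreal (t powr (- s * p) / t) * ennreal (c * t powr p)"
          using True by (intro ennreal_mult') auto
        also have "\<dots> \<le> ennreal (t powr (- s * p) / t) * shift_energy p f (t *\<^sub>R \<xi>)"
          using True by (intro mult_left_mono \<delta>) auto
        finally show ?thesis using True by simp
      qed simp
    qed
    also have "(\<integral>\<^sup>+t. (indicator {0<..<\<delta>} t * ennreal (t powr (p * (1 - s)) / t)) * ennreal c \<partial>lborel) =
       ennreal (\<delta> powr (p * (1 - s)) / (p * (1 - s))) * ennreal c"
      using p s \<delta> by (subst nn_integral_multc) (auto simp: nn_integral_powr_head)
    finally show ?thesis using c p s by (simp add: ennreal_mult'[symmetric] mult.commute)
  qed
  have "((\<lambda>s. c * \<delta> powr (p * (1 - s))) \<longlongrightarrow> c * \<delta> powr (p * (1 - 1))) (at_left 1)"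
    using \<delta> by (intro tendsto_intros) auto
  then have "\<forall>\<^sub>F s in at_left 1. 1 < c * \<delta> powr (p * (1 - s))"
    using c \<delta> by (intro order_tendstoD(1)) auto
  moreover have "\<forall>\<^sub>F s in at_left (1::real). s < 1" by (simp add: eventually_at_filter)
  ultimately show ?thesis
  proof eventually_elim
    case (elim s)
    have "ennreal (1 / (p * (1 - s))) < ennreal (c * \<delta> powr (p * (1 - s)) / (p * (1 - s)))"
      using elim p by (intro ennreal_lessI divide_strict_right_mono) (auto intro!: divide_pos_pos mult_pos_pos)
    also note lower[OF elim(2)]
    finally show ?case by simp
  qed
qed

text \<open>Sandwich between dilates of the polar body \<open>?Q\<close> and the unions of
  \<open>B s\<close> with it. On \<open>?Q\<close> the indicator of the union is constantly 1, so
  pointwise convergence has to be checked only outside \<open>?Q\<close>.\<close>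

lemma normalized_body_tendsto:
  fixes f :: "'a::euclidean_space \<Rightarrow> real" and g :: "'a \<Rightarrow> 'a"
  assumes f [measurable]: "f \<in> borel_measurable borel" and g [measurable]: "g \<in> borel_measurable borel"
    and p: "p \<ge> 1"
    and F: "Lp_pow p f = ennreal F" "F > 0"
    and G: "\<And>z. grad_energy p g z < \<infinity>"
    and weak: "weak_gradient f g"
    and \<sigma>: "emeasure lborel (supp_set f) < \<infinity>"
    and P: "emeasure lborel (polar_proj_body p g) < \<infinity>"
  shows "((\<lambda>s. measure lborel {\<xi>. frac_gauge_pow s p f \<xi> \<le> ennreal (1 / (p * (1 - s)))})
    \<longlongrightarrow> measure lborel (polar_proj_body p g)) (at_left 1)"
proof -
  define B where "B s = {\<xi>. frac_gauge_pow s p f \<xi> \<le> ennreal (1 / (p * (1 - s)))}" for s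
  have Bm [measurable]: "B s \<in> sets borel" for s unfolding B_def by measurable
  let ?Q = "polar_proj_body p g"
  have F': "Lp_pow p f < \<infinity>" using F by simp
  obtain D where D [measurable]: "D \<in> sets borel" and D_fin: "emeasure lborel D < \<infinity>"
    and BD: "\<And>s. s \<in> {1/2<..<1} \<Longrightarrow> B s \<subseteq> D"
    using normalized_body_bound[OF f p F \<sigma>] unfolding B_def by blast
  have W_fin: "emeasure lborel (D \<union> ?Q) < \<infinity>"
    by (rule le_less_trans[OF emeasure_subadditive]) (use D_fin P in auto)
  have B_fin: "emeasure lborel (B s \<union> ?Q) < \<infinity>" if "s \<in> {1/2<..<1}" for s
    by (rule le_less_trans[OF emeasure_mono W_fin]) (use BD[OF that] in auto)
  have ev: "\<forall>\<^sub>F s in at_left 1. s \<in> {1/2<..<1::real}"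
    by (rule eventually_at_left_real) simp
  have upper: "((\<lambda>s. measure lborel (B s \<union> ?Q)) \<longlongrightarrow> measure lborel ?Q) (at_left 1)"
  proof (rule tendsto_at_left_sequentially[of "1/2"])
    fix S :: "nat \<Rightarrow> real"
    assume S: "\<And>n. S n < 1" "\<And>n. 1/2 < S n" "S \<longlonglongrightarrow> 1"
    have "filterlim S (at_left 1) sequentially"
      using S(1,3) less_imp_neq[OF S(1)] by (auto simp: filterlim_at intro!: always_eventually)
    have "(\<lambda>n. \<integral>\<xi>. indicator (B (S n) \<union> ?Q) \<xi> \<partial>lborel) \<longlonglongrightarrow> (\<integral>\<xi>. (indicator ?Q \<xi> :: real) \<partial>lborel)"
    proof (rule integral_dominated_convergence[where w = "indicator (D \<union> ?Q)"])
      show "integrable lborel (indicator (D \<union> ?Q) :: 'a \<Rightarrow> real)"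
        using W_fin by (intro integrable_real_indicator) auto
      show "AE \<xi> in lborel. norm (indicator (B (S n) \<union> ?Q) \<xi> :: real) \<le> indicator (D \<union> ?Q) \<xi>" for n
        using BD[of "S n"] S by (intro AE_I2) (auto split: split_indicator)
      show "AE \<xi> in lborel. (\<lambda>n. indicator (B (S n) \<union> ?Q) \<xi> :: real) \<longlonglongrightarrow> indicator ?Q \<xi>"
      proof (rule AE_I2)
        fix \<xi> :: 'a
        show "(\<lambda>n. indicator (B (S n) \<union> ?Q) \<xi> :: real) \<longlonglongrightarrow> indicator ?Q \<xi>"
        proof (cases "\<xi> \<in> ?Q")
          case False
          have "\<forall>\<^sub>F s in at_left 1. \<xi> \<notin> B s"
            using frac_gauge_pow_eventually_large[OF f g p F' G weak False] by (simp add: B_def)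
          then have "\<forall>\<^sub>F n in sequentially. \<xi> \<notin> B (S n)"
            using \<open>filterlim S (at_left 1) sequentially\<close> by (rule eventually_compose_filterlim)
          then have "\<forall>\<^sub>F n in sequentially. indicator (B (S n) \<union> ?Q) \<xi> = (indicator ?Q \<xi> :: real)"
            by eventually_elim (simp add: False)
          then show ?thesis by (rule tendsto_eventually)
        qed simp
      qed
    qed measurable
    then show "(\<lambda>n. measure lborel (B (S n) \<union> ?Q)) \<longlonglongrightarrow> measure lborel ?Q" by simp
  qed simp
  \<comment> \<open>The dilation factor of \<open>emeasure_frac_gauge_pow_sublevel_ge\<close> for c
    = 1 / (p (1 - s)): the product c p (1 - s) is 1, so the factor has limit 1.\<close>
  define \<mu> where "\<mu> s = (s * (2 powr p * F) powr (s - 1)) powr (1 / (s * p))" for s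
  have "(\<mu> \<longlongrightarrow> (1 * (2 powr p * F) powr (1 - 1)) powr (1 / (1 * p))) (at_left 1)"
    unfolding \<mu>_def using F p by (intro tendsto_intros) auto
  then have "((\<lambda>s. \<mu> s ^ DIM('a) * measure lborel ?Q) \<longlongrightarrow> 1 ^ DIM('a) * measure lborel ?Q) (at_left 1)"
    using F by (intro tendsto_intros) auto
  then have lower: "((\<lambda>s. \<mu> s ^ DIM('a) * measure lborel ?Q) \<longlongrightarrow> measure lborel ?Q) (at_left 1)" by simp
  have "((\<lambda>s. measure lborel (B s)) \<longlongrightarrow> measure lborel ?Q) (at_left 1)"
  proof (rule tendsto_sandwich[OF _ _ lower upper])
    show "\<forall>\<^sub>F s in at_left 1. \<mu> s ^ DIM('a) * measure lborel ?Q \<le> measure lborel (B s)"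
      using ev
    proof eventually_elim
      case (elim s)
      have s: "0 < s" "s < 1" using elim by auto
      have \<mu>0: "\<mu> s \<ge> 0" by (simp add: \<mu>_def)
      have "ennreal (\<mu> s ^ DIM('a)) * emeasure lborel ?Q \<le> emeasure lborel (B s)"
        unfolding B_def using p s
        by (intro emeasure_frac_gauge_pow_sublevel_ge[OF f g p s F G weak]) (auto simp: \<mu>_def mult.assoc)
      moreover have "emeasure lborel (B s) < \<infinity>"
        by (rule le_less_trans[OF emeasure_mono B_fin[OF elim]]) auto
      ultimately have "ennreal (\<mu> s ^ DIM('a) * measure lborel ?Q) \<le> ennreal (measure lborel (B s))"
        using P \<mu>0 by (simp add: emeasure_eq_ennreal_measure less_top ennreal_mult')
      then show ?case by (subst (asm) ennreal_le_iff) auto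
    qed
    show "\<forall>\<^sub>F s in at_left 1. measure lborel (B s) \<le> measure lborel (B s \<union> ?Q)"
      using ev
    proof eventually_elim
      case (elim s)
      show ?case using B_fin[OF elim] by (intro measure_mono_fmeasurable) (auto simp: fmeasurable_def)
    qed
  qed
  then show ?thesis by (simp add: B_def)
qed

text \<open>The normalised set is the dilate of the fractional body by r with r powr (s p) = 1 / (p
  (1 - s)). In the power - s / n of its volume this gives (p (1 - s)) powr (1 / p), the origin of p
  powr (- 1 / p) in the limit.\<close>

lemma frac_polar_tendsto_polar:
  fixes f :: "'a::euclidean_space \<Rightarrow> real" and g :: "'a \<Rightarrow> 'a"
  defines "n \<equiv> real DIM('a)"
  assumes f [measurable]: "f \<in> borel_measurable borel" and g [measurable]: "g \<in> borel_measurable borel"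
    and p: "p \<ge> 1"
    and F: "Lp_pow p f = ennreal F" "F > 0"
    and G: "\<And>z. grad_energy p g z < \<infinity>"
    and weak: "weak_gradient f g"
    and \<sigma>: "emeasure lborel (supp_set f) < \<infinity>"
    and P: "emeasure lborel (polar_proj_body p g) = ennreal P" "P > 0"
  shows "((\<lambda>s. (1 - s) powr (1 / p) * measure lborel (frac_polar_proj_body s p f) powr (- s / n))
    \<longlongrightarrow> p powr (- 1 / p) * P powr (- 1 / n)) (at_left 1)"
proof -
  have n: "n \<ge> 1" by (simp add: n_def DIM_positive Suc_leI)
  define y where "y s = measure lborel {\<xi>. frac_gauge_pow s p f \<xi> \<le> ennreal (1 / (p * (1 - s)))}" for s
  have mP: "measure lborel (polar_proj_body p g) = P" using P by (simp add: measure_def)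
  have "(y \<longlongrightarrow> P) (at_left 1)"
    unfolding y_def using normalized_body_tendsto[OF f g p F G weak \<sigma>] P mP by simp
  then have "((\<lambda>s. p powr (- 1 / p) * y s powr (- s / n)) \<longlongrightarrow> p powr (- 1 / p) * P powr (- 1 / n)) (at_left 1)"
    using P n by (intro tendsto_intros) auto
  moreover have "\<forall>\<^sub>F s in at_left 1. p powr (- 1 / p) * y s powr (- s / n) = (1 - s) powr (1 / p) * measure lborel (frac_polar_proj_body s p f) powr (- s / n)"
    using eventually_at_left_real[of 0 "1::real", OF zero_less_one]
  proof eventually_elim
    case (elim s)
    then have s: "0 < s" "s < 1" by auto
    define k where "k = measure lborel (frac_polar_proj_body s p f)"
    define r where "r = (1 / (p * (1 - s))) powr (1 / (s * p))"
    have q: "1 / (p * (1 - s)) > 0" using p s by simp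
    have r: "r > 0" "r powr (s * p) = 1 / (p * (1 - s))" using q p s by (auto simp: r_def powr_powr)
    have "y s = r ^ DIM('a) * k"
      using emeasure_frac_gauge_pow_sublevel[OF f r(1), of s p] r
      by (simp add: y_def k_def measure_def enn2real_mult)
    then have "y s = r powr n * k" using r by (simp add: n_def powr_realpow)
    then have "y s powr (- s / n) = r powr (- s) * k powr (- s / n)"
      using n r by (simp add: powr_mult powr_powr k_def)
    also have "r powr (- s) = (1 / (p * (1 - s))) powr (- (1 / p))"
      using s p by (simp add: r_def powr_powr)
    also have "\<dots> = p powr (1 / p) * (1 - s) powr (1 / p)"
      using p s by (simp add: powr_divide powr_mult powr_minus_divide)
    finally have "p powr (- 1 / p) * y s powr (- s / n) = (p powr (- 1 / p) * p powr (1 / p)) * ((1 - s) powr (1 / p) * k powr (- s / n))"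
      by simp
    also have "p powr (- 1 / p) * p powr (1 / p) = 1" using p by (simp add: powr_add[symmetric])
    finally show ?case by (simp add: k_def)
  qed
  ultimately show ?thesis by (rule Lim_transform_eventually)
qed

section \<open>Borel representatives\<close>

lemma emeasure_lebesgue_eq_lborel: "A \<in> sets borel \<Longrightarrow> emeasure lebesgue A = emeasure lborel A"
  using nn_integral_completion[of lborel "indicator A"] by simp

lemma smooth_fun_measurable:
  assumes "smooth_fun \<phi>"
  shows "\<phi> \<in> borel_measurable borel"
    and "i \<in> Basis \<Longrightarrow> (\<lambda>x. frechet_derivative \<phi> (at x) i) \<in> borel_measurable borel"
proof -
  have cont: "\<psi> \<in> borel_measurable borel" if "smooth_fun \<psi>" for \<psi> :: "'a \<Rightarrow> real"
    using that
    by (cases rule: smooth_fun.cases)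
       (auto intro!: borel_measurable_continuous_onI differentiable_imp_continuous_on simp: differentiable_on_def intro: differentiable_at_withinI)
  show "\<phi> \<in> borel_measurable borel" by (rule cont[OF assms])
  show "(\<lambda>x. frechet_derivative \<phi> (at x) i) \<in> borel_measurable borel" if "i \<in> Basis"
    using assms that by (cases rule: smooth_fun.cases) (auto intro: cont)
qed

lemma weak_gradient_cong_AE:
  fixes f f' :: "'a::euclidean_space \<Rightarrow> real" and g g' :: "'a \<Rightarrow> 'a"
  assumes weak: "weak_gradient f g"
    and [measurable]: "f \<in> borel_measurable lebesgue" "f' \<in> borel_measurable lebesgue"
      "g \<in> borel_measurable lebesgue" "g' \<in> borel_measurable lebesgue"
    and ae: "AE x in lborel. f x = f' x" "AE x in lborel. g x = g' x"
  shows "weak_gradient f' g'"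
  unfolding weak_gradient_def
proof (intro allI impI ballI)
  fix \<phi> :: "'a \<Rightarrow> real" and i :: 'a
  assume \<phi>: "test_fun \<phi>" and i: "i \<in> Basis"
  have "smooth_fun \<phi>" using \<phi> by (simp add: test_fun_def)
  then have [measurable]: "\<phi> \<in> borel_measurable lebesgue" "(\<lambda>x. frechet_derivative \<phi> (at x) i) \<in> borel_measurable lebesgue"
    using smooth_fun_measurable[of \<phi>] i by (auto intro: measurable_completion)
  have "(\<integral>x. f' x * frechet_derivative \<phi> (at x) i \<partial>lebesgue) = (\<integral>x. f x * frechet_derivative \<phi> (at x) i \<partial>lebesgue)"
    using AE_completion[OF ae(1)] by (intro integral_cong_AE) (measurable, auto)
  also have "\<dots> = - (\<integral>x. (g x \<bullet> i) * \<phi> x \<partial>lebesgue)"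
    using weak \<phi> i unfolding weak_gradient_def by blast
  also have "(\<integral>x. (g x \<bullet> i) * \<phi> x \<partial>lebesgue) = (\<integral>x. (g' x \<bullet> i) * \<phi> x \<partial>lebesgue)"
    using AE_completion[OF ae(2)] by (intro integral_cong_AE) (measurable, auto)
  finally show "(\<integral>x. f' x * frechet_derivative \<phi> (at x) i \<partial>lebesgue) = - (\<integral>x. (g' x \<bullet> i) * \<phi> x \<partial>lebesgue)" .
qed

lemma lebesgue_measurable_vector_ex_borel:
  fixes g :: "'a::euclidean_space \<Rightarrow> 'a"
  assumes g: "g \<in> borel_measurable lebesgue"
  shows "\<exists>g' \<in> borel_measurable borel. AE x in lborel. g x = g' x"
proof -
  have "\<forall>i\<in>Basis. \<exists>h. h \<in> borel_measurable borel \<and> (AE x in lborel. g x \<bullet> i = h x)"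
  proof
    fix i :: 'a
    have "(\<lambda>x. g x \<bullet> i) \<in> borel_measurable lebesgue" using g by measurable
    from completion_ex_borel_measurable_real[OF this]
    show "\<exists>h. h \<in> borel_measurable borel \<and> (AE x in lborel. g x \<bullet> i = h x)" by auto
  qed
  then obtain h where h: "\<And>i. i \<in> Basis \<Longrightarrow> h i \<in> borel_measurable borel" "\<And>i. i \<in> Basis \<Longrightarrow> AE x in lborel. g x \<bullet> i = h i x"
    using bchoice[of Basis "\<lambda>i h. h \<in> borel_measurable borel \<and> (AE x in lborel. g x \<bullet> i = h x)"] by blast
  let ?g = "\<lambda>x. \<Sum>i\<in>Basis. h i x *\<^sub>R i"
  have gm: "?g \<in> borel_measurable borel" using h(1) by (intro borel_measurable_sum borel_measurable_scaleR) auto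
  have "AE x in lborel. \<forall>i\<in>Basis. g x \<bullet> i = h i x"
    using h(2) by (intro AE_finite_allI) auto
  then have "AE x in lborel. g x = ?g x"
  proof eventually_elim
    case (elim x)
    have "g x = (\<Sum>i\<in>Basis. (g x \<bullet> i) *\<^sub>R i)" by (simp add: euclidean_representation)
    then show ?case using elim by simp
  qed
  then show ?thesis using gm by (intro bexI[of _ ?g])
qed

text \<open>A change of f on a null set alters no shift energy at any z, so the fractional bodies
  agree as sets, not merely up to null sets. A Borel representative gives access to Fubini over
  \<open>lborel\<close>.\<close>

lemma Lp_fun_borel_representative:
  fixes f :: "'a::euclidean_space \<Rightarrow> real"
  assumes "Lp_fun p f"
  obtains f' where "f' \<in> borel_measurable borel" "AE x in lborel. f x = f' x"
    "Lp_pow p f' < \<infinity>"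
    "emeasure lebesgue (supp_set f) = emeasure lborel (supp_set f')"
    "\<forall>s. frac_polar_proj_body s p f = frac_polar_proj_body s p f'"
    "\<forall>s. gagliardo s p f = gagliardo s p f'"
proof -
  have f [measurable]: "f \<in> borel_measurable lebesgue" and int: "integrable lebesgue (\<lambda>x. \<bar>f x\<bar> powr p)"
    using assms by (auto simp: Lp_fun_def)
  obtain f' where f' [measurable]: "f' \<in> borel_measurable borel" and ae: "AE x in lborel. f x = f' x"
    using completion_ex_borel_measurable_real[OF f] by auto
  have "Lp_pow p f' = (\<integral>\<^sup>+x. ennreal (\<bar>f x\<bar> powr p) \<partial>lebesgue)"
    unfolding nn_integral_completion using ae by (intro nn_integral_cong_AE) auto
  also have "\<dots> < \<infinity>" using int by (simp add: integrable_iff_bounded)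
  finally have fin: "Lp_pow p f' < \<infinity>" .
  have "emeasure lebesgue (supp_set f) = emeasure lebesgue (supp_set f')"
  proof (rule emeasure_eq_AE)
    show "AE x in lebesgue. x \<in> supp_set f \<longleftrightarrow> x \<in> supp_set f'"
      using AE_completion[OF ae] by eventually_elim (simp add: supp_set_def)
    have "{x \<in> space lebesgue. f x \<noteq> 0} \<in> sets lebesgue" by measurable
    then show "supp_set f \<in> sets lebesgue" by (simp add: supp_set_def)
    have "supp_set f' \<in> sets borel" unfolding supp_set_def by measurable
    then show "supp_set f' \<in> sets lebesgue" by (simp add: sets_completionI_sets)
  qed
  also have "\<dots> = emeasure lborel (supp_set f')"
    by (rule emeasure_lebesgue_eq_lborel) (unfold supp_set_def, measurable)
  finally have supp: "emeasure lebesgue (supp_set f) = emeasure lborel (supp_set f')" .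
  have body: "frac_polar_proj_body s p f = frac_polar_proj_body s p f'" for s
    by (simp add: frac_polar_proj_body_def frac_gauge_pow_cong_AE[OF ae])
  have gag: "gagliardo s p f = gagliardo s p f'" for s
    unfolding gagliardo_def nn_integral_completion
  proof (rule nn_integral_cong_AE)
    show "AE x in lborel. (\<integral>\<^sup>+y. ennreal (\<bar>f x - f y\<bar> powr p / norm (x - y) powr (s * p + real DIM('a))) \<partial>lborel) =
       (\<integral>\<^sup>+y. ennreal (\<bar>f' x - f' y\<bar> powr p / norm (x - y) powr (s * p + real DIM('a))) \<partial>lborel)"
      using ae
    proof eventually_elim
      case (elim x)
      show ?case using ae elim by (intro nn_integral_cong_AE) auto
    qed
  qed
  show thesis by (rule that[OF f' ae fin supp]) (auto simp: body gag)
qed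

lemma Lp_norm_pos:
  fixes f :: "'a::euclidean_space \<Rightarrow> real"
  assumes [measurable]: "f \<in> borel_measurable borel"
    and fin: "Lp_pow p f < \<infinity>" and pos: "emeasure lborel (supp_set f) > 0"
  shows "\<exists>F>0. Lp_pow p f = ennreal F"
proof -
  obtain F where F: "F \<ge> 0" "Lp_pow p f = ennreal F"
    using fin by (cases "Lp_pow p f") auto
  have "F \<noteq> 0"
  proof
    assume "F = 0"
    then have "AE x in lborel. ennreal (\<bar>f x\<bar> powr p) = 0"
      using F by (subst nn_integral_0_iff_AE[symmetric]) auto
    then have "AE x in lborel. x \<notin> supp_set f"
      by eventually_elim (simp add: supp_set_def)
    moreover have "supp_set f \<in> sets lborel" unfolding supp_set_def by measurable
    ultimately have "emeasure lborel (supp_set f) = 0"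
      by (metis AE_iff_null_sets null_setsD1)
    then show False using pos by simp
  qed
  then show ?thesis using F by (intro exI[of _ F]) auto
qed

text \<open>Supplies the positive finite reals F, \<open>\<sigma>\<close> and P on which the
  estimates for (b) and (c) operate; P is finite by \<open>affine_poincare\<close> and positive
  because the polar body contains a ball.\<close>

lemma W1p_grad_borel_representative:
  fixes f :: "'a::euclidean_space \<Rightarrow> real" and g :: "'a \<Rightarrow> 'a"
  assumes W: "W1p_grad p f g" and p: "p \<ge> 1"
    and pos: "emeasure lebesgue (supp_set f) > 0" and fin: "emeasure lebesgue (supp_set f) < \<infinity>"
  obtains f' :: "'a \<Rightarrow> real" and g' :: "'a \<Rightarrow> 'a" and F \<sigma> P where "f' \<in> borel_measurable borel" "g' \<in> borel_measurable borel"
    "Lp_pow p f' = ennreal F" "F > 0"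
    "\<forall>z. grad_energy p g' z < \<infinity>" "weak_gradient f' g'"
    "emeasure lborel (supp_set f') = ennreal \<sigma>" "\<sigma> > 0"
    "emeasure lborel (polar_proj_body p g') = ennreal P" "P > 0"
    "vol (supp_set f) = \<sigma>" "vol (polar_proj_body p g) = P"
    "\<forall>s. vol (frac_polar_proj_body s p f) = measure lborel (frac_polar_proj_body s p f')"
proof -
  have Lp: "Lp_fun p f" and g: "g \<in> borel_measurable lebesgue" and weak: "weak_gradient f g"
    and gp: "integrable lebesgue (\<lambda>x. norm (g x) powr p)"
    using W by (auto simp: W1p_grad_def)
  obtain f' where f' [measurable]: "f' \<in> borel_measurable borel" and aef: "AE x in lborel. f x = f' x"
    and F': "Lp_pow p f' < \<infinity>"
    and supp: "emeasure lebesgue (supp_set f) = emeasure lborel (supp_set f')"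
    and body: "\<forall>s. frac_polar_proj_body s p f = frac_polar_proj_body s p f'" and "\<forall>s. gagliardo s p f = gagliardo s p f'"
    by (rule Lp_fun_borel_representative[OF Lp])
  obtain g' where g' [measurable]: "g' \<in> borel_measurable borel" and aeg: "AE x in lborel. g x = g' x"
    using lebesgue_measurable_vector_ex_borel[OF g] by blast
  have "(\<integral>\<^sup>+x. ennreal (norm (g' x) powr p) \<partial>lborel) = (\<integral>\<^sup>+x. ennreal (norm (g x) powr p) \<partial>lebesgue)"
    unfolding nn_integral_completion using aeg by (intro nn_integral_cong_AE) auto
  also have "\<dots> < \<infinity>" using gp by (simp add: integrable_iff_bounded)
  finally have g'_fin: "(\<integral>\<^sup>+x. ennreal (norm (g' x) powr p) \<partial>lborel) < \<infinity>" .
  have G: "grad_energy p g' z < \<infinity>" for z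
  proof -
    have "grad_energy p g' z \<le> (\<integral>\<^sup>+x. ennreal (norm z powr p) * ennreal (norm (g' x) powr p) \<partial>lborel)"
    proof (rule nn_integral_mono)
      fix x
      have "\<bar>g' x \<bullet> z\<bar> powr p \<le> (norm z * norm (g' x)) powr p"
        using p Cauchy_Schwarz_ineq2[of "g' x" z] by (intro powr_mono2) (auto simp: mult.commute)
      then show "ennreal (\<bar>g' x \<bullet> z\<bar> powr p) \<le> ennreal (norm z powr p) * ennreal (norm (g' x) powr p)"
        by (simp add: powr_mult ennreal_mult'[symmetric])
    qed
    also have "\<dots> = ennreal (norm z powr p) * (\<integral>\<^sup>+x. ennreal (norm (g' x) powr p) \<partial>lborel)"
      by (rule nn_integral_cmult) measurable
    also have "\<dots> < \<infinity>" using g'_fin by (simp add: ennreal_mult_less_top)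
    finally show ?thesis .
  qed
  have weak': "weak_gradient f' g'"
    using Lp by (intro weak_gradient_cong_AE[OF weak _ _ g _ aef aeg]) (auto simp: Lp_fun_def intro: measurable_completion)
  obtain F where F: "F > 0" "Lp_pow p f' = ennreal F"
    using Lp_norm_pos[OF f' F'] pos by (auto simp: supp)
  obtain \<sigma> where \<sigma>: "\<sigma> > 0" "emeasure lborel (supp_set f') = ennreal \<sigma>"
    using pos fin by (cases "emeasure lborel (supp_set f')") (auto simp: supp)
  have "ennreal (((F / 2) powr (1 / p)) ^ DIM('a)) * emeasure lborel (polar_proj_body p g') \<le> 2 * emeasure lborel (supp_set f')"
    by (rule affine_poincare[OF f' g' p F(2,1) G weak'])
  also have "\<dots> < \<infinity>" by (simp add: \<sigma> ennreal_mult_less_top)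
  finally have "emeasure lborel (polar_proj_body p g') < \<infinity>"
    using F by (auto simp: ennreal_mult_less_top)
  moreover have "emeasure lborel (polar_proj_body p g') > 0"
    by (rule emeasure_polar_proj_body_pos[OF g' p g'_fin])
  ultimately obtain P where P: "P > 0" "emeasure lborel (polar_proj_body p g') = ennreal P"
    by (cases "emeasure lborel (polar_proj_body p g')") auto
  have body_eq: "polar_proj_body p g = polar_proj_body p g'"
  proof -
    have "grad_energy p g \<xi> = grad_energy p g' \<xi>" for \<xi>
      using aeg by (intro nn_integral_cong_AE) auto
    then show ?thesis by (simp add: polar_proj_body_eq)
  qed
  have v1: "vol (supp_set f) = \<sigma>" using \<sigma> by (simp add: vol_def measure_def supp)
  have v2: "vol (polar_proj_body p g) = P"
    using P by (simp add: vol_def measure_def body_eq emeasure_lebesgue_eq_lborel[OF polar_proj_body_sets[OF g']])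
  have v3: "vol (frac_polar_proj_body s p f) = measure lborel (frac_polar_proj_body s p f')" for s
    by (simp add: vol_def measure_def body emeasure_lebesgue_eq_lborel[OF frac_polar_proj_body_sets[OF f']])
  show thesis
    by (rule that[OF f' g' F(2,1) _ weak' \<sigma>(2,1) P(2,1) v1 v2]) (use G v3 in auto)
qed

theorem theorem1p5:
  fixes p :: real
  assumes "DIM('a::euclidean_space) \<ge> 2" and "p > real DIM('a)"
  shows
   "(\<forall>s0 \<in> {real DIM('a) / p <..< 1}. \<exists>C::real. \<forall>s \<in> {s0<..<1}. \<forall>f :: 'a \<Rightarrow> real.
        W_frac s p f \<and> emeasure lebesgue (supp_set f) < \<infinity> \<longrightarrow>
        Linf_norm f \<le> ereal (C * vol (supp_set f) powr (s / DIM('a) - 1 / p) * (1 - s) powr (1 / p)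
                               * vol (frac_polar_proj_body s p f) powr (- s / DIM('a)))) \<and>
    (\<exists>c::real. \<forall>(f :: 'a \<Rightarrow> real) g s. W1p_grad p f g \<and> emeasure lebesgue (supp_set f) > 0 \<and>
        emeasure lebesgue (supp_set f) < \<infinity> \<and> s \<in> {0<..<1} \<longrightarrow>
        (s * (1 - s)) powr (1 / p) * vol (supp_set f) powr (s / DIM('a))
          * vol (frac_polar_proj_body s p f) powr (- s / DIM('a))
        \<le> c * vol (supp_set f) powr (1 / DIM('a)) * vol (polar_proj_body p g) powr (- 1 / DIM('a))) \<and>
    (\<forall>(f :: 'a \<Rightarrow> real) g. W1p_grad p f g \<and> emeasure lebesgue (supp_set f) > 0 \<and>
        emeasure lebesgue (supp_set f) < \<infinity> \<longrightarrow>
        ((\<lambda>s. (1 - s) powr (1 / p) * vol (supp_set f) powr (s / DIM('a) - 1 / p)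
               * vol (frac_polar_proj_body s p f) powr (- s / DIM('a)))
         \<longlongrightarrow> p powr (- 1 / p) * vol (supp_set f) powr (1 / DIM('a) - 1 / p)
               * vol (polar_proj_body p g) powr (- 1 / DIM('a))) (at_left 1))"
  (is "?A \<and> ?B \<and> ?C")
proof (intro conjI)
  let ?n = "real DIM('a)"
  have n: "?n \<ge> 1" by (simp add: DIM_positive Suc_leI)
  have p: "p \<ge> 1" using n assms(2) by linarith
  show ?A
  proof
    fix s0
    assume s0: "s0 \<in> {?n / p<..<1}"
    \<comment> \<open>Fixed before s and f: it contains only n, p and s0.\<close>
    let ?C = "2 * (2 powr ?n * 2 powr p * 2 powr p * (3 * 4 powr p * p)) powr (1 / p) * (1 + 1 / (1 - 2 powr (- (s0 - ?n / p))))"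
    have bound: "Linf_norm f \<le> ereal (?C * vol (supp_set f) powr (s / ?n - 1 / p) * (1 - s) powr (1 / p) * vol (frac_polar_proj_body s p f) powr (- s / ?n))"
      if s: "s \<in> {s0<..<1}" and W: "W_frac s p f" and fin: "emeasure lebesgue (supp_set f) < \<infinity>" for s and f :: "'a \<Rightarrow> real"
    proof -
      have Lp: "Lp_fun p f" and gag: "gagliardo s p f < \<infinity>" using W by (auto simp: W_frac_def)
      have "?n / p > 0" using n p by simp
      then have s': "0 < s" "s < 1" using s s0 by auto
      obtain f' where f' [measurable]: "f' \<in> borel_measurable borel" and ae: "AE x in lborel. f x = f' x"
        and F': "Lp_pow p f' < \<infinity>"
        and supp: "emeasure lebesgue (supp_set f) = emeasure lborel (supp_set f')"
        and body: "\<forall>s. frac_polar_proj_body s p f = frac_polar_proj_body s p f'"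
        and gag': "\<forall>s. gagliardo s p f = gagliardo s p f'"
        by (rule Lp_fun_borel_representative[OF Lp])
      have ess: "Linf_norm f \<le> ereal S" if "AE x in lborel. \<bar>f' x\<bar> \<le> S" for S
        unfolding Linf_norm_def
      proof (rule esssup_I)
        show "(\<lambda>x. ereal \<bar>f x\<bar>) \<in> borel_measurable lebesgue" using Lp by (auto simp: Lp_fun_def)
        have "AE x in lborel. ereal \<bar>f x\<bar> \<le> ereal S" using ae that by eventually_elim simp
        then show "AE x in lebesgue. ereal \<bar>f x\<bar> \<le> ereal S" by (rule AE_completion)
      qed
      have vb: "vol (frac_polar_proj_body s p f) = measure lborel (frac_polar_proj_body s p f')"
        by (simp add: vol_def measure_def body emeasure_lebesgue_eq_lborel[OF frac_polar_proj_body_sets[OF f']])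
      obtain \<sigma> where \<sigma>: "\<sigma> \<ge> 0" "emeasure lborel (supp_set f') = ennreal \<sigma>"
        using fin by (cases "emeasure lborel (supp_set f')") (auto simp: supp)
      have vs: "vol (supp_set f) = \<sigma>" using \<sigma> by (simp add: vol_def measure_def supp)
      show ?thesis
      \<comment> \<open>\<open>fractional_morrey\<close> assumes a support of positive measure. If
        it is null, f vanishes almost everywhere and the right side is 0, because 0
        \<open>powr\<close> any exponent is 0.\<close>
      proof (cases "\<sigma> = 0")
        case True
        have "supp_set f' \<in> sets lborel" unfolding supp_set_def by measurable
        then have "supp_set f' \<in> null_sets lborel" using \<sigma> True by (simp add: null_sets_def)
        from AE_not_in[OF this] have "AE x in lborel. \<bar>f' x\<bar> \<le> 0"
          by eventually_elim (simp add: supp_set_def)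
        from ess[OF this] show ?thesis using True by (simp add: vs)
      next
        case False
        then have \<sigma>0: "\<sigma> > 0" using \<sigma> by simp
        obtain F where F: "F > 0" "Lp_pow p f' = ennreal F"
          using Lp_norm_pos[OF f' F'] \<sigma>0 \<sigma> by auto
        have "emeasure lborel (frac_polar_proj_body s p f') < \<infinity>"
          using \<sigma> by (intro emeasure_frac_polar_proj_body_finite[OF f' p s' F(2,1)]) auto
        moreover have "emeasure lborel (frac_polar_proj_body s p f') > 0"
          using gag s' p by (intro emeasure_frac_polar_proj_body_pos[OF f']) (auto simp: gag')
        ultimately obtain k where k: "emeasure lborel (frac_polar_proj_body s p f') = ennreal k" "k > 0"
          by (cases "emeasure lborel (frac_polar_proj_body s p f')") auto
        have vk: "vol (frac_polar_proj_body s p f) = k" using k by (simp add: vb measure_def)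
        show ?thesis
          unfolding vs vk using s s0 assms(2)
          by (intro ess fractional_morrey[OF f' _ _ _ _ F' \<sigma>(2) \<sigma>0 k]) auto
      qed
    qed
    show "\<exists>C::real. \<forall>s \<in> {s0<..<1}. \<forall>f :: 'a \<Rightarrow> real.
        W_frac s p f \<and> emeasure lebesgue (supp_set f) < \<infinity> \<longrightarrow>
        Linf_norm f \<le> ereal (C * vol (supp_set f) powr (s / ?n - 1 / p) * (1 - s) powr (1 / p)
                               * vol (frac_polar_proj_body s p f) powr (- s / ?n))"
      by (intro exI[of _ ?C] ballI allI impI) (rule bound; simp)
  qed
  show ?B
  proof (intro exI[of _ 8] allI impI)
    fix f :: "'a \<Rightarrow> real" and g :: "'a \<Rightarrow> 'a" and s :: real
    assume *: "W1p_grad p f g \<and> emeasure lebesgue (supp_set f) > 0 \<and> emeasure lebesgue (supp_set f) < \<infinity> \<and> s \<in> {0<..<1}"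
    then have W: "W1p_grad p f g" and pos: "emeasure lebesgue (supp_set f) > 0" and fin: "emeasure lebesgue (supp_set f) < \<infinity>" and s: "0 < s" "s < 1"
      by auto
    obtain f' :: "'a \<Rightarrow> real" and g' :: "'a \<Rightarrow> 'a" and F \<sigma> P where f': "f' \<in> borel_measurable borel" and g': "g' \<in> borel_measurable borel"
      and F: "Lp_pow p f' = ennreal F" "F > 0"
      and G: "\<forall>z. grad_energy p g' z < \<infinity>" and weak: "weak_gradient f' g'"
      and \<sigma>: "emeasure lborel (supp_set f') = ennreal \<sigma>" "\<sigma> > 0"
      and P: "emeasure lborel (polar_proj_body p g') = ennreal P" "P > 0"
      and v: "vol (supp_set f) = \<sigma>" "vol (polar_proj_body p g) = P"
        "\<forall>s. vol (frac_polar_proj_body s p f) = measure lborel (frac_polar_proj_body s p f')"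
      by (rule W1p_grad_borel_representative[OF W p pos fin])
    have "emeasure lborel (frac_polar_proj_body s p f') < \<infinity>"
      using \<sigma> by (intro emeasure_frac_polar_proj_body_finite[OF f' p s F]) auto
    then have k: "emeasure lborel (frac_polar_proj_body s p f') = ennreal (measure lborel (frac_polar_proj_body s p f'))"
      by (intro emeasure_eq_ennreal_measure) auto
    show "(s * (1 - s)) powr (1 / p) * vol (supp_set f) powr (s / ?n) * vol (frac_polar_proj_body s p f) powr (- s / ?n)
        \<le> 8 * vol (supp_set f) powr (1 / ?n) * vol (polar_proj_body p g) powr (- 1 / ?n)"
      unfolding v(1,2) v(3)[rule_format] by (rule frac_polar_le_polar[OF f' g' p s F G[rule_format] weak \<sigma> P k]) simp
  qed
  show ?C
  proof (intro allI impI)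
    fix f :: "'a \<Rightarrow> real" and g :: "'a \<Rightarrow> 'a"
    assume *: "W1p_grad p f g \<and> emeasure lebesgue (supp_set f) > 0 \<and> emeasure lebesgue (supp_set f) < \<infinity>"
    then have W: "W1p_grad p f g" and pos: "emeasure lebesgue (supp_set f) > 0" and fin: "emeasure lebesgue (supp_set f) < \<infinity>"
      by auto
    obtain f' :: "'a \<Rightarrow> real" and g' :: "'a \<Rightarrow> 'a" and F \<sigma> P where f': "f' \<in> borel_measurable borel" and g': "g' \<in> borel_measurable borel"
      and F: "Lp_pow p f' = ennreal F" "F > 0"
      and G: "\<forall>z. grad_energy p g' z < \<infinity>" and weak: "weak_gradient f' g'"
      and \<sigma>: "emeasure lborel (supp_set f') = ennreal \<sigma>" "\<sigma> > 0"
      and P: "emeasure lborel (polar_proj_body p g') = ennreal P" "P > 0"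
      and v: "vol (supp_set f) = \<sigma>" "vol (polar_proj_body p g) = P"
        "\<forall>s. vol (frac_polar_proj_body s p f) = measure lborel (frac_polar_proj_body s p f')"
      by (rule W1p_grad_borel_representative[OF W p pos fin])
    have "((\<lambda>s. (1 - s) powr (1 / p) * measure lborel (frac_polar_proj_body s p f') powr (- s / ?n)) \<longlongrightarrow> p powr (- 1 / p) * P powr (- 1 / ?n)) (at_left 1)"
      using \<sigma> by (intro frac_polar_tendsto_polar[OF f' g' p F G[rule_format] weak _ P]) auto
    moreover have "((\<lambda>s. \<sigma> powr (s / ?n - 1 / p)) \<longlongrightarrow> \<sigma> powr (1 / ?n - 1 / p)) (at_left 1)"
      using \<sigma> n p by (intro tendsto_intros) auto
    ultimately have "((\<lambda>s. \<sigma> powr (s / ?n - 1 / p) * ((1 - s) powr (1 / p) * measure lborel (frac_polar_proj_body s p f') powr (- s / ?n)))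
       \<longlongrightarrow> \<sigma> powr (1 / ?n - 1 / p) * (p powr (- 1 / p) * P powr (- 1 / ?n))) (at_left 1)"
      by (rule tendsto_mult[rotated])
    then show "((\<lambda>s. (1 - s) powr (1 / p) * vol (supp_set f) powr (s / ?n - 1 / p) * vol (frac_polar_proj_body s p f) powr (- s / ?n))
         \<longlongrightarrow> p powr (- 1 / p) * vol (supp_set f) powr (1 / ?n - 1 / p) * vol (polar_proj_body p g) powr (- 1 / ?n)) (at_left 1)"
      unfolding v(1,2) v(3)[rule_format] by (simp add: mult_ac)
  qed
qed

end
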